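(* Let $\omega_1$ be the first uncountable ordinal and equip the ordinal interval $[0,\omega_1]$ with its order topology. Then $[0,\omega_1]$ admits local compensation, and therefore $C([0,\omega_1])$ has the Bishop-Phelps-Bollobás (BPB) property for numerical radius.
   Context: All Banach spaces are real. For a compact Hausdorff space $K$, $C(K)$ is the Banach space of continuous real-valued functions on $K$ with the supremum norm; its dual is identified with $\mathcal{M}(K)$, the space of regular Borel signed measures on $K$ with the total variation norm, and $B_{\mathcal{M}(K)}$ is its closed unit ball. $\omega^*$ denotes the weak$^*$ topology of $\mathcal{M}(K)=C(K)^*$. For $\mu\in\mathcal{M}(K)$, $\mu^+$ is its positive part. $\nu\in\mathcal{M}(K)$ is a compensation of $\mu\in\mathcal{M}(K)$ if: $0\le\nu\le\mu^+$ and $\nu(K)=\mu(K)$ in case $\mu(K)>0$; and $\nu=0$ in case $\mu(K)\le 0$. $W(K)$ is the set of all $\omega^*$-continuous functions $F\colon K\to B_{\mathcal{M}(K)}$. $G\in W(K)$ is a compensation of $F\in W(K)$ if $G(t)$ is a compensation of $F(t)$ for every $t\in K$. $K$ admits local compensation if every element of $W(K)$ admits a compensation (in $W(K)$). For a Banach space $X$, $\mathfrak{L}(X)$ is the space of bounded linear operators $X\to X$, $\Pi(X)=\{(x,x^* )\in S_X\times S_{X^*}\colon x^*(x)=1\}$ (where $S$ denotes unit spheres), and the numerical radius of $T\in\mathfrak{L}(X)$ is $\nu(T)=\sup\{|x^*(T(x))|\colon (x,x^* )\in\Pi(X)\}$. $X$ has the BPB property for numerical radius if there is a function $\delta\colon(0,1)\to(0,1)$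 such that: for every $0<\varepsilon<1$, every $T\in\mathfrak{L}(X)$ with $\nu(T)=1$ and every $(x,x^* )\in\Pi(X)$ with $x^*(T(x))\ge 1-\delta(\varepsilon)$, there exist $T_0\in\mathfrak{L}(X)$ with $\nu(T_0)=1$ and $(x_0,x_0^* )\in\Pi(X)$ with $x_0^*(T_0(x_0))=1$ such that $\nu(T-T_0)\le\varepsilon$, $\|x-x_0\|\le\varepsilon$ and $\|x^*-x_0^*\|\le\varepsilon$. *)

theory Defs
  imports "HOL-Analysis.Analysis" "HOL-Library.Countable_Set_Type"
begin

class compact_t2_space = t2_space +
  assumes compact_UNIV: "compact UNIV"

section \<open>The ordinal interval \<open>[0, \<omega>\<^sub>1]\<close>\<close>

text \<open>
  The well-order \<^term>\<open>cardSuc natLeq\<close> is the initial ordinal of the first uncountable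
  cardinal; its field, so ordered, is \<open>[0, \<omega>\<^sub>1)\<close>. The interval \<open>[0, \<omega>\<^sub>1]\<close> is
  obtained by adding a greatest element.
\<close>

typedef countable_ordinal = "Field (cardSuc natLeq)"
proof -
  have "infinite (Field (cardSuc natLeq))"
    using cardSuc_finite[OF natLeq_Card_order] infinite_UNIV_nat by (simp only: Field_natLeq) simp
  then show ?thesis
    by (metis ex_in_conv finite.emptyI)
qed

lemma Well_order_cardSuc_natLeq: "Well_order (cardSuc natLeq)"
  using cardSuc_Card_order natLeq_Card_order card_order_on_well_order_on by blast

instantiation countable_ordinal :: wellorder
begin

definition less_eq_countable_ordinal :: "countable_ordinal \<Rightarrow> countable_ordinal \<Rightarrow> bool" where
  "a \<le> b \<longleftrightarrow> (Rep_countable_ordinal a, Rep_countable_ordinal b) \<in> cardSuc natLeq"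

definition less_countable_ordinal :: "countable_ordinal \<Rightarrow> countable_ordinal \<Rightarrow> bool" where
  "a < b \<longleftrightarrow> a \<le> b \<and> a \<noteq> (b :: countable_ordinal)"

instance
proof -
  have wo: "Well_order (cardSuc natLeq)"
    by (rule Well_order_cardSuc_natLeq)
  then have refl: "Refl (cardSuc natLeq)" and trans: "trans (cardSuc natLeq)"
    and antisym: "antisym (cardSuc natLeq)" and total: "Total (cardSuc natLeq)"
    and wf: "wf (cardSuc natLeq - Id)"
    by (simp_all add: well_order_on_def linear_order_on_def partial_order_on_def preorder_on_def)
  have anti: "a \<le> b \<Longrightarrow> b \<le> a \<Longrightarrow> a = b" for a b :: countable_ordinal
    using antisym unfolding less_eq_countable_ordinal_def antisym_def
    by (metis Rep_countable_ordinal_inject)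
  have "wfP ((<) :: countable_ordinal \<Rightarrow> countable_ordinal \<Rightarrow> bool)"
    unfolding wfp_def
    by (rule wf_subset[OF wf_inv_image[OF wf, of Rep_countable_ordinal]])
      (auto simp: inv_image_def less_countable_ordinal_def less_eq_countable_ordinal_def
        Rep_countable_ordinal_inject)
  then have ind: "P a" if "\<And>x. (\<And>y. y < x \<Longrightarrow> P y) \<Longrightarrow> P x"
    for P and a :: countable_ordinal
    by (induction a rule: wfp_induct_rule) (rule that)
  show "OFCLASS(countable_ordinal, wellorder_class)"
  proof
    fix x y z :: countable_ordinal
    show "x < y \<longleftrightarrow> x \<le> y \<and> \<not> y \<le> x"
      using anti by (auto simp: less_countable_ordinal_def)
    show "x \<le> x"
      using refl Rep_countable_ordinal[of x]
      by (auto simp: less_eq_countable_ordinal_def refl_on_def)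
    then show "x \<le> y \<or> y \<le> x"
      using total Rep_countable_ordinal[of x] Rep_countable_ordinal[of y]
      unfolding less_eq_countable_ordinal_def total_on_def by metis
    show "x \<le> y \<Longrightarrow> y \<le> z \<Longrightarrow> x \<le> z"
      using trans unfolding less_eq_countable_ordinal_def trans_def by blast
    show "x \<le> y \<Longrightarrow> y \<le> x \<Longrightarrow> x = y"
      by (rule anti)
  next
    fix P :: "countable_ordinal \<Rightarrow> bool" and a :: countable_ordinal
    assume "\<And>x. (\<And>y. y < x \<Longrightarrow> P y) \<Longrightarrow> P x"
    then show "P a"
      by (rule ind)
  qed
qed

end

datatype omega1_interval = Ord countable_ordinal | Omega1

instantiation omega1_interval :: wellorder
begin

fun less_eq_omega1_interval :: "omega1_interval \<Rightarrow> omega1_interval \<Rightarrow> bool" where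
  "x \<le> Omega1 \<longleftrightarrow> True"
| "Omega1 \<le> Ord b \<longleftrightarrow> False"
| "Ord a \<le> Ord b \<longleftrightarrow> a \<le> b"

definition less_omega1_interval :: "omega1_interval \<Rightarrow> omega1_interval \<Rightarrow> bool" where
  "x < y \<longleftrightarrow> x \<le> y \<and> x \<noteq> (y :: omega1_interval)"

instance
proof
  fix x y z :: omega1_interval
  show "x < y \<longleftrightarrow> x \<le> y \<and> \<not> y \<le> x"
    by (cases x; cases y) (auto simp: less_omega1_interval_def)
  show "x \<le> x"
    by (cases x) auto
  show "x \<le> y \<Longrightarrow> y \<le> z \<Longrightarrow> x \<le> z"
    by (cases x; cases y; cases z) auto
  show "x \<le> y \<Longrightarrow> y \<le> x \<Longrightarrow> x = y"
    by (cases x; cases y) auto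
  show "x \<le> y \<or> y \<le> x"
    by (cases x; cases y) auto
next
  fix P :: "omega1_interval \<Rightarrow> bool" and a :: omega1_interval
  assume step: "\<And>x. (\<And>y. y < x \<Longrightarrow> P y) \<Longrightarrow> P x"
  have *: "P (Ord b)" for b
  proof (induction b rule: less_induct)
    case (less b)
    show ?case
    proof (rule step)
      fix y assume "y < Ord b"
      then show "P y"
        using less by (cases y) (auto simp: less_omega1_interval_def)
    qed
  qed
  have "P Omega1"
  proof (rule step)
    fix y assume "y < Omega1"
    then show "P y"
      using * by (cases y) (auto simp: less_omega1_interval_def)
  qed
  with * show "P a"
    by (cases a) auto
qed

end

instantiation omega1_interval :: linorder_topology
begin

definition open_omega1_interval :: "omega1_interval set \<Rightarrow> bool" where
  "open_omega1_interval = generate_topology (range (\<lambda>a. {..<a}) \<union> range (\<lambda>a. {a<..}))"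

instance
  by standard (rule open_omega1_interval_def)

end

text \<open>
  The next three facts pin down the well-order \<^typ>\<open>omega1_interval\<close> up to isomorphism.
\<close>

lemma le_Omega1: "x \<le> Omega1"
  by simp

lemma countable_below_Omega1:
  includes cardinal_syntax
  assumes "x < Omega1"
  shows "countable {..<x}"
proof -
  obtain b where b: "x = Ord b"
    using assms by (cases x) (auto simp: less_omega1_interval_def)
  let ?r = "cardSuc natLeq" and ?b = "Rep_countable_ordinal b"
  have "|underS ?r ?b| <o ?r"
    by (rule card_of_underS[OF cardSuc_Card_order[OF natLeq_Card_order] Rep_countable_ordinal])
  then have "|underS ?r ?b| \<le>o natLeq"
    by (simp only: cardSuc_ordLeq_ordLess[OF natLeq_Card_order card_of_Card_order])
  then have "countable (underS ?r ?b)"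
    by (simp only: countable_card_le_natLeq)
  moreover have "{..<x} \<subseteq> (\<lambda>u. Ord (Abs_countable_ordinal u)) ` underS ?r ?b"
  proof
    fix y assume "y \<in> {..<x}"
    then obtain a where a: "y = Ord a" "a \<le> b" "a \<noteq> b"
      by (cases y) (auto simp: less_omega1_interval_def b)
    then have "Rep_countable_ordinal a \<in> underS ?r ?b"
      by (auto simp: underS_def less_eq_countable_ordinal_def Rep_countable_ordinal_inject)
    then show "y \<in> (\<lambda>u. Ord (Abs_countable_ordinal u)) ` underS ?r ?b"
      by (rule rev_image_eqI) (simp add: a Rep_countable_ordinal_inverse)
  qed
  ultimately show ?thesis
    by (rule countable_subset[OF _ countable_image, rotated])
qed

lemma uncountable_below_Omega1:
  includes cardinal_syntax
  shows "uncountable {..<Omega1}"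
proof
  assume c: "countable {..<Omega1}"
  let ?r = "cardSuc natLeq"
  have "inj_on (\<lambda>u. Ord (Abs_countable_ordinal u)) (Field ?r)"
    by (auto simp: inj_on_def Abs_countable_ordinal_inject)
  moreover have "(\<lambda>u. Ord (Abs_countable_ordinal u)) ` Field ?r \<subseteq> {..<Omega1}"
    by (auto simp: less_omega1_interval_def)
  ultimately have "countable (Field ?r)"
    by (rule countable_image_inj_on[OF countable_subset[OF _ c], rotated])
  then have "|Field ?r| \<le>o natLeq"
    by (simp only: countable_card_le_natLeq)
  then have "?r \<le>o natLeq"
    by (rule ordIso_ordLeq_trans[OF ordIso_symmetric[OF
          card_of_Field_ordIso[OF cardSuc_Card_order[OF natLeq_Card_order]]]])
  then show False
    using not_ordLess_ordLeq[OF cardSuc_greater[OF natLeq_Card_order]] by (rule notE[rotated])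
qed

lemma compact_omega1_interval: "compact (UNIV :: omega1_interval set)"
proof -
  have "\<exists>D\<subseteq>C. finite D \<and> {..x} \<subseteq> \<Union>D"
    if C: "\<forall>U\<in>C. open U" "UNIV \<subseteq> \<Union>C" for x :: omega1_interval and C
  proof (induction x rule: less_induct)
    case (less x)
    obtain U where U: "U \<in> C" "x \<in> U"
      using C(2) by blast
    show ?case
    proof (cases "\<exists>y. y < x")
      case False
      then have "{..x} \<subseteq> \<Union>{U}"
        using U(2) by (auto simp: order_le_less)
      then show ?thesis
        using U(1) by (intro exI[of _ "{U}"]) auto
    next
      case True
      then obtain y where y: "y < x" "{y<..x} \<subseteq> U"
        using open_left[of U x] U C(1) by blast
      obtain D where D: "D \<subseteq> C" "finite D" "{..y} \<subseteq> \<Union>D"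
        using less[OF y(1)] by blast
      have "{..x} \<subseteq> {..y} \<union> {y<..x}"
        by (auto simp: not_le)
      also have "\<dots> \<subseteq> \<Union>(insert U D)"
        using D(3) y(2) by blast
      finally show ?thesis
        using D(1,2) U(1) by (intro exI[of _ "insert U D"]) simp
    qed
  qed
  moreover have "{..Omega1} = UNIV"
    by auto
  ultimately show ?thesis
    unfolding compact_eq_Heine_Borel by (metis (no_types))
qed

instance omega1_interval :: compact_t2_space
  by standard (rule compact_omega1_interval)


section \<open>Regular Borel signed measures and the weak* topology\<close>

text \<open>
  A signed measure is a real-valued set function; only its values on Borel sets matter, and it is
  required to vanish elsewhere, so that equality of measures is equality of functions.
\<close>

definition signed_measure :: "('k::topological_space set \<Rightarrow> real) \<Rightarrow> bool" where
  "signed_measure \<mu> \<longleftrightarrow>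
     (\<forall>A. A \<notin> sets borel \<longrightarrow> \<mu> A = 0) \<and>
     (\<forall>A :: nat \<Rightarrow> 'k set. range A \<subseteq> sets borel \<longrightarrow> disjoint_family A \<longrightarrow>
        (\<lambda>i. \<mu> (A i)) sums \<mu> (\<Union>i. A i))"

definition pos_part :: "('k::topological_space set \<Rightarrow> real) \<Rightarrow> 'k set \<Rightarrow> real" where
  "pos_part \<mu> A = (if A \<in> sets borel then SUP B\<in>{B \<in> sets borel. B \<subseteq> A}. \<mu> B else 0)"

definition neg_part :: "('k::topological_space set \<Rightarrow> real) \<Rightarrow> 'k set \<Rightarrow> real" where
  "neg_part \<mu> = pos_part (\<lambda>A. - \<mu> A)"

definition variation :: "('k::topological_space set \<Rightarrow> real) \<Rightarrow> 'k set \<Rightarrow> real" where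
  "variation \<mu> A = pos_part \<mu> A + neg_part \<mu> A"

definition regular :: "('k::topological_space set \<Rightarrow> real) \<Rightarrow> bool" where
  "regular \<mu> \<longleftrightarrow>
     (\<forall>A\<in>sets borel. \<forall>\<epsilon>>0. \<exists>C U. compact C \<and> open U \<and> C \<subseteq> A \<and> A \<subseteq> U \<and> variation \<mu> (U - C) < \<epsilon>)"

definition regular_measures :: "('k::topological_space set \<Rightarrow> real) set" where
  "regular_measures = {\<mu>. signed_measure \<mu> \<and> regular \<mu>}"

definition unit_ball_measures :: "('k::topological_space set \<Rightarrow> real) set" where
  "unit_ball_measures = {\<mu> \<in> regular_measures. variation \<mu> UNIV \<le> 1}"

text \<open>The pairing between \<open>M(K)\<close> and \<open>C(K)\<close>.\<close>

definition signed_integral ::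
    "('k::topological_space set \<Rightarrow> real) \<Rightarrow> ('k \<Rightarrow> real) \<Rightarrow> real" where
  "signed_integral \<mu> f =
     (\<integral>x. f x \<partial>measure_of UNIV (sets borel) (\<lambda>A. ennreal (pos_part \<mu> A))) -
     (\<integral>x. f x \<partial>measure_of UNIV (sets borel) (\<lambda>A. ennreal (neg_part \<mu> A)))"

text \<open>
  For compact \<open>K\<close> the type \<open>'k \<Rightarrow>\<^sub>C real\<close> of bounded continuous functions
  is \<open>C(K)\<close> with the supremum norm.
\<close>

definition weak_star_topology :: "('k::topological_space set \<Rightarrow> real) topology" where
  "weak_star_topology = topology_generated_by
     {{\<mu> \<in> regular_measures. signed_integral \<mu> (apply_bcontfun f) \<in> U} |
        (f :: 'k \<Rightarrow>\<^sub>C real) U. open U}"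


section \<open>Local compensation\<close>

definition compensation_measure ::
    "('k::topological_space set \<Rightarrow> real) \<Rightarrow> ('k set \<Rightarrow> real) \<Rightarrow> bool" where
  "compensation_measure \<mu> \<nu> \<longleftrightarrow>
     \<nu> \<in> regular_measures \<and>
     (if \<mu> UNIV > 0
      then (\<forall>A\<in>sets borel. 0 \<le> \<nu> A \<and> \<nu> A \<le> pos_part \<mu> A) \<and> \<nu> UNIV = \<mu> UNIV
      else \<nu> = (\<lambda>A. 0))"

definition W :: "('k::topological_space \<Rightarrow> 'k set \<Rightarrow> real) set" where
  "W = {F. continuous_map euclidean (subtopology weak_star_topology unit_ball_measures) F}"

definition compensation ::
    "('k::topological_space \<Rightarrow> 'k set \<Rightarrow> real) \<Rightarrow> ('k \<Rightarrow> 'k set \<Rightarrow> real) \<Rightarrow> bool" where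
  "compensation F G \<longleftrightarrow> (\<forall>t. compensation_measure (F t) (G t))"

definition admits_local_compensation :: "'k::compact_t2_space itself \<Rightarrow> bool" where
  "admits_local_compensation _ \<longleftrightarrow>
     (\<forall>F\<in>W :: ('k \<Rightarrow> 'k set \<Rightarrow> real) set. \<exists>G\<in>W. compensation F G)"


section \<open>The Bishop-Phelps-Bollobas property for numerical radius\<close>

text \<open>
  The library declares \<open>'k \<Rightarrow>\<^sub>C 'b\<close> complete for metric \<open>'k\<close> only; here
  \<open>'k\<close> is an arbitrary topological space.
\<close>

instance bcontfun :: (topological_space, complete_space) complete_space
proof
  fix f :: "nat \<Rightarrow> ('a, 'b) bcontfun"
  assume "Cauchy f"
  then obtain g where "uniform_limit UNIV f g sequentially"
    using uniformly_convergent_eq_cauchy[of "\<lambda>_. True" f]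
    unfolding Cauchy_def uniform_limit_sequentially_iff
    by (metis dist_fun_lt_imp_dist_val_lt)
  from uniform_limit_bcontfunE[OF this sequentially_bot]
  obtain l' where "g = apply_bcontfun l'" "(f \<longlonglongrightarrow> l')" by metis
  then show "convergent f"
    by (intro convergentI)
qed

instance bcontfun :: (topological_space, banach) banach ..

definition states :: "('x::real_normed_vector \<times> ('x \<Rightarrow>\<^sub>L real)) set" where
  "states = {(x, x'). norm x = 1 \<and> norm x' = 1 \<and> blinfun_apply x' x = 1}"

definition numerical_radius :: "('x::real_normed_vector \<Rightarrow>\<^sub>L 'x) \<Rightarrow> real" where
  "numerical_radius T =
     (SUP (x, x')\<in>states. \<bar>blinfun_apply x' (blinfun_apply T x)\<bar>)"

definition BPB_numerical_radius :: "'x::banach itself \<Rightarrow> bool" where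
  "BPB_numerical_radius _ \<longleftrightarrow>
     (\<exists>\<delta> :: real \<Rightarrow> real.
        (\<forall>\<epsilon>\<in>{0<..<1}. \<delta> \<epsilon> \<in> {0<..<1}) \<and>
        (\<forall>\<epsilon>\<in>{0<..<1}. \<forall>(T :: 'x \<Rightarrow>\<^sub>L 'x) x x'.
           numerical_radius T = 1 \<longrightarrow> (x, x') \<in> states \<longrightarrow>
           blinfun_apply x' (blinfun_apply T x) \<ge> 1 - \<delta> \<epsilon> \<longrightarrow>
           (\<exists>(T0 :: 'x \<Rightarrow>\<^sub>L 'x) x0 x0'.
              numerical_radius T0 = 1 \<and> (x0, x0') \<in> states \<and>
              blinfun_apply x0' (blinfun_apply T0 x0) = 1 \<and>
              numerical_radius (T - T0) \<le> \<epsilon> \<and> norm (x - x0) \<le> \<epsilon> \<and> norm (x' - x0') \<le> \<epsilon>)))"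

end

theory Submission
  imports Defs
begin

text \<open>
  Every regular measure on \<open>[0, \<omega>\<^sub>1]\<close> is atomic, so a weak* continuous function into the unit
  ball is a family of summable functions \<open>a t\<close> for which the sums over clopen sets are continuous
  in \<open>t\<close>.

  If countably many clopen sets separate the atoms, a compensation is given explicitly: refine the
  clopen partitions step by step and pass the positive part of the total mass down the resulting
  binary tree, each time in proportion to the positive parts of the masses of the two halves. As
  the mass passed down never exceeds the sum of these two positive parts, the result is dominated
  by the positive part of the measure, and it depends continuously on the masses of the cells.

  On \<open>[0, \<omega>\<^sub>1]\<close> one countable tree does not suffice. For large \<open>t\<close> the measure
  \<open>a t\<close> consists of a constant part and a part that moves to \<open>\<omega>\<^sub>1\<close>. By a closing-off argument
  there are unboundedly many cuts \<open>c\<close> such that the moving part has left \<open>[0, c)\<close> from time \<open>c\<close> on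
  and charges nothing in \<open>[c, \<omega>\<^sub>1)\<close> before. A separate tree is used between consecutive
  cuts, and continuity at limits of cuts is automatic.

  For the BPB property, operators and functionals on \<open>C([0, \<omega>\<^sub>1])\<close> are represented by
  summable families, and the numerical radius of an operator is its norm. If \<open>x'(T x)\<close> is close
  to 1, replace \<open>x\<close> by its sign near the set where it is almost extremal. At those \<open>t\<close> with \<open>|T x(t)|\<close> close to 1
  the measure of \<open>T\<close> at \<open>t\<close> is almost positive after multiplication by this sign and that of
  \<open>T x(t)\<close>; compensating and normalizing it gives an operator attaining its numerical radius.
\<close>

section \<open>Summable real functions\<close>

text \<open>The positive part of a measure is not weak* continuous: atoms of opposite sign may merge
  and cancel in the limit. Only masses of clopen sets are continuous, so a compensation has to be
  built from these alone. No countable family of clopen sets separates the points, since each clopen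
  set contains or misses a whole tail of the countable ordinals. What helps is that countable sets
  of countable ordinals are bounded and that continuous real functions are constant near
  \<open>Omega1\<close>.

  Cuts may accumulate, and trees change infinitely often there. Every tree begins by splitting
  \<open>{..k}\<close> from the rest, which holds only \<open>Omega1\<close>; the share of
  \<open>Omega1\<close> therefore depends on the total mass and the atom at \<open>Omega1\<close>
  but not on the tree, and at an accumulation point this share determines all limits.

  In the BPB modulus \<open>(\<epsilon>\<^sup>2 / 36)\<^sup>2\<close> the outer square is lost when
  a functional is restricted to the points where \<open>T x\<close> is nearly extremal. The inner
  one is lost because mass at points where \<open>x\<close> stays \<open>\<epsilon> / 2\<close> away
  from 1 and -1 is controlled only up to a factor \<open>2 / \<epsilon>\<close>.\<close>

lemma summable_on_UNIV_subset:
  fixes a :: "'k \<Rightarrow> real"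
  assumes "a summable_on UNIV"
  shows "a summable_on S"
  by (rule summable_on_subset_banach[OF assms]) simp

lemma summable_on_abs_iff:
  fixes a :: "'k \<Rightarrow> real"
  shows "(\<lambda>x. \<bar>a x\<bar>) summable_on S \<longleftrightarrow> a summable_on S"
  using summable_on_iff_abs_summable_on_real[of a S] by simp

lemma summable_on_dominated:
  fixes a b :: "'k \<Rightarrow> real"
  assumes "b summable_on S" "\<And>x. x \<in> S \<Longrightarrow> \<bar>a x\<bar> \<le> b x"
  shows "a summable_on S"
  using summable_on_comparison_test[OF assms(1), of "\<lambda>x. \<bar>a x\<bar>"] assms(2)
  by (simp add: summable_on_abs_iff)

lemma summable_on_pos_part:
  fixes a :: "'k \<Rightarrow> real"
  assumes "a summable_on S"
  shows "(\<lambda>x. max 0 (a x)) summable_on S"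
  by (rule summable_on_dominated[of "\<lambda>x. \<bar>a x\<bar>"]) (use assms in \<open>auto simp: summable_on_abs_iff\<close>)

lemma summable_on_mult_bounded:
  fixes a f :: "'k \<Rightarrow> real"
  assumes "a summable_on S" "\<And>x. x \<in> S \<Longrightarrow> \<bar>f x\<bar> \<le> M"
  shows "(\<lambda>x. a x * f x) summable_on S"
proof (rule summable_on_dominated)
  show "(\<lambda>x. \<bar>a x\<bar> * M) summable_on S"
    using assms(1) by (intro summable_on_cmult_left) (simp add: summable_on_abs_iff)
  show "\<bar>a x * f x\<bar> \<le> \<bar>a x\<bar> * M" if "x \<in> S" for x
    using assms(2)[OF that] by (simp add: abs_mult mult_left_mono)
qed

lemma infsum_abs_bound:
  fixes a :: "'k \<Rightarrow> real"
  assumes "a summable_on S"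
  shows "\<bar>infsum a S\<bar> \<le> infsum (\<lambda>x. \<bar>a x\<bar>) S"
  using norm_infsum_bound[of a S] assms by (simp add: summable_on_abs_iff)

lemma infsum_subset_mono:
  fixes a :: "'k \<Rightarrow> real"
  assumes "a summable_on B" "A \<subseteq> B" "\<And>x. x \<in> B \<Longrightarrow> 0 \<le> a x"
  shows "infsum a A \<le> infsum a B"
proof (rule infsum_mono_neutral)
  show "a summable_on A" by (rule summable_on_subset_banach[OF assms(1,2)])
  show "a summable_on B" by (rule assms(1))
qed (use assms(2,3) in auto)

lemma infsum_split:
  fixes a :: "'k \<Rightarrow> real"
  assumes "a summable_on S"
  shows "infsum a S = infsum a (S \<inter> A) + infsum a (S - A)"
proof -
  have "infsum a ((S \<inter> A) \<union> (S - A)) = infsum a (S \<inter> A) + infsum a (S - A)"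
    by (rule infsum_Un_disjoint) (rule summable_on_subset_banach[OF assms], blast, rule summable_on_subset_banach[OF assms], blast+)
  then show ?thesis by (simp only: Int_Diff_Un)
qed

lemma infsum_abs_split:
  fixes a :: "'k \<Rightarrow> real"
  assumes "a summable_on S"
  shows "infsum (\<lambda>x. \<bar>a x\<bar>) S = infsum (\<lambda>x. max 0 (a x)) S + infsum (\<lambda>x. max 0 (- a x)) S"
proof -
  have "infsum (\<lambda>x. \<bar>a x\<bar>) S = infsum (\<lambda>x. max 0 (a x) + max 0 (- a x)) S"
    by (rule infsum_cong) linarith
  also have "\<dots> = infsum (\<lambda>x. max 0 (a x)) S + infsum (\<lambda>x. max 0 (- a x)) S"
    using assms by (intro infsum_add summable_on_pos_part) (simp_all only: summable_on_uminus)
  finally show ?thesis .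
qed

lemma infsum_le_pos_part:
  fixes a :: "'k \<Rightarrow> real"
  assumes "a summable_on S"
  shows "infsum a S \<le> infsum (\<lambda>x. max 0 (a x)) S"
  using assms summable_on_pos_part[OF assms] by (rule infsum_mono) simp

lemma infsum_as_integral:
  fixes a :: "'k \<Rightarrow> real"
  assumes "a summable_on S"
  shows "integrable (count_space S) a" "infsum a S = integral\<^sup>L (count_space S) a"
proof -
  have "Infinite_Set_Sum.abs_summable_on a S"
    using assms summable_on_abs_iff[of a S] by (simp add: abs_summable_equivalent[symmetric])
  then show "integrable (count_space S) a" "infsum a S = integral\<^sup>L (count_space S) a"
    by (simp_all add: Infinite_Set_Sum.abs_summable_on_def infsetsum_infsum[symmetric] infsetsum_def)
qed

text \<open>Sums are integrals over the counting measure, so this is Lebesgue's theorem. It yields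
  countable additivity of atomic measures and the limits along branches of the tree.\<close>

lemma infsum_dominated_convergence:
  fixes f :: "nat \<Rightarrow> 'k \<Rightarrow> real"
  assumes b: "b summable_on S" and bound: "\<And>n x. x \<in> S \<Longrightarrow> \<bar>f n x\<bar> \<le> b x"
    and lim: "\<And>x. x \<in> S \<Longrightarrow> (\<lambda>n. f n x) \<longlonglongrightarrow> g x"
  shows "(\<lambda>n. infsum (f n) S) \<longlonglongrightarrow> infsum g S"
proof -
  have f: "f n summable_on S" for n
    using b bound by (rule summable_on_dominated)
  have "\<bar>g x\<bar> \<le> b x" if "x \<in> S" for x
    by (rule LIMSEQ_le_const2[OF tendsto_rabs[OF lim[OF that]]]) (use bound[OF that] in blast)
  with b have g: "g summable_on S"
    by (rule summable_on_dominated)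
  have "(\<lambda>n. integral\<^sup>L (count_space S) (f n)) \<longlonglongrightarrow> integral\<^sup>L (count_space S) g"
    by (rule integral_dominated_convergence[where w = b])
      (use infsum_as_integral(1)[OF b] lim bound in \<open>auto simp: AE_count_space\<close>)
  then show ?thesis
    using infsum_as_integral(2)[OF f] infsum_as_integral(2)[OF g] by simp
qed

lemma summable_on_small_tail:
  fixes a :: "'k \<Rightarrow> real"
  assumes "a summable_on UNIV" "\<epsilon> > 0"
  obtains X where "finite X" "\<And>S. S \<inter> X = {} \<Longrightarrow> infsum (\<lambda>x. \<bar>a x\<bar>) S < \<epsilon>"
proof -
  let ?b = "\<lambda>x. \<bar>a x\<bar>"
  have b: "?b summable_on UNIV" using assms(1) by (simp add: summable_on_abs_iff)
  have "\<epsilon> / 2 > 0" using assms(2) by simp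
  from infsum_finite_approximation[OF b this]
  obtain X where X: "finite X" "dist (sum ?b X) (infsum ?b UNIV) \<le> \<epsilon> / 2"
    by blast
  have "infsum ?b S < \<epsilon>" if "S \<inter> X = {}" for S
  proof -
    have "infsum ?b S \<le> infsum ?b (- X)"
      using that by (intro infsum_subset_mono summable_on_UNIV_subset[OF b]) auto
    also have "\<dots> = infsum ?b UNIV - sum ?b X"
      using infsum_split[OF b, of X] X(1) by (simp add: Compl_eq_Diff_UNIV)
    finally show ?thesis using X(2) assms(2) unfolding dist_real_def by linarith
  qed
  with X(1) show ?thesis by (rule that)
qed

lemma summable_on_abs_bounded:
  fixes a :: "'k \<Rightarrow> real"
  assumes "\<And>X. finite X \<Longrightarrow> (\<Sum>x\<in>X. \<bar>a x\<bar>) \<le> M"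
  shows "a summable_on UNIV" "infsum (\<lambda>x. \<bar>a x\<bar>) UNIV \<le> M"
proof -
  have "(\<lambda>x. \<bar>a x\<bar>) summable_on UNIV"
    by (rule nonneg_bdd_above_summable_on) (use assms in \<open>auto intro!: bdd_aboveI[where M = M]\<close>)
  then show "a summable_on UNIV" by (simp only: summable_on_abs_iff)
  show "infsum (\<lambda>x. \<bar>a x\<bar>) UNIV \<le> M"
    by (rule infsum_le_finite_sums) (fact, rule assms)
qed

section \<open>Atomic signed measures\<close>

text \<open>The value 0 off the Borel sets is what \<open>signed_measure\<close> demands.\<close>

definition atomic_measure :: "('k::topological_space \<Rightarrow> real) \<Rightarrow> 'k set \<Rightarrow> real" where
  "atomic_measure a A = (if A \<in> sets borel then infsum a A else 0)"

lemma atomic_measure_uminus: "(\<lambda>A. - atomic_measure a A) = atomic_measure (\<lambda>x. - a x)"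
  by (auto simp: atomic_measure_def infsum_uminus)

lemma countable_sets_borel:
  assumes "countable (A :: 'k::t1_space set)"
  shows "A \<in> sets borel"
  using assms by (rule sets.countable[rotated]) (simp add: borel_closed)

text \<open>The supremum is attained where \<open>a\<close> is positive, a countable and hence Borel
  set.\<close>

lemma pos_part_atomic_measure:
  fixes a :: "'k::t1_space \<Rightarrow> real"
  assumes a: "a summable_on UNIV" and A: "A \<in> sets borel"
  shows "pos_part (atomic_measure a) A = infsum (\<lambda>x. max 0 (a x)) A"
proof -
  let ?P = "A \<inter> {x. a x > 0}"
  have "countable {x \<in> UNIV. a x \<noteq> 0}"
    using a by (rule summable_countable_real)
  then have "countable ?P"
    by (rule countable_subset[rotated]) auto
  then have P: "?P \<in> sets borel" by (rule countable_sets_borel)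
  have eq: "atomic_measure a ?P = infsum (\<lambda>x. max 0 (a x)) A"
    using P by (auto simp: atomic_measure_def max_def not_less intro!: infsum_cong_neutral split: if_splits)
  have "infsum a B \<le> infsum (\<lambda>x. max 0 (a x)) A" if "B \<subseteq> A" for B
    using that by (intro infsum_mono_neutral summable_on_pos_part summable_on_UNIV_subset[OF a]) auto
  then have "(SUP B\<in>{B \<in> sets borel. B \<subseteq> A}. atomic_measure a B) = atomic_measure a ?P"
    unfolding eq
  proof (intro cSup_eq_maximum)
    show "infsum (\<lambda>x. max 0 (a x)) A \<in> atomic_measure a ` {B \<in> sets borel. B \<subseteq> A}"
      using P eq by (intro image_eqI[of _ _ ?P]) auto
  qed (auto simp: atomic_measure_def)
  then show ?thesis using A eq by (simp add: pos_part_def)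
qed

lemma neg_part_atomic_measure:
  fixes a :: "'k::t1_space \<Rightarrow> real"
  assumes a: "a summable_on UNIV" and A: "A \<in> sets borel"
  shows "neg_part (atomic_measure a) A = infsum (\<lambda>x. max 0 (- a x)) A"
  unfolding neg_part_def atomic_measure_uminus
  by (rule pos_part_atomic_measure) (use a A in \<open>auto simp: summable_on_uminus\<close>)

lemma variation_atomic_measure:
  fixes a :: "'k::t1_space \<Rightarrow> real"
  assumes a: "a summable_on UNIV" and A: "A \<in> sets borel"
  shows "variation (atomic_measure a) A = infsum (\<lambda>x. \<bar>a x\<bar>) A"
  using summable_on_UNIV_subset[OF a, of A]
  by (simp add: variation_def pos_part_atomic_measure[OF a A] neg_part_atomic_measure[OF a A]
      infsum_abs_split)

lemma infsum_disjoint_sums: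
  fixes a :: "'k \<Rightarrow> real"
  assumes a: "a summable_on UNIV" and A: "disjoint_family A"
  shows "(\<lambda>i. infsum a (A i)) sums infsum a (\<Union>i. A i)"
proof -
  have "(\<lambda>n. infsum (\<lambda>x. if x \<in> (\<Union>i<n. A i) then a x else 0) UNIV)
      \<longlonglongrightarrow> infsum (\<lambda>x. if x \<in> (\<Union>i. A i) then a x else 0) UNIV"
  proof (rule infsum_dominated_convergence[where b = "\<lambda>x. \<bar>a x\<bar>"])
    show "(\<lambda>n. if x \<in> (\<Union>i<n. A i) then a x else 0) \<longlonglongrightarrow> (if x \<in> (\<Union>i. A i) then a x else 0)" for x
    proof (cases "x \<in> (\<Union>i. A i)")
      case True
      then obtain i where "x \<in> A i" by blast
      then have "\<forall>\<^sub>F n in sequentially. x \<in> (\<Union>i<n. A i)"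
        by (intro eventually_sequentiallyI[of "Suc i"]) auto
      then have "\<forall>\<^sub>F n in sequentially. (if x \<in> (\<Union>i<n. A i) then a x else 0) = a x"
        by (rule eventually_mono) simp
      then show ?thesis
        using True by (simp only: tendsto_eventually if_True)
    qed auto
  qed (use a in \<open>auto simp: summable_on_abs_iff\<close>)
  moreover have "infsum (\<lambda>x. if x \<in> (\<Union>i<n. A i) then a x else 0) UNIV = (\<Sum>i<n. infsum a (A i))" for n
  proof -
    have "infsum (\<lambda>x. if x \<in> (\<Union>i<n. A i) then a x else 0) UNIV = infsum a (\<Union>i<n. A i)"
      by (rule infsum_cong_neutral) auto
    also have "\<dots> = (\<Sum>i<n. infsum a (A i))"
      by (rule sum_infsum[symmetric])
        (use A summable_on_UNIV_subset[OF a] in \<open>auto simp: disjoint_family_on_def\<close>)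
    finally show ?thesis .
  qed
  moreover have "infsum (\<lambda>x. if x \<in> (\<Union>i. A i) then a x else 0) UNIV = infsum a (\<Union>i. A i)"
    by (rule infsum_cong_neutral) auto
  ultimately show ?thesis by (simp add: sums_def)
qed

lemma signed_measure_atomic_measure:
  fixes a :: "'k::topological_space \<Rightarrow> real"
  assumes a: "a summable_on UNIV"
  shows "signed_measure (atomic_measure a)"
proof -
  have "(\<lambda>i. atomic_measure a (A i)) sums atomic_measure a (\<Union>i. A i)"
    if "range A \<subseteq> sets borel" "disjoint_family A" for A :: "nat \<Rightarrow> 'k set"
  proof -
    have "A i \<in> sets borel" for i using that(1) by auto
    then show ?thesis
      using infsum_disjoint_sums[OF a that(2)] by (simp add: atomic_measure_def sets.countable_UN)
  qed
  then show ?thesis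
    by (auto simp: signed_measure_def atomic_measure_def)
qed

text \<open>A finite set \<open>X\<close> carries all but \<epsilon> of the mass. Its points in
  \<open>A\<close> form the compact set, and deleting its points outside \<open>A\<close> gives the
  open set; the difference of the two misses \<open>X\<close>.\<close>

lemma atomic_measure_regular:
  fixes a :: "'k::t1_space \<Rightarrow> real"
  assumes a: "a summable_on UNIV"
  shows "atomic_measure a \<in> regular_measures"
proof -
  have "\<exists>C U. compact C \<and> open U \<and> C \<subseteq> A \<and> A \<subseteq> U \<and> variation (atomic_measure a) (U - C) < \<epsilon>"
    if \<epsilon>: "\<epsilon> > 0" for A \<epsilon>
  proof -
    obtain X where X: "finite X" "\<And>S. S \<inter> X = {} \<Longrightarrow> infsum (\<lambda>x. \<bar>a x\<bar>) S < \<epsilon>"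
      using summable_on_small_tail[OF a \<epsilon>] by metis
    have "open (- (X - A))" "compact (X \<inter> A)"
      using X(1) by (auto simp: open_closed intro!: finite_imp_closed finite_imp_compact)
    moreover have "variation (atomic_measure a) (- (X - A) - X \<inter> A) < \<epsilon>"
      using X \<open>open (- (X - A))\<close> countable_sets_borel[OF countable_finite, of "X \<inter> A"]
      by (subst variation_atomic_measure[OF a]) (auto simp del: Compl_Diff_eq intro!: X(2))
    ultimately show ?thesis
      by (intro exI[of _ "X \<inter> A"] exI[of _ "- (X - A)"]) auto
  qed
  then show ?thesis
    using signed_measure_atomic_measure[OF a] by (auto simp: regular_measures_def regular_def)
qed

section \<open>Integration against atomic measures\<close>

lemma nn_integral_count_space_ennreal:
  fixes b :: "'k \<Rightarrow> real"
  assumes "b summable_on A" "\<And>x. 0 \<le> b x"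
  shows "(\<integral>\<^sup>+x. ennreal (b x) * indicator A x \<partial>count_space UNIV) = ennreal (infsum b A)"
proof -
  have "(\<integral>\<^sup>+x. ennreal (b x) * indicator A x \<partial>count_space UNIV) = (\<integral>\<^sup>+x. ennreal (b x) \<partial>count_space A)"
    by (subst nn_integral_count_space_indicator) auto
  also have "\<dots> = ennreal (infsum b A)"
    using assms by (subst nn_integral_eq_integral) (simp_all add: infsum_as_integral)
  finally show ?thesis .
qed

text \<open>On Borel sets the set function agrees with the counting measure of density
  \<open>b\<close>. That measure lives on all subsets, so it is first transported to the Borel sets
  by the identity.\<close>

lemma integral_summable_weights:
  fixes b f :: "'k::topological_space \<Rightarrow> real"
  assumes b: "b summable_on UNIV" and nonneg: "\<And>x. 0 \<le> b x" and f: "continuous_on UNIV f"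
    and bounded: "\<And>x. \<bar>f x\<bar> \<le> M"
    and m: "\<And>A. A \<in> sets borel \<Longrightarrow> m A = infsum b A"
  shows "(\<integral>x. f x \<partial>measure_of UNIV (sets borel) (\<lambda>A. ennreal (m A))) = infsum (\<lambda>x. b x * f x) UNIV"
proof -
  let ?D = "density (count_space UNIV) (\<lambda>x. ennreal (b x))"
  let ?N = "distr ?D borel (\<lambda>x. x)"
  have id: "(\<lambda>x. x) \<in> measurable ?D borel" by simp
  have "emeasure ?N A = ennreal (m A)" if "A \<in> sets borel" for A
    using that nn_integral_count_space_ennreal[OF summable_on_UNIV_subset[OF b] nonneg]
    by (subst emeasure_distr) (simp_all add: emeasure_density m)
  then have "measure_of UNIV (sets borel) (\<lambda>A. ennreal (m A)) = measure_of (space ?N) (sets ?N) (emeasure ?N)"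
    using sets.sigma_sets_eq[of "borel :: 'k measure"]
    by (simp only: space_distr sets_distr space_borel) (intro measure_of_eq, simp_all)
  also have "\<dots> = ?N" by (rule measure_of_of_measure)
  finally have "(\<integral>x. f x \<partial>measure_of UNIV (sets borel) (\<lambda>A. ennreal (m A))) = (\<integral>x. f x \<partial>?N)" by simp
  also have "\<dots> = (\<integral>x. f x \<partial>?D)"
    using f by (intro integral_distr) (auto intro: borel_measurable_continuous_onI)
  also have "\<dots> = (\<integral>x. b x * f x \<partial>count_space UNIV)"
    using nonneg by (subst integral_density) auto
  also have "\<dots> = infsum (\<lambda>x. b x * f x) UNIV"
    by (rule infsum_as_integral(2)[symmetric]) (use b bounded summable_on_mult_bounded in blast)
  finally show ?thesis .
qed

lemma signed_integral_atomic_measure: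
  fixes a f :: "'k::t1_space \<Rightarrow> real"
  assumes a: "a summable_on UNIV" and f: "continuous_on UNIV f" and bounded: "\<And>x. \<bar>f x\<bar> \<le> M"
  shows "signed_integral (atomic_measure a) f = infsum (\<lambda>x. a x * f x) UNIV"
proof -
  let ?p = "\<lambda>x. max 0 (a x)" and ?n = "\<lambda>x. max 0 (- a x)"
  have p: "?p summable_on UNIV" and n: "?n summable_on UNIV"
    using a by (auto intro: summable_on_pos_part simp: summable_on_uminus)
  have "signed_integral (atomic_measure a) f
      = infsum (\<lambda>x. ?p x * f x) UNIV - infsum (\<lambda>x. ?n x * f x) UNIV"
    unfolding signed_integral_def
    using integral_summable_weights[OF p _ f bounded pos_part_atomic_measure[OF a]]
      integral_summable_weights[OF n _ f bounded neg_part_atomic_measure[OF a]] by simp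
  also have "infsum (\<lambda>x. ?p x * f x) UNIV = infsum (\<lambda>x. a x * f x + ?n x * f x) UNIV"
    by (rule infsum_cong) (auto simp: max_def)
  also have "\<dots> = infsum (\<lambda>x. a x * f x) UNIV + infsum (\<lambda>x. ?n x * f x) UNIV"
    using summable_on_mult_bounded[OF a bounded] summable_on_mult_bounded[OF n bounded]
    by (rule infsum_add)
  finally show ?thesis by simp
qed

section \<open>Regular signed measures on a well-ordered space are atomic\<close>

context
  fixes \<mu> :: "'k::topological_space set \<Rightarrow> real"
  assumes sm: "signed_measure \<mu>"
begin

lemma signed_measure_sums:
  assumes "\<And>i. A i \<in> sets borel" "disjoint_family A"
  shows "(\<lambda>i. \<mu> (A i)) sums \<mu> (\<Union>i. A i)"
  using sm assms unfolding signed_measure_def by blast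

lemma signed_measure_empty: "\<mu> {} = 0"
proof -
  have "(\<lambda>i::nat. \<mu> {}) sums \<mu> (\<Union>i::nat. {})"
    by (rule signed_measure_sums) (auto simp: disjoint_family_on_def)
  then have "summable (\<lambda>i::nat. \<mu> {})" by (rule sums_summable)
  then have "(\<lambda>i::nat. \<mu> {}) \<longlonglongrightarrow> 0" by (rule summable_LIMSEQ_zero)
  then show ?thesis by (simp add: LIMSEQ_const_iff)
qed

lemma signed_measure_Un:
  assumes "A \<in> sets borel" "B \<in> sets borel" "A \<inter> B = {}"
  shows "\<mu> (A \<union> B) = \<mu> A + \<mu> B"
proof -
  have "(\<lambda>n. \<mu> (binaryset A B n)) sums (\<mu> A + \<mu> B)"
    by (rule binaryset_sums) (rule signed_measure_empty)
  moreover have "(\<lambda>n. \<mu> (binaryset A B n)) sums \<mu> (\<Union>n. binaryset A B n)"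
    by (rule signed_measure_sums)
      (use assms in \<open>auto simp: binaryset_def disjoint_family_on_def\<close>)
  ultimately show ?thesis
    by (simp add: UN_binaryset_eq sums_unique2)
qed

lemma signed_measure_Diff:
  assumes "A \<in> sets borel" "B \<in> sets borel" "B \<subseteq> A"
  shows "\<mu> (A - B) = \<mu> A - \<mu> B"
proof -
  have "\<mu> (B \<union> (A - B)) = \<mu> B + \<mu> (A - B)"
    by (rule signed_measure_Un) (use assms in auto)
  moreover have "B \<union> (A - B) = A" using assms(3) by blast
  ultimately show ?thesis by simp
qed

text \<open>
  If the values were unbounded, repeated splitting would produce disjoint sets of measure at
  least 1 in absolute value, contradicting countable additivity.
\<close>

lemma signed_measure_bounded: "\<exists>M. \<forall>A\<in>sets borel. \<bar>\<mu> A\<bar> \<le> M"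
proof (rule ccontr)
  assume unbounded: "\<not> ?thesis"
  define U where "U A \<longleftrightarrow> A \<in> sets borel \<and> (\<forall>M. \<exists>B\<in>sets borel. B \<subseteq> A \<and> \<bar>\<mu> B\<bar> > M)" for A
  have step: "\<exists>A'. U A' \<and> A' \<subseteq> A \<and> \<bar>\<mu> (A - A')\<bar> \<ge> 1" if UA: "U A" for A
  proof -
    have A: "A \<in> sets borel" using UA by (simp add: U_def)
    from UA obtain B where B: "B \<in> sets borel" "B \<subseteq> A" "\<bar>\<mu> B\<bar> > \<bar>\<mu> A\<bar> + 1"
      unfolding U_def by meson
    have diff: "\<mu> (A - B) = \<mu> A - \<mu> B" using A B by (intro signed_measure_Diff)
    show ?thesis
    proof (cases "U B")
      case True
      then show ?thesis using B diff by (intro exI[of _ B]) auto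
    next
      case False
      then obtain M where M: "\<And>C. C \<in> sets borel \<Longrightarrow> C \<subseteq> B \<Longrightarrow> \<bar>\<mu> C\<bar> \<le> M"
        using B(1) unfolding U_def by (auto simp: not_less)
      have "\<exists>C\<in>sets borel. C \<subseteq> A - B \<and> \<bar>\<mu> C\<bar> > N" for N
      proof -
        obtain C where C: "C \<in> sets borel" "C \<subseteq> A" "\<bar>\<mu> C\<bar> > N + M"
          using UA unfolding U_def by meson
        have "\<mu> (C - C \<inter> B) = \<mu> C - \<mu> (C \<inter> B)"
          using C B by (intro signed_measure_Diff) auto
        moreover have "\<bar>\<mu> (C \<inter> B)\<bar> \<le> M" using C B by (intro M) auto
        ultimately have "\<bar>\<mu> (C - C \<inter> B)\<bar> > N" using C(3) by linarith
        then show ?thesis using C B by (intro bexI[of _ "C - C \<inter> B"]) auto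
      qed
      then have "U (A - B)" using A B unfolding U_def by auto
      moreover have "A - (A - B) = B" using B(2) by blast
      ultimately show ?thesis using B(3) by (intro exI[of _ "A - B"]) auto
    qed
  qed
  have "U UNIV" using unbounded by (auto simp: U_def not_le)
  then have "\<exists>A. \<forall>n. U (A n) \<and> (A (Suc n) \<subseteq> A n \<and> \<bar>\<mu> (A n - A (Suc n))\<bar> \<ge> 1)"
    by (intro dependent_nat_choice[of "\<lambda>_. U" "\<lambda>_ A A'. A' \<subseteq> A \<and> \<bar>\<mu> (A - A')\<bar> \<ge> 1"])
      (blast, metis step)
  then obtain A where A: "\<And>n. U (A n)" "\<And>n. A (Suc n) \<subseteq> A n \<and> \<bar>\<mu> (A n - A (Suc n))\<bar> \<ge> 1"
    by metis
  have dec: "A n \<subseteq> A m" if "m \<le> n" for m n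
    using A(2) by (intro lift_Suc_antimono_le[OF _ that]) simp
  have "disjoint_family (\<lambda>n. A n - A (Suc n))"
  proof -
    have "(A m - A (Suc m)) \<inter> (A n - A (Suc n)) = {}" if "m < n" for m n
      using dec[of "Suc m" n] that by auto
    then show ?thesis
      unfolding disjoint_family_on_def by (metis Int_commute linorder_neqE_nat)
  qed
  moreover have "A n - A (Suc n) \<in> sets borel" for n
    using A(1) unfolding U_def by blast
  ultimately have "(\<lambda>n. \<mu> (A n - A (Suc n))) sums \<mu> (\<Union>n. A n - A (Suc n))"
    by (intro signed_measure_sums)
  then have "(\<lambda>n. \<mu> (A n - A (Suc n))) \<longlonglongrightarrow> 0"
    using summable_LIMSEQ_zero sums_summable by blast
  then have "(\<lambda>n. \<bar>\<mu> (A n - A (Suc n))\<bar>) \<longlonglongrightarrow> 0" by (rule tendsto_rabs_zero)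
  then have "1 \<le> (0::real)"
    by (rule LIMSEQ_le_const) (use A(2) in blast)
  then show False by simp
qed

lemma le_pos_part:
  assumes "S \<in> sets borel" "B \<in> sets borel" "B \<subseteq> S"
  shows "\<mu> B \<le> pos_part \<mu> S"
proof -
  obtain M where "\<forall>A\<in>sets borel. \<bar>\<mu> A\<bar> \<le> M" using signed_measure_bounded by blast
  then have "bdd_above (\<mu> ` {B \<in> sets borel. B \<subseteq> S})"
    by (intro bdd_aboveI[of _ M]) (auto simp: abs_le_iff)
  then show ?thesis
    using assms by (auto simp: pos_part_def intro!: cSUP_upper)
qed

end

lemma signed_measure_uminus:
  assumes "signed_measure \<mu>"
  shows "signed_measure (\<lambda>A. - \<mu> A)"
  using assms unfolding signed_measure_def by (auto intro!: sums_minus)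

lemma le_neg_part:
  assumes "signed_measure \<mu>" "S \<in> sets borel" "B \<in> sets borel" "B \<subseteq> S"
  shows "- \<mu> B \<le> neg_part \<mu> S"
  unfolding neg_part_def using le_pos_part[OF signed_measure_uminus] assms by blast

lemma diff_le_variation:
  assumes \<mu>: "signed_measure \<mu>" and S: "S \<in> sets borel"
    and "A \<in> sets borel" "A \<subseteq> S" "B \<in> sets borel" "B \<subseteq> S"
  shows "\<mu> A - \<mu> B \<le> variation \<mu> S"
  using le_pos_part[OF \<mu> S, of A] le_neg_part[OF \<mu> S, of B] assms by (simp add: variation_def)

lemma signed_measure_finite:
  fixes \<mu> :: "'k::t1_space set \<Rightarrow> real"
  assumes \<mu>: "signed_measure \<mu>" and "finite X"
  shows "\<mu> X = (\<Sum>x\<in>X. \<mu> {x})"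
  using assms(2)
proof induction
  case empty
  then show ?case by (simp add: signed_measure_empty[OF \<mu>])
next
  case (insert x X)
  have "\<mu> ({x} \<union> X) = \<mu> {x} + \<mu> X"
    using insert by (intro signed_measure_Un[OF \<mu>] countable_sets_borel countable_finite) auto
  then show ?case using insert by simp
qed

lemma sum_abs_le_variation:
  fixes \<mu> :: "'k::t1_space set \<Rightarrow> real"
  assumes \<mu>: "signed_measure \<mu>" and S: "S \<in> sets borel" and X: "finite X" "X \<subseteq> S"
  shows "(\<Sum>x\<in>X. \<bar>\<mu> {x}\<bar>) \<le> variation \<mu> S"
proof -
  let ?P = "{x \<in> X. \<mu> {x} \<ge> 0}"
  have fin: "finite ?P" "finite (X - ?P)" using X(1) by auto
  have "(\<Sum>x\<in>X. \<bar>\<mu> {x}\<bar>) = (\<Sum>x\<in>?P. \<bar>\<mu> {x}\<bar>) + (\<Sum>x\<in>X - ?P. \<bar>\<mu> {x}\<bar>)"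
    using X(1) by (subst sum.subset_diff[of ?P]) (auto simp: add.commute)
  also have "\<dots> = (\<Sum>x\<in>?P. \<mu> {x}) + (\<Sum>x\<in>X - ?P. - \<mu> {x})"
    by (intro arg_cong2[of _ _ _ _ "(+)"] sum.cong) auto
  also have "\<dots> = \<mu> ?P - \<mu> (X - ?P)"
    using signed_measure_finite[OF \<mu> fin(1)] signed_measure_finite[OF \<mu> fin(2)]
    by (simp add: sum_negf)
  also have "\<dots> \<le> variation \<mu> S"
    using X fin by (intro diff_le_variation[OF \<mu> S] countable_sets_borel countable_finite) auto
  finally show ?thesis .
qed

lemma signed_measure_points_summable:
  fixes \<mu> :: "'k::t1_space set \<Rightarrow> real"
  assumes \<mu>: "signed_measure \<mu>"
  shows "(\<lambda>x. \<mu> {x}) summable_on UNIV"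
  by (rule summable_on_abs_bounded(1)[of _ "variation \<mu> UNIV"])
    (rule sum_abs_le_variation[OF \<mu>], auto)

text \<open>Transfinite induction on \<open>b\<close>. Without the point \<open>b\<close>, the set
  \<open>B\<close> is approximated from inside by compact sets; a nonempty one has a greatest
  element below \<open>b\<close>, so the induction hypothesis applies to it. Regularity is what
  excludes the Dieudonne measure on the interval up to \<open>Omega1\<close>.\<close>

lemma regular_measure_atomic_initial:
  fixes \<mu> :: "'k::{wellorder, linorder_topology} set \<Rightarrow> real"
  assumes \<mu>: "\<mu> \<in> regular_measures" and "B \<in> sets borel" "B \<subseteq> {..b}"
  shows "\<mu> B = infsum (\<lambda>x. \<mu> {x}) B"
  using assms(2,3)
proof (induction b arbitrary: B rule: less_induct)
  case (less b)
  have sm: "signed_measure \<mu>" and reg: "regular \<mu>" using \<mu> by (auto simp: regular_measures_def)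
  let ?a = "\<lambda>x. \<mu> {x}"
  have sum: "?a summable_on S" for S
    by (rule summable_on_UNIV_subset[OF signed_measure_points_summable[OF sm]])
  have b: "{b} \<in> sets borel" by (rule countable_sets_borel) simp
  define B' where "B' = B - {b}"
  have B': "B' \<in> sets borel" using less.prems(1) b by (auto simp: B'_def)
  have "\<bar>\<mu> B' - infsum ?a B'\<bar> \<le> \<epsilon> + \<epsilon>" if \<epsilon>: "\<epsilon> > 0" for \<epsilon>
  proof -
    from reg[unfolded regular_def, rule_format, OF B' \<epsilon>]
    obtain C U where C: "compact C" "open U" "C \<subseteq> B'" "B' \<subseteq> U" "variation \<mu> (U - C) < \<epsilon>"
      by (elim exE conjE)
    have CB: "C \<in> sets borel" using C(1) by (simp add: borel_compact)
    have S: "U - C \<in> sets borel" using C(2) CB by auto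
    have "\<mu> C = infsum ?a C"
    proof (cases "C = {}")
      case True
      then show ?thesis by (simp add: signed_measure_empty[OF sm])
    next
      case False
      then obtain c where c: "c \<in> C" "\<And>x. x \<in> C \<Longrightarrow> x \<le> c"
        using compact_attains_sup[OF C(1)] by blast
      have "c \<in> B" "c \<noteq> b" using c(1) C(3) by (auto simp: B'_def)
      then have "c < b" using less.prems(2) by (auto simp: order_less_le)
      then show ?thesis using less.IH[of c C] c CB by auto
    qed
    moreover have "\<mu> (B' - C) = \<mu> B' - \<mu> C"
      using B' CB C(3) by (rule signed_measure_Diff[OF sm])
    moreover have "infsum ?a B' = infsum ?a C + infsum ?a (B' - C)"
      using infsum_split[OF sum, of B' C] C(3) by (simp add: Int_absorb1)
    moreover have "\<bar>\<mu> (B' - C)\<bar> \<le> variation \<mu> (U - C)"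
      using diff_le_variation[OF sm S, of "B' - C" "{}"] diff_le_variation[OF sm S, of "{}" "B' - C"]
        Diff_mono[OF C(4) order_refl, of C] B' CB signed_measure_empty[OF sm] by auto
    \<comment> \<open>The point masses left over are controlled by the same variation, because their
      finite sums are.\<close>
    moreover have "\<bar>infsum ?a (B' - C)\<bar> \<le> variation \<mu> (U - C)"
    proof -
      have "infsum (\<lambda>x. \<bar>?a x\<bar>) (B' - C) \<le> variation \<mu> (U - C)"
      proof (rule infsum_le_finite_sums)
        show "(\<lambda>x. \<bar>?a x\<bar>) summable_on (B' - C)" using sum by (simp only: summable_on_abs_iff)
        show "(\<Sum>x\<in>X. \<bar>?a x\<bar>) \<le> variation \<mu> (U - C)" if "finite X" "X \<subseteq> B' - C" for X
          using that C(4) by (intro sum_abs_le_variation[OF sm S]) auto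
      qed
      then show ?thesis using infsum_abs_bound[OF sum] by (rule order_trans[rotated])
    qed
    ultimately show ?thesis using C(5) by linarith
  qed
  then have "\<bar>\<mu> B' - infsum ?a B'\<bar> \<le> 0 + e" if "e > 0" for e
    using that[THEN half_gt_zero] by (metis add_0 field_sum_of_halves)
  then have "\<bar>\<mu> B' - infsum ?a B'\<bar> \<le> 0"
    by (rule field_le_epsilon)
  then have eq: "\<mu> B' = infsum ?a B'" by simp
  show ?case
  proof (cases "b \<in> B")
    case True
    then have "B = B' \<union> {b}" by (auto simp: B'_def)
    moreover have "\<mu> (B' \<union> {b}) = \<mu> B' + \<mu> {b}"
      using B' b by (intro signed_measure_Un[OF sm]) (auto simp: B'_def)
    moreover have "infsum ?a (B' \<union> {b}) = infsum ?a B' + infsum ?a {b}"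
      using sum by (intro infsum_Un_disjoint) (auto simp: B'_def)
    ultimately show ?thesis using eq by simp
  next
    case False
    then show ?thesis using eq by (simp add: B'_def)
  qed
qed

lemma regular_measure_atomic:
  fixes \<mu> :: "omega1_interval set \<Rightarrow> real"
  assumes "\<mu> \<in> regular_measures"
  shows "\<mu> = atomic_measure (\<lambda>x. \<mu> {x})"
proof
  fix B
  have "B \<subseteq> {..Omega1}" by (auto simp: le_Omega1)
  then show "\<mu> B = atomic_measure (\<lambda>x. \<mu> {x}) B"
    using regular_measure_atomic_initial[OF assms, of B Omega1] assms
    by (simp add: atomic_measure_def regular_measures_def signed_measure_def)
qed

section \<open>Clopen sets and step functions\<close>

abbreviation clopen :: "'k::topological_space set \<Rightarrow> bool" where
  "clopen S \<equiv> open S \<and> closed S"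

text \<open>In a well-order \<open>{..b}\<close> is everything or ends just before the successor of
  \<open>b\<close>, so it is open as well as closed.\<close>

lemma clopen_atMost:
  fixes b :: "'k::{wellorder, linorder_topology}"
  shows "clopen {..b}"
proof -
  have "open {..b}"
  proof (cases "\<exists>x. b < x")
    case True
    define s where "s = (LEAST x. b < x)"
    have "b < s" unfolding s_def using True by (rule LeastI_ex)
    moreover have "s \<le> x" if "b < x" for x unfolding s_def using that by (rule Least_le)
    ultimately have "x \<le> b \<longleftrightarrow> x < s" for x by (metis leD le_less_trans not_le)
    then have "{..b} = {..<s}" by auto
    then show ?thesis by simp
  next
    case False
    then have "{..b} = UNIV" by (auto simp: not_less)
    then show ?thesis by simp
  qed
  then show ?thesis by simp
qed

lemma continuous_on_indicator_clopen:
  assumes "clopen S"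
  shows "continuous_on UNIV (indicator S :: 'k::topological_space \<Rightarrow> real)"
proof -
  have "continuous_on (S \<union> - S) (\<lambda>x. if x \<in> S then 1 else (0::real))"
    using assms by (intro continuous_on_cases) auto
  moreover have "(\<lambda>x. if x \<in> S then 1 else (0::real)) = indicator S" by auto
  ultimately show ?thesis by (simp only: Compl_partition)
qed

lemma continuous_on_if_clopen:
  fixes f g :: "'k::topological_space \<Rightarrow> real"
  assumes "clopen S" "continuous_on UNIV f" "continuous_on UNIV g"
  shows "continuous_on UNIV (\<lambda>x. if x \<in> S then f x else g x)"
proof -
  have "continuous_on (S \<union> - S) (\<lambda>x. if x \<in> S then f x else g x)"
    using assms by (intro continuous_on_cases) (auto intro: continuous_on_subset)
  then show ?thesis by (simp add: Compl_partition)
qed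

lemma infsum_indicator:
  fixes a :: "'k \<Rightarrow> real"
  shows "infsum (\<lambda>x. a x * indicator S x) UNIV = infsum a S"
  by (rule infsum_cong_neutral) auto

section \<open>Uniform approximation by step functions\<close>

inductive_set steps :: "('k::order \<Rightarrow> real) set" where
  zero: "(\<lambda>x. 0) \<in> steps"
| add: "g \<in> steps \<Longrightarrow> (\<lambda>x. g x + c * indicator {..b} x) \<in> steps"

lemma steps_continuous:
  fixes g :: "'k::{wellorder, linorder_topology} \<Rightarrow> real"
  assumes "g \<in> steps"
  shows "continuous_on UNIV g"
  using assms
  by induction (auto intro!: continuous_intros continuous_on_indicator_clopen clopen_atMost)

lemma steps_bounded:
  assumes "g \<in> steps"
  shows "\<exists>M. \<forall>x. \<bar>g x\<bar> \<le> M"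
  using assms
proof induction
  case zero
  then show ?case by (intro exI[of _ 0]) simp
next
  case (add g c b)
  then obtain M where M: "\<And>x. \<bar>g x\<bar> \<le> M" by blast
  have "\<bar>g x + c * indicator {..b} x\<bar> \<le> M + \<bar>c\<bar>" for x
    using M[of x] by (auto simp: indicator_def)
  then show ?case by blast
qed

lemma steps_vimage_open:
  fixes g :: "'k::{wellorder, linorder_topology} \<Rightarrow> real"
  assumes "g \<in> steps"
  shows "open (g -` B)"
  using assms
proof (induction arbitrary: B)
  case zero
  then show ?case by (cases "0 \<in> B") (auto simp: vimage_def)
next
  case (add g c b)
  have "(\<lambda>x. g x + c * indicator {..b} x) -` B
      = ({..b} \<inter> g -` {y. y + c \<in> B}) \<union> (- {..b} \<inter> g -` B)"
    by (auto split: split_indicator split_indicator_asm)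
  moreover have "open {..b}" "open (- {..b})" using clopen_atMost[of b] by auto
  ultimately show ?case
    using add.IH by (simp only:) (intro open_Un open_Int; blast)
qed

lemma steps_clopen:
  fixes g :: "'k::{wellorder, linorder_topology} \<Rightarrow> real"
  assumes "g \<in> steps"
  shows "clopen (g -` B)"
  using steps_vimage_open[OF assms, of B] steps_vimage_open[OF assms, of "- B"]
  by (simp add: closed_def vimage_Compl)

text \<open>On some \<open>{y<..b}\<close> the function is within \<epsilon> of \<open>f b\<close>,
  and induction covers \<open>{..y}\<close>. Vanishing above \<open>b\<close> belongs to the claim
  so that the two pieces can be added.\<close>

lemma step_approximation_initial:
  fixes f :: "'k::{wellorder, linorder_topology} \<Rightarrow> real"
  assumes f: "continuous_on UNIV f" and \<epsilon>: "\<epsilon> > 0"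
  shows "\<exists>g\<in>steps. (\<forall>x\<le>b. \<bar>f x - g x\<bar> < \<epsilon>) \<and> (\<forall>x>b. g x = 0)"
proof (induction b rule: less_induct)
  case (less b)
  define U where "U = f -` {f b - \<epsilon><..<f b + \<epsilon>}"
  have U: "open U" "b \<in> U"
    using f \<epsilon> by (auto simp: U_def continuous_on_open_vimage)
  have fU: "\<bar>f x - f b\<bar> < \<epsilon>" if "x \<in> U" for x using that by (auto simp: U_def)
  show ?case
  proof (cases "\<exists>y. y < b")
    case False
    then have "x \<le> b \<longleftrightarrow> x = b" for x by (auto simp: order_le_less)
    moreover have "(\<lambda>x. 0 + f b * indicator {..b} x) \<in> steps"
      by (intro steps.intros)
    ultimately show ?thesis
      using \<epsilon> by (intro bexI[of _ "\<lambda>x. 0 + f b * indicator {..b} x"]) auto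
  next
    case True
    then obtain y where y: "y < b" "{y<..b} \<subseteq> U" using open_left[OF U] by blast
    obtain g where g: "g \<in> steps" "\<And>x. x \<le> y \<Longrightarrow> \<bar>f x - g x\<bar> < \<epsilon>" "\<And>x. x > y \<Longrightarrow> g x = 0"
      using less[OF y(1)] by blast
    \<comment> \<open>The two new terms contribute \<open>f b\<close> on \<open>{y<..b}\<close> and
      nothing elsewhere.\<close>
    let ?h = "\<lambda>x. (g x + f b * indicator {..b} x) + (- f b) * indicator {..y} x"
    have "?h \<in> steps" using g(1) by (intro steps.intros)
    moreover have "\<bar>f x - ?h x\<bar> < \<epsilon>" if "x \<le> b" for x
    proof (cases "x \<le> y")
      case True
      then show ?thesis using g(2)[of x] y(1) that by simp
    next
      case False
      then have "x \<in> {y<..b}" using that by auto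
      then show ?thesis using fU[of x] g(3)[of x] y(2) by auto
    qed
    moreover have "?h x = 0" if "x > b" for x
      using that y(1) g(3)[of x] by auto
    ultimately show ?thesis by (intro bexI[of _ ?h]) auto
  qed
qed

lemma step_approximation:
  fixes f :: "omega1_interval \<Rightarrow> real"
  assumes "continuous_on UNIV f" "\<epsilon> > 0"
  obtains g where "g \<in> steps" "\<And>x. \<bar>f x - g x\<bar> < \<epsilon>"
  using step_approximation_initial[OF assms, of Omega1] le_Omega1 by blast

text \<open>Preimages under steps are clopen. A step within half the gap of \<open>f\<close>, cut at
  the midpoint of \<open>c\<close> and \<open>d\<close>, separates the two level sets.\<close>

lemma continuous_clopen_separation:
  fixes f :: "omega1_interval \<Rightarrow> real"
  assumes "continuous_on UNIV f" "c < d"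
  obtains P where "clopen P" "{x. f x \<ge> d} \<subseteq> P" "P \<subseteq> {x. f x > c}"
proof -
  have "(d - c) / 2 > 0" using assms(2) by simp
  then obtain g where g: "g \<in> steps" "\<And>x. \<bar>f x - g x\<bar> < (d - c) / 2"
    using step_approximation[OF assms(1)] by blast
  have "{x. f x \<ge> d} \<subseteq> g -` {(c + d) / 2..}" "g -` {(c + d) / 2..} \<subseteq> {x. f x > c}"
    using g(2) by (auto simp: abs_less_iff field_simps) (smt (verit, best))+
  then show ?thesis using that steps_clopen[OF g(1)] by blast
qed

lemma continuous_bounded:
  fixes f :: "'k::compact_t2_space \<Rightarrow> real"
  assumes "continuous_on UNIV f"
  shows "f \<in> bcontfun" "\<exists>M. \<forall>x. \<bar>f x\<bar> \<le> M"
proof -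
  have "compact (range f)" using compact_continuous_image[OF assms compact_UNIV] .
  then have "bounded (range f)" by (rule compact_imp_bounded)
  then show "f \<in> bcontfun" "\<exists>M. \<forall>x. \<bar>f x\<bar> \<le> M"
    using assms by (auto simp: bcontfun_def bounded_iff)
qed

section \<open>Weak* continuous families of atomic measures\<close>

text \<open>Testing initial segments is enough for weak* continuity: their indicators span the
  steps, which are uniformly dense in the continuous functions on the interval, and the norms are
  bounded by 1.\<close>

definition atomic_family :: "('t::topological_space \<Rightarrow> 'k::{wellorder, linorder_topology} \<Rightarrow> real) \<Rightarrow> bool" where
  "atomic_family a \<longleftrightarrow>
     (\<forall>t. a t summable_on UNIV \<and> infsum (\<lambda>x. \<bar>a t x\<bar>) UNIV \<le> 1) \<and>
     (\<forall>b. continuous_on UNIV (\<lambda>t. infsum (a t) {..b}))"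

lemma pairing_bound:
  fixes a f :: "'k \<Rightarrow> real"
  assumes a: "a summable_on UNIV" and f: "\<And>x. \<bar>f x\<bar> \<le> M"
  shows "\<bar>infsum (\<lambda>x. a x * f x) UNIV\<bar> \<le> infsum (\<lambda>x. \<bar>a x\<bar>) UNIV * M"
proof -
  have abs: "(\<lambda>x. \<bar>a x\<bar>) summable_on UNIV" using a by (simp add: summable_on_abs_iff)
  have "\<bar>infsum (\<lambda>x. a x * f x) UNIV\<bar> \<le> infsum (\<lambda>x. \<bar>a x * f x\<bar>) UNIV"
    by (rule infsum_abs_bound[OF summable_on_mult_bounded[OF a f]])
  also have "\<dots> \<le> infsum (\<lambda>x. \<bar>a x\<bar> * M) UNIV"
  proof (rule infsum_mono)
    show "(\<lambda>x. \<bar>a x * f x\<bar>) summable_on UNIV"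
      using summable_on_mult_bounded[OF a f] by (simp only: summable_on_abs_iff)
  qed (use abs f in \<open>auto simp: abs_mult mult_left_mono intro: summable_on_cmult_left\<close>)
  also have "\<dots> = infsum (\<lambda>x. \<bar>a x\<bar>) UNIV * M"
    by (rule infsum_cmult_left) (use abs in blast)
  finally show ?thesis .
qed

lemma pairing_diff:
  fixes a f g :: "'k \<Rightarrow> real"
  assumes a: "a summable_on UNIV" and f: "\<And>x. \<bar>f x\<bar> \<le> M" and g: "\<And>x. \<bar>g x\<bar> \<le> N"
  shows "infsum (\<lambda>x. a x * f x) UNIV - infsum (\<lambda>x. a x * g x) UNIV
    = infsum (\<lambda>x. a x * (f x - g x)) UNIV"
proof -
  have "\<bar>f x - g x\<bar> \<le> M + N" for x using f[of x] g[of x] by linarith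
  then have "infsum (\<lambda>x. a x * (f x - g x) + a x * g x) UNIV
      = infsum (\<lambda>x. a x * (f x - g x)) UNIV + infsum (\<lambda>x. a x * g x) UNIV"
    by (intro infsum_add summable_on_mult_bounded[OF a, of _ "M + N"] summable_on_mult_bounded[OF a g]) auto
  then show ?thesis by (simp add: algebra_simps)
qed

lemma pairing_step_add:
  fixes a g :: "'k::order \<Rightarrow> real"
  assumes a: "a summable_on UNIV" and g: "g \<in> steps"
  shows "infsum (\<lambda>x. a x * (g x + c * indicator {..b} x)) UNIV
    = infsum (\<lambda>x. a x * g x) UNIV + c * infsum a {..b}"
proof -
  obtain M where M: "\<And>x. \<bar>g x\<bar> \<le> M" using steps_bounded[OF g] by blast
  have "infsum (\<lambda>x. a x * g x + a x * (c * indicator {..b} x)) UNIV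
      = infsum (\<lambda>x. a x * g x) UNIV + infsum (\<lambda>x. a x * (c * indicator {..b} x)) UNIV"
    by (intro infsum_add summable_on_mult_bounded[OF a M] summable_on_mult_bounded[OF a, of _ "\<bar>c\<bar>"])
      (auto simp: indicator_def)
  also have "infsum (\<lambda>x. a x * (c * indicator {..b} x)) UNIV = c * infsum (\<lambda>x. a x * indicator {..b} x) UNIV"
    by (subst infsum_cmult_right'[symmetric]) (simp add: mult_ac)
  also have "infsum (\<lambda>x. a x * indicator {..b} x) UNIV = infsum a {..b}"
    by (rule infsum_indicator)
  finally show ?thesis by (simp add: distrib_left)
qed

text \<open>The common bound on the norms turns uniform approximation of \<open>f\<close> by steps
  into approximation of the pairing uniformly in \<open>t\<close>.\<close>

lemma atomic_family_pairing:
  fixes a :: "'t::topological_space \<Rightarrow> omega1_interval \<Rightarrow> real"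
  assumes a: "atomic_family a" and f: "continuous_on UNIV f"
  shows "continuous_on UNIV (\<lambda>t. infsum (\<lambda>x. a t x * f x) UNIV)"
proof -
  have sum: "a t summable_on UNIV" and norm: "infsum (\<lambda>x. \<bar>a t x\<bar>) UNIV \<le> 1" for t
    using a by (auto simp: atomic_family_def)
  have step: "continuous_on UNIV (\<lambda>t. infsum (\<lambda>x. a t x * g x) UNIV)" if "g \<in> steps" for g
    using that
  proof induction
    case (add g c b)
    then show ?case
      using a by (simp add: pairing_step_add[OF sum add.hyps] atomic_family_def continuous_intros)
  qed simp
  obtain M where M: "\<And>x. \<bar>f x\<bar> \<le> M" using continuous_bounded(2)[OF f] by blast
  have "\<exists>g. \<forall>x. g \<in> steps \<and> \<bar>f x - g x\<bar> < inverse (real (Suc n))" for n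
    using step_approximation[OF f, of "inverse (real (Suc n))"] by (metis inverse_positive_iff_positive of_nat_0_less_iff zero_less_Suc)
  then obtain g where g: "\<And>n. g n \<in> steps" "\<And>n x. \<bar>f x - g n x\<bar> < inverse (real (Suc n))"
    by metis
  have close: "\<bar>infsum (\<lambda>x. a t x * f x) UNIV - infsum (\<lambda>x. a t x * g n x) UNIV\<bar> \<le> inverse (real (Suc n))" for t n
  proof -
    obtain N where N: "\<And>x. \<bar>g n x\<bar> \<le> N" using steps_bounded[OF g(1)] by blast
    have "\<bar>infsum (\<lambda>x. a t x * (f x - g n x)) UNIV\<bar> \<le> infsum (\<lambda>x. \<bar>a t x\<bar>) UNIV * inverse (real (Suc n))"
      using g(2) by (intro pairing_bound[OF sum]) (auto intro: less_imp_le)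
    also have "\<dots> \<le> 1 * inverse (real (Suc n))"
      using norm[of t] by (intro mult_right_mono) auto
    finally show ?thesis by (simp add: pairing_diff[OF sum M N])
  qed
  have "uniform_limit UNIV (\<lambda>n t. infsum (\<lambda>x. a t x * g n x) UNIV)
      (\<lambda>t. infsum (\<lambda>x. a t x * f x) UNIV) sequentially"
  proof (rule uniform_limitI)
    fix e :: real
    assume "e > 0"
    with LIMSEQ_inverse_real_of_nat have "\<forall>\<^sub>F n in sequentially. inverse (real (Suc n)) < e"
      by (rule order_tendstoD(2))
    then show "\<forall>\<^sub>F n in sequentially. \<forall>t\<in>UNIV.
        dist (infsum (\<lambda>x. a t x * g n x) UNIV) (infsum (\<lambda>x. a t x * f x) UNIV) < e"
      by (rule eventually_mono) (use close in \<open>auto simp: dist_real_def abs_minus_commute intro: le_less_trans\<close>)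
  qed
  then show ?thesis
    by (rule uniform_limit_theorem[rotated]) (use step g(1) in auto)
qed

lemma atomic_family_clopen:
  fixes a :: "'t::topological_space \<Rightarrow> omega1_interval \<Rightarrow> real"
  assumes a: "atomic_family a" and S: "clopen S"
  shows "continuous_on UNIV (\<lambda>t. infsum (a t) S)"
  using atomic_family_pairing[OF a continuous_on_indicator_clopen[OF S]] by (simp add: infsum_indicator)

lemma continuous_map_weak_star_iff:
  fixes F :: "'t::topological_space \<Rightarrow> 'k::topological_space set \<Rightarrow> real"
  shows "continuous_map euclidean (subtopology weak_star_topology unit_ball_measures) F \<longleftrightarrow>
    range F \<subseteq> unit_ball_measures \<and>
    (\<forall>f :: 'k \<Rightarrow>\<^sub>C real. continuous_on UNIV (\<lambda>t. signed_integral (F t) (apply_bcontfun f)))"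
    (is "?L \<longleftrightarrow> ?R \<and> ?C")
proof -
  let ?B = "{{\<mu> \<in> regular_measures. signed_integral \<mu> (apply_bcontfun f) \<in> U} |
        (f :: 'k \<Rightarrow>\<^sub>C real) U. open U}"
  have "continuous_map euclidean weak_star_topology F \<longleftrightarrow> ?C" if R: ?R
  proof -
    have reg: "F t \<in> regular_measures" for t using R by (auto simp: unit_ball_measures_def)
    have 1: "continuous_map euclidean weak_star_topology F \<longleftrightarrow>
        (\<forall>V. V \<in> ?B \<longrightarrow> open (F -` V)) \<and> range F \<subseteq> \<Union>?B"
      by (simp add: weak_star_topology_def continuous_on_generated_topo_iff)
    \<comment> \<open>Continuity into a generated topology also requires the values to lie in the
      union of the generating sets; the function 0 and the open set \<open>UNIV\<close> give a
      generating set that contains every regular measure.\<close>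
    have 2: "range F \<subseteq> \<Union>?B"
      using reg by (intro subsetI UnionI[of "{\<mu> \<in> regular_measures. signed_integral \<mu> (apply_bcontfun 0) \<in> UNIV}"]) auto
    have 3: "(\<forall>V. V \<in> ?B \<longrightarrow> open (F -` V)) \<longleftrightarrow>
        (\<forall>(f :: 'k \<Rightarrow>\<^sub>C real) U. open U \<longrightarrow> open ((\<lambda>t. signed_integral (F t) (apply_bcontfun f)) -` U))"
    proof -
      have eq: "F -` {\<mu> \<in> regular_measures. signed_integral \<mu> (apply_bcontfun f) \<in> U}
          = (\<lambda>t. signed_integral (F t) (apply_bcontfun f)) -` U" for f :: "'k \<Rightarrow>\<^sub>C real" and U
        using reg by auto
      have "(\<forall>V. V \<in> ?B \<longrightarrow> open (F -` V)) \<longleftrightarrow> (\<forall>(f :: 'k \<Rightarrow>\<^sub>C real) U. open U \<longrightarrow>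
          open (F -` {\<mu> \<in> regular_measures. signed_integral \<mu> (apply_bcontfun f) \<in> U}))"
        by (auto simp del: vimage_Collect_eq)
      then show ?thesis by (simp only: eq)
    qed
    also have "\<dots> \<longleftrightarrow> ?C" by (simp add: continuous_on_open_vimage)
    finally show ?thesis unfolding 1 using 2 by (simp only: simp_thms)
  qed
  then show ?thesis by (auto simp: continuous_map_in_subtopology)
qed

text \<open>This trades the weak* topology for sums over points. Atomicity of regular measures gives
  one direction, continuity of all pairings the other.\<close>

lemma W_iff_atomic_family:
  "(F :: omega1_interval \<Rightarrow> omega1_interval set \<Rightarrow> real) \<in> W \<longleftrightarrow>
    (\<exists>a. atomic_family a \<and> F = (\<lambda>t. atomic_measure (a t)))"
proof
  assume "F \<in> W"
  then have ball: "F t \<in> unit_ball_measures"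
    and cont: "continuous_on UNIV (\<lambda>t. signed_integral (F t) (apply_bcontfun f))" for t and f :: "omega1_interval \<Rightarrow>\<^sub>C real"
    unfolding W_def mem_Collect_eq continuous_map_weak_star_iff by auto
  define a where "a = (\<lambda>t x. F t {x})"
  have reg: "F t \<in> regular_measures" for t using ball by (auto simp: unit_ball_measures_def)
  have F: "F t = atomic_measure (a t)" for t
    unfolding a_def by (rule regular_measure_atomic[OF reg])
  have sum: "a t summable_on UNIV" for t
    unfolding a_def using signed_measure_points_summable reg by (auto simp: regular_measures_def)
  have "infsum (\<lambda>x. \<bar>a t x\<bar>) UNIV \<le> 1" for t
    using ball[of t] variation_atomic_measure[OF sum, of UNIV t] by (simp add: unit_ball_measures_def F)
  moreover have "continuous_on UNIV (\<lambda>t. infsum (a t) {..b})" for b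
  proof -
    have ind: "continuous_on UNIV (indicator {..b} :: omega1_interval \<Rightarrow> real)"
      by (rule continuous_on_indicator_clopen[OF clopen_atMost])
    then have "apply_bcontfun (Bcontfun (indicator {..b} :: omega1_interval \<Rightarrow> real)) = indicator {..b}"
      by (intro Bcontfun_inverse continuous_bounded)
    then show ?thesis
      using cont[of "Bcontfun (indicator {..b})"] signed_integral_atomic_measure[OF sum ind, of 1]
      by (simp add: F infsum_indicator)
  qed
  ultimately have "atomic_family a" using sum by (simp add: atomic_family_def)
  then show "\<exists>a. atomic_family a \<and> F = (\<lambda>t. atomic_measure (a t))" using F by blast
next
  assume "\<exists>a. atomic_family a \<and> F = (\<lambda>t. atomic_measure (a t))"
  then obtain a where a: "atomic_family a" and F: "F = (\<lambda>t. atomic_measure (a t))" by blast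
  have sum: "a t summable_on UNIV" and norm: "infsum (\<lambda>x. \<bar>a t x\<bar>) UNIV \<le> 1" for t
    using a by (auto simp: atomic_family_def)
  have "F t \<in> unit_ball_measures" for t
    using atomic_measure_regular[OF sum] variation_atomic_measure[OF sum, of UNIV t] norm[of t]
    by (simp add: unit_ball_measures_def F)
  moreover have "continuous_on UNIV (\<lambda>t. signed_integral (F t) (apply_bcontfun f))" for f :: "omega1_interval \<Rightarrow>\<^sub>C real"
  proof -
    have "signed_integral (F t) (apply_bcontfun f) = infsum (\<lambda>x. a t x * apply_bcontfun f x) UNIV" for t
      unfolding F using norm_bounded[of f] by (intro signed_integral_atomic_measure[OF sum, of _ "norm f"]) auto
    then show ?thesis using atomic_family_pairing[OF a, of "apply_bcontfun f"] by simp
  qed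
  ultimately show "F \<in> W"
    unfolding W_def mem_Collect_eq continuous_map_weak_star_iff by auto
qed

section \<open>Functionals on \<open>C([0, \<omega>\<^sub>1])\<close> are sums over points\<close>

locale bounded_functional =
  fixes L :: "('k::{wellorder, linorder_topology} \<Rightarrow> real) \<Rightarrow> real" and M :: real
  assumes L_add: "\<And>f g. continuous_on UNIV f \<Longrightarrow> continuous_on UNIV g \<Longrightarrow> L (\<lambda>x. f x + g x) = L f + L g"
    and L_scale: "\<And>c f. continuous_on UNIV f \<Longrightarrow> L (\<lambda>x. c * f x) = c * L f"
    and L_bound: "\<And>f B. continuous_on UNIV f \<Longrightarrow> (\<And>x. \<bar>f x\<bar> \<le> B) \<Longrightarrow> \<bar>L f\<bar> \<le> M * B"
begin

lemma L_zero: "L (\<lambda>x. 0) = 0"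
  using L_scale[of "\<lambda>x. 0" 0] by simp

lemma L_diff:
  assumes "continuous_on UNIV f" "continuous_on UNIV g"
  shows "L (\<lambda>x. f x - g x) = L f - L g"
  using L_add[of f "\<lambda>x. -1 * g x"] L_scale[of g "-1"] assms by (simp add: continuous_intros)

lemma L_sum:
  assumes "finite X" "\<And>i. i \<in> X \<Longrightarrow> continuous_on UNIV (f i)"
  shows "L (\<lambda>x. \<Sum>i\<in>X. c i * f i x) = (\<Sum>i\<in>X. c i * L (f i))"
  using assms
proof induction
  case empty
  then show ?case by (simp add: L_zero)
next
  case (insert i X)
  have "L (\<lambda>x. c i * f i x + (\<Sum>i\<in>X. c i * f i x)) = L (\<lambda>x. c i * f i x) + L (\<lambda>x. \<Sum>i\<in>X. c i * f i x)"
    using insert.prems by (intro L_add continuous_intros) auto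
  then show ?case using insert by (simp add: L_scale)
qed

section \<open>Positive and negative part of a functional\<close>

definition dominated :: "'k set \<Rightarrow> ('k \<Rightarrow> real) set" where
  "dominated S = {g. continuous_on UNIV g \<and> (\<forall>x. 0 \<le> g x \<and> g x \<le> indicator S x)}"

text \<open>For \<open>\<sigma> = 1\<close> and \<open>\<sigma> = -1\<close> and clopen
  \<open>S\<close> this is the mass of \<open>S\<close> under the positive and the negative part of
  \<open>L\<close>.\<close>

definition upper :: "real \<Rightarrow> 'k set \<Rightarrow> real" where
  "upper \<sigma> S = (SUP g\<in>dominated S. \<sigma> * L g)"

lemma zero_dominated: "(\<lambda>x. 0) \<in> dominated S"
  by (simp add: dominated_def)

lemma upper_bdd: "bdd_above ((\<lambda>g. \<sigma> * L g) ` dominated S)"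
proof (rule bdd_aboveI)
  fix y assume "y \<in> (\<lambda>g. \<sigma> * L g) ` dominated S"
  then obtain g where g: "g \<in> dominated S" "y = \<sigma> * L g" by blast
  have "\<bar>g x\<bar> \<le> 1" for x
    using g(1) indicator_le_1[of S x] by (auto simp: dominated_def intro: order_trans)
  then have "\<bar>L g\<bar> \<le> M * 1" using g(1) by (intro L_bound) (auto simp: dominated_def)
  then have "\<bar>\<sigma> * L g\<bar> \<le> \<bar>\<sigma>\<bar> * M" by (simp add: abs_mult mult_left_mono)
  then show "y \<le> \<bar>\<sigma>\<bar> * M" using g(2) by linarith
qed

lemma upper_nonneg: "0 \<le> upper \<sigma> S"
proof -
  have "\<sigma> * L (\<lambda>x. 0) \<le> upper \<sigma> S"
    unfolding upper_def by (rule cSUP_upper[OF zero_dominated upper_bdd])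
  then show ?thesis by (simp add: L_zero)
qed

lemma upper_mono: "S \<subseteq> T \<Longrightarrow> upper \<sigma> S \<le> upper \<sigma> T"
  unfolding upper_def
proof (rule cSUP_subset_mono[OF _ upper_bdd])
  assume "S \<subseteq> T"
  then have "indicator S x \<le> (indicator T x :: real)" for x
    by (auto simp: indicator_def)
  then show "dominated S \<subseteq> dominated T"
    by (auto simp: dominated_def intro: order_trans)
qed (use zero_dominated in auto)

text \<open>
  Replacing \<open>g\<close> by its complement in the indicator of \<open>S\<close> exchanges the two suprema.
\<close>

lemma L_indicator_upper:
  assumes S: "clopen S"
  shows "L (indicator S) = upper 1 S - upper (-1) S"
proof -
  let ?i = "indicator S :: 'k \<Rightarrow> real"
  have i: "continuous_on UNIV ?i" by (rule continuous_on_indicator_clopen[OF S])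
  have dom: "(\<lambda>x. ?i x - g x) \<in> dominated S" and eq: "L (\<lambda>x. ?i x - g x) = L ?i - L g"
    if "g \<in> dominated S" for g
    using that i by (auto simp: dominated_def L_diff intro!: continuous_intros)
  have "upper 1 S \<le> L ?i + upper (-1) S"
    unfolding upper_def[of 1]
  proof (rule cSUP_least)
    fix g assume g: "g \<in> dominated S"
    have "-1 * L (\<lambda>x. ?i x - g x) \<le> upper (-1) S"
      unfolding upper_def by (rule cSUP_upper[OF dom[OF g] upper_bdd])
    then show "1 * L g \<le> L ?i + upper (-1) S" using eq[OF g] by simp
  qed (use zero_dominated in blast)
  moreover have "upper (-1) S \<le> upper 1 S - L ?i"
    unfolding upper_def[of "-1"]
  proof (rule cSUP_least)
    fix g assume g: "g \<in> dominated S"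
    have "1 * L (\<lambda>x. ?i x - g x) \<le> upper 1 S"
      unfolding upper_def by (rule cSUP_upper[OF dom[OF g] upper_bdd])
    then show "-1 * L g \<le> upper 1 S - L ?i" using eq[OF g] by simp
  qed (use zero_dominated in blast)
  ultimately show ?thesis by linarith
qed

section \<open>Point masses of a functional\<close>

definition left_nbhds :: "'k \<Rightarrow> 'k set set" where
  "left_nbhds b = {S. clopen S \<and> b \<in> S \<and> S \<subseteq> {..b}}"

text \<open>\<open>L (indicator S)\<close> is not monotone in \<open>S\<close>, so a limit along
  shrinking neighbourhoods is not evident. The masses \<open>upper \<sigma> S\<close> are monotone,
  and their infimum is such a limit.\<close>

definition mass :: "real \<Rightarrow> 'k \<Rightarrow> real" where
  "mass \<sigma> b = (INF S\<in>left_nbhds b. upper \<sigma> S)"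

definition coef :: "'k \<Rightarrow> real" where
  "coef b = mass 1 b - mass (-1) b"

lemma atMost_left_nbhds: "{..b} \<in> left_nbhds b"
  using clopen_atMost by (simp add: left_nbhds_def)

lemma left_nbhds_Int: "S \<in> left_nbhds b \<Longrightarrow> T \<in> left_nbhds b \<Longrightarrow> S \<inter> T \<in> left_nbhds b"
  by (auto simp: left_nbhds_def)

lemma mass_limit:
  assumes "\<epsilon> > 0"
  shows "\<exists>S\<in>left_nbhds b. \<forall>S'\<in>left_nbhds b. S' \<subseteq> S \<longrightarrow> mass \<sigma> b \<le> upper \<sigma> S' \<and> upper \<sigma> S' < mass \<sigma> b + \<epsilon>"
proof -
  have bdd: "bdd_below (upper \<sigma> ` left_nbhds b)"
    by (rule bdd_belowI[of _ 0]) (use upper_nonneg in auto)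
  have "mass \<sigma> b < mass \<sigma> b + \<epsilon>" using assms by simp
  then obtain S where S: "S \<in> left_nbhds b" "upper \<sigma> S < mass \<sigma> b + \<epsilon>"
    using cINF_less_iff[OF _ bdd, of "mass \<sigma> b + \<epsilon>"] atMost_left_nbhds unfolding mass_def by blast
  have "mass \<sigma> b \<le> upper \<sigma> S'" if "S' \<in> left_nbhds b" for S'
    unfolding mass_def by (rule cINF_lower[OF bdd that])
  moreover have "upper \<sigma> S' < mass \<sigma> b + \<epsilon>" if "S' \<subseteq> S" for S'
    using upper_mono[OF that, of \<sigma>] S(2) by linarith
  ultimately show ?thesis using S(1) by blast
qed

lemma coef_limit:
  assumes "\<epsilon> > 0"
  shows "\<exists>S\<in>left_nbhds b. \<forall>S'\<in>left_nbhds b. S' \<subseteq> S \<longrightarrow> \<bar>L (indicator S') - coef b\<bar> < \<epsilon>"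
proof -
  obtain S where S: "S \<in> left_nbhds b" "\<And>S'. S' \<in> left_nbhds b \<Longrightarrow> S' \<subseteq> S \<Longrightarrow>
      mass 1 b \<le> upper 1 S' \<and> upper 1 S' < mass 1 b + \<epsilon>"
    using mass_limit[OF assms, of b 1] by blast
  obtain T where T: "T \<in> left_nbhds b" "\<And>S'. S' \<in> left_nbhds b \<Longrightarrow> S' \<subseteq> T \<Longrightarrow>
      mass (-1) b \<le> upper (-1) S' \<and> upper (-1) S' < mass (-1) b + \<epsilon>"
    using mass_limit[OF assms, of b "-1"] by blast
  have "\<bar>L (indicator S') - coef b\<bar> < \<epsilon>" if S': "S' \<in> left_nbhds b" "S' \<subseteq> S \<inter> T" for S'
  proof -
    have "clopen S'" using S'(1) by (simp add: left_nbhds_def)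
    from L_indicator_upper[OF this] show ?thesis
      using S(2)[OF S'(1)] T(2)[OF S'(1)] S'(2) unfolding coef_def abs_less_iff by simp
  qed
  then show ?thesis using left_nbhds_Int[OF S(1) T(1)] by blast
qed

text \<open>\<open>L\<close> is tested on a function of norm at most 1 that takes the signs of the
  coefficients on disjoint clopen neighbourhoods of the points of \<open>X\<close>.\<close>

lemma coef_sum_bound:
  assumes X: "finite X"
  shows "(\<Sum>x\<in>X. \<bar>coef x\<bar>) \<le> M"
proof (rule field_le_epsilon)
  fix e :: real
  assume e: "e > 0"
  \<comment> \<open>The summand 1 keeps the denominator positive for empty \<open>X\<close>.\<close>
  define \<epsilon> where "\<epsilon> = e / (real (card X) + 1)"
  have \<epsilon>: "\<epsilon> > 0" "real (card X) * \<epsilon> \<le> e" using e by (auto simp: \<epsilon>_def field_simps)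
  obtain S where S: "\<And>x. S x \<in> left_nbhds x"
    "\<And>x S'. S' \<in> left_nbhds x \<Longrightarrow> S' \<subseteq> S x \<Longrightarrow> \<bar>L (indicator S') - coef x\<bar> < \<epsilon>"
    using coef_limit[OF \<epsilon>(1)] by metis
  \<comment> \<open>The neighbourhood of a smaller \<open>y\<close> lies inside
    \<open>{..y}\<close>, so removing these segments makes the neighbourhoods disjoint.\<close>
  define T where "T x = S x - (\<Union>y\<in>X \<inter> {..<x}. {..y})" for x
  have cl: "clopen (\<Union>y\<in>X \<inter> {..<x}. {..y})" for x
    using X clopen_atMost by (intro conjI open_UN closed_UN) auto
  have T: "T x \<in> left_nbhds x" for x
  proof -
    have "clopen (T x)"
      unfolding T_def using S(1)[of x] cl[of x] by (intro conjI open_Diff closed_Diff) (auto simp: left_nbhds_def)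
    then show ?thesis using S(1)[of x] by (auto simp: left_nbhds_def T_def)
  qed
  have cont: "continuous_on UNIV (indicator (T x) :: 'k \<Rightarrow> real)" for x
    using T[of x] by (intro continuous_on_indicator_clopen) (simp add: left_nbhds_def)
  let ?g = "\<lambda>z. \<Sum>x\<in>X. sgn (coef x) * indicator (T x) z"
  have uniq: "x = y" if "x \<in> X" "y \<in> X" "z \<in> T x" "z \<in> T y" for x y z
  proof (rule ccontr)
    assume "x \<noteq> y"
    then consider "x < y" | "y < x" by fastforce
    then show False
    proof cases
      case 1
      then have "z \<notin> {..x}" using that by (auto simp: T_def)
      then show False using T[of x] that(3) by (auto simp: left_nbhds_def)
    next
      case 2
      then have "z \<notin> {..y}" using that by (auto simp: T_def)
      then show False using T[of y] that(4) by (auto simp: left_nbhds_def)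
    qed
  qed
  have "\<bar>?g z\<bar> \<le> 1" for z
  proof (cases "\<exists>x\<in>X. z \<in> T x")
    case True
    then obtain x where x: "x \<in> X" "z \<in> T x" by blast
    have "?g z = (\<Sum>y\<in>X. if y = x then sgn (coef x) else 0)"
      using uniq x by (intro sum.cong) (auto simp: indicator_def)
    also have "\<dots> = sgn (coef x)" using X x(1) by simp
    finally show ?thesis by (simp add: abs_sgn_eq)
  next
    case False
    then have "?g z = 0" by (intro sum.neutral) auto
    then show ?thesis by simp
  qed
  then have "\<bar>L ?g\<bar> \<le> M * 1"
    using cont by (intro L_bound continuous_intros) auto
  moreover have "L ?g = (\<Sum>x\<in>X. sgn (coef x) * L (indicator (T x)))"
    by (rule L_sum[OF X cont])
  moreover have "(\<Sum>x\<in>X. \<bar>coef x\<bar>) - real (card X) * \<epsilon> \<le> (\<Sum>x\<in>X. sgn (coef x) * L (indicator (T x)))"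
  proof -
    have "\<bar>coef x\<bar> - \<epsilon> \<le> sgn (coef x) * L (indicator (T x))" for x
    proof -
      have "\<bar>L (indicator (T x)) - coef x\<bar> < \<epsilon>" by (rule S(2)[OF T]) (simp add: T_def)
      then show ?thesis using \<epsilon>(1) by (auto simp: sgn_real_def)
    qed
    then have "(\<Sum>x\<in>X. \<bar>coef x\<bar> - \<epsilon>) \<le> (\<Sum>x\<in>X. sgn (coef x) * L (indicator (T x)))"
      by (rule sum_mono)
    then show ?thesis by (simp add: sum_subtractf)
  qed
  ultimately show "(\<Sum>x\<in>X. \<bar>coef x\<bar>) \<le> M + e" using \<epsilon>(2) by linarith
qed

lemma coef_summable: "coef summable_on UNIV" "infsum (\<lambda>x. \<bar>coef x\<bar>) UNIV \<le> M"
  using summable_on_abs_bounded[of coef, OF coef_sum_bound] by blast+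

text \<open>Transfinite induction: \<open>{..b}\<close> consists of \<open>{..y}\<close> and a short
  clopen interval \<open>{y<..b}\<close>, on which both sides are nearly
  \<open>coef b\<close>.\<close>

lemma L_initial: "L (indicator {..b}) = infsum coef {..b}"
proof (induction b rule: less_induct)
  case (less b)
  have "\<bar>L (indicator {..b}) - infsum coef {..b}\<bar> \<le> 0 + e" if "e > 0" for e
  proof -
    have \<epsilon>: "e / 2 > 0" using that by simp
    obtain S where S: "S \<in> left_nbhds b"
      "\<And>S'. S' \<in> left_nbhds b \<Longrightarrow> S' \<subseteq> S \<Longrightarrow> \<bar>L (indicator S') - coef b\<bar> < e / 2"
      using coef_limit[OF \<epsilon>] by metis
    obtain X where X: "finite X" "\<And>S. S \<inter> X = {} \<Longrightarrow> infsum (\<lambda>x. \<bar>coef x\<bar>) S < e / 2"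
      using summable_on_small_tail[OF coef_summable(1) \<epsilon>] by metis
    have sum: "coef summable_on A" for A by (rule summable_on_UNIV_subset[OF coef_summable(1)])
    show ?thesis
    proof (cases "\<exists>y. y < b")
      case False
      then have "{..b} = {b}" by (auto simp: order_le_less)
      moreover have "S = {b}" using S(1) calculation by (auto simp: left_nbhds_def)
      ultimately show ?thesis using S(2)[OF S(1)] that by simp
    next
      case True
      have "open S" "b \<in> S" using S(1) by (auto simp: left_nbhds_def)
      then obtain y0 where y0: "y0 < b" "{y0<..b} \<subseteq> S" using open_left True by blast
      \<comment> \<open>Above \<open>y0\<close> the interval fits into the neighbourhood
        \<open>S\<close>; above the points of \<open>X\<close> less than \<open>b\<close>, the
        coefficients strictly between \<open>y\<close> and \<open>b\<close> have a small
        sum.\<close>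
      define y where "y = Max (insert y0 (X \<inter> {..<b}))"
      have fin: "finite (insert y0 (X \<inter> {..<b}))" using X(1) by simp
      have y: "y < b" "y0 \<le> y" "\<And>x. x \<in> X \<Longrightarrow> x < b \<Longrightarrow> x \<le> y"
        unfolding y_def using fin y0(1) by auto
      let ?T = "{y<..b}"
      have Teq: "?T = {..b} - {..y}" by auto
      have "clopen ?T" unfolding Teq using clopen_atMost by (intro conjI open_Diff closed_Diff) auto
      moreover have "?T \<subseteq> {y0<..b}" using y(2) by auto
      then have "?T \<subseteq> S" using y0(2) by blast
      ultimately have T: "\<bar>L (indicator ?T) - coef b\<bar> < e / 2"
        using y(1) by (intro S(2)) (auto simp: left_nbhds_def)
      have "L (indicator {..b}) = L (\<lambda>x. indicator {..y} x + indicator ?T x)"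
        using y(1) by (intro arg_cong[of _ _ L]) (auto simp: fun_eq_iff indicator_def)
      also have "\<dots> = L (indicator {..y}) + L (indicator ?T)"
        using \<open>clopen ?T\<close> clopen_atMost by (intro L_add continuous_on_indicator_clopen) auto
      finally have 1: "L (indicator {..b}) = infsum coef {..y} + L (indicator ?T)"
        using less[OF y(1)] by simp
      have "{..b} = {..y} \<union> ({y<..<b} \<union> {b})" using y(1) by auto
      moreover have "infsum coef ({..y} \<union> ({y<..<b} \<union> {b})) = infsum coef {..y} + infsum coef ({y<..<b} \<union> {b})"
        using y(1) by (intro infsum_Un_disjoint sum) auto
      ultimately have "infsum coef {..b} = infsum coef {..y} + infsum coef ({y<..<b} \<union> {b})"
        by (simp only:)
      also have "infsum coef ({y<..<b} \<union> {b}) = infsum coef {y<..<b} + infsum coef {b}"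
        by (intro infsum_Un_disjoint sum) auto
      finally have 2: "infsum coef {..b} = infsum coef {..y} + (infsum coef {y<..<b} + coef b)" by simp
      have "\<bar>infsum coef {y<..<b}\<bar> \<le> infsum (\<lambda>x. \<bar>coef x\<bar>) {y<..<b}"
        by (rule infsum_abs_bound[OF sum])
      also have "\<dots> < e / 2" using y(3) by (intro X(2)) fastforce
      finally show ?thesis using 1 2 T by linarith
    qed
  qed
  then have "\<bar>L (indicator {..b}) - infsum coef {..b}\<bar> \<le> 0" by (rule field_le_epsilon)
  then show ?case by simp
qed

lemma L_steps:
  assumes "g \<in> steps"
  shows "L g = infsum (\<lambda>x. coef x * g x) UNIV"
  using assms
proof induction
  case zero
  then show ?case by (simp add: L_zero)
next
  case (add g c b)
  have ind: "continuous_on UNIV (indicator {..b} :: 'k \<Rightarrow> real)"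
    by (rule continuous_on_indicator_clopen[OF clopen_atMost])
  have "L (\<lambda>x. g x + c * indicator {..b} x) = L g + L (\<lambda>x. c * indicator {..b} x)"
    using ind steps_continuous[OF add.hyps] by (intro L_add continuous_intros)
  then show ?case
    using ind add.IH by (simp add: L_scale L_initial pairing_step_add[OF coef_summable(1) add.hyps])
qed

end

lemma functional_representation:
  fixes L :: "(omega1_interval \<Rightarrow> real) \<Rightarrow> real"
  assumes L_add: "\<And>f g. continuous_on UNIV f \<Longrightarrow> continuous_on UNIV g \<Longrightarrow> L (\<lambda>x. f x + g x) = L f + L g"
    and L_scale: "\<And>c f. continuous_on UNIV f \<Longrightarrow> L (\<lambda>x. c * f x) = c * L f"
    and L_bound: "\<And>f B. continuous_on UNIV f \<Longrightarrow> (\<And>x. \<bar>f x\<bar> \<le> B) \<Longrightarrow> \<bar>L f\<bar> \<le> M * B"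
  obtains a where "a summable_on UNIV" "infsum (\<lambda>x. \<bar>a x\<bar>) UNIV \<le> M"
    "\<And>f. continuous_on UNIV f \<Longrightarrow> L f = infsum (\<lambda>x. a x * f x) UNIV"
proof -
  interpret bounded_functional L M
    by (rule bounded_functional.intro) (fact L_add, fact L_scale, fact L_bound)
  let ?a = coef
  have sum: "?a summable_on UNIV" and norm: "infsum (\<lambda>x. \<bar>?a x\<bar>) UNIV \<le> M"
    by (rule coef_summable)+
  have "L f = infsum (\<lambda>x. ?a x * f x) UNIV" if f: "continuous_on UNIV f" for f
  proof -
    obtain N where N: "\<And>x. \<bar>f x\<bar> \<le> N" using continuous_bounded(2)[OF f] by blast
    have M: "M \<ge> 0" using L_bound[of "\<lambda>x. 0" 1] by simp
    have "\<bar>L f - infsum (\<lambda>x. ?a x * f x) UNIV\<bar> \<le> 0 + e" if e: "e > 0" for e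
    proof -
      \<comment> \<open>Each of the two replacements of \<open>f\<close> by \<open>g\<close> may
        cost \<open>e / 2\<close>; the summand 1 covers \<open>M = 0\<close>.\<close>
      define \<epsilon> where "\<epsilon> = e / (2 * (M + 1))"
      have \<epsilon>: "\<epsilon> > 0" "M * \<epsilon> \<le> e / 2" using e M by (auto simp: \<epsilon>_def field_simps)
      obtain g where g: "g \<in> steps" "\<And>x. \<bar>f x - g x\<bar> < \<epsilon>"
        using step_approximation[OF f \<epsilon>(1)] by metis
      obtain N' where N': "\<And>x. \<bar>g x\<bar> \<le> N'" using steps_bounded[OF g(1)] by blast
      have le: "\<bar>f x - g x\<bar> \<le> \<epsilon>" for x using g(2)[of x] by simp
      have "L (\<lambda>x. f x - g x) = L f - L g"
        using f steps_continuous[OF g(1)] by (rule L_diff)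
      moreover have "\<bar>L (\<lambda>x. f x - g x)\<bar> \<le> M * \<epsilon>"
        using continuous_on_diff[OF f steps_continuous[OF g(1)]] le by (rule L_bound)
      ultimately have "\<bar>L f - L g\<bar> \<le> M * \<epsilon>" by simp
      moreover have "\<bar>infsum (\<lambda>x. ?a x * f x) UNIV - infsum (\<lambda>x. ?a x * g x) UNIV\<bar> \<le> M * \<epsilon>"
        unfolding pairing_diff[OF sum N N']
        using pairing_bound[OF sum le] norm \<epsilon>(1) by (meson less_imp_le mult_right_mono order_trans)
      moreover have "L g = infsum (\<lambda>x. ?a x * g x) UNIV" by (rule L_steps[OF g(1)])
      ultimately show ?thesis using \<epsilon>(2) by linarith
    qed
    then have "\<bar>L f - infsum (\<lambda>x. ?a x * f x) UNIV\<bar> \<le> 0" by (rule field_le_epsilon)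
    then show ?thesis by simp
  qed
  with sum norm show ?thesis by (rule that)
qed

section \<open>Compensating along a binary tree of cells\<close>

text \<open>The share is discontinuous where \<open>p + q\<close> vanishes. There
  \<open>w0 \<le> p0 + q0\<close> forces \<open>w\<close> to tend to 0, and a share never exceeds
  \<open>w\<close>, also with the convention that division by zero gives 0.\<close>

lemma proportional_tendsto:
  fixes p q w :: "'t \<Rightarrow> real"
  assumes p: "(p \<longlongrightarrow> p0) F" and q: "(q \<longlongrightarrow> q0) F" and w: "(w \<longlongrightarrow> w0) F"
    and nonneg: "\<And>t. 0 \<le> p t" "\<And>t. 0 \<le> q t" "\<And>t. 0 \<le> w t" "0 \<le> p0" "0 \<le> q0" "0 \<le> w0"
    and le: "w0 \<le> p0 + q0"
  shows "((\<lambda>t. w t * p t / (p t + q t)) \<longlongrightarrow> w0 * p0 / (p0 + q0)) F"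
proof (cases "p0 + q0 = 0")
  case False
  then show ?thesis by (intro tendsto_intros p q w)
next
  case True
  then have w0: "w0 = 0" using le nonneg by linarith
  have "((\<lambda>t. w t * p t / (p t + q t)) \<longlongrightarrow> 0) F"
  proof (rule Lim_null_comparison)
    show "(w \<longlongrightarrow> 0) F" using w w0 by simp
    have "norm (w t * p t / (p t + q t)) \<le> w t" for t
    proof -
      have "p t / (p t + q t) \<le> 1" using nonneg(1)[of t] nonneg(2)[of t] by (simp add: divide_le_eq)
      then have "w t * (p t / (p t + q t)) \<le> w t * 1" using nonneg(3)[of t] by (rule mult_left_mono)
      then show ?thesis using nonneg(1)[of t] nonneg(2)[of t] nonneg(3)[of t] by simp
    qed
    then show "\<forall>\<^sub>F t in F. norm (w t * p t / (p t + q t)) \<le> w t" by simp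
  qed
  then show ?thesis using w0 by simp
qed

context
  fixes E :: "nat \<Rightarrow> 'k set"
begin

text \<open>The latest decision is the head of the list, so the length of the tail tells which
  \<open>E n\<close> was consulted.\<close>

primrec cell :: "bool list \<Rightarrow> 'k set" where
  "cell [] = UNIV"
| "cell (d # l) = (if d then cell l \<inter> E (length l) else cell l - E (length l))"

primrec branch :: "'k \<Rightarrow> nat \<Rightarrow> bool list" where
  "branch x 0 = []"
| "branch x (Suc n) = (x \<in> E n) # branch x n"

definition cell_pos :: "('k \<Rightarrow> real) \<Rightarrow> bool list \<Rightarrow> real" where
  "cell_pos a l = max 0 (infsum a (cell l))"

text \<open>
  In contrast to the positive part of the measure \<open>a\<close>, these masses of the cells depend continuously
  on \<open>a\<close>.
\<close>

primrec cell_weight :: "('k \<Rightarrow> real) \<Rightarrow> bool list \<Rightarrow> real" where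
  "cell_weight a [] = max 0 (infsum a UNIV)"
| "cell_weight a (d # l) = cell_weight a l * cell_pos a (d # l) / (cell_pos a (True # l) + cell_pos a (False # l))"

text \<open>
  A point off the support of \<open>a\<close> may share all its cells with a point of the support; there the
  limit of the weights would be wrong.
\<close>

definition tree_comp :: "('k \<Rightarrow> real) \<Rightarrow> 'k \<Rightarrow> real" where
  "tree_comp a x = (if a x = 0 then 0 else lim (\<lambda>n. cell_weight a (branch x n)))"

lemma length_branch [simp]: "length (branch x n) = n"
  by (induction n) auto

lemma mem_cell_iff: "x \<in> cell l \<longleftrightarrow> l = branch x (length l)"
  by (induction l) auto

lemma cell_pos_nonneg [simp]: "0 \<le> cell_pos a l"
  by (simp add: cell_pos_def)

lemma cell_weight_nonneg [simp]: "0 \<le> cell_weight a l"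
  by (induction l) auto

lemma cell_split:
  fixes l :: "bool list"
  shows "cell l = cell (True # l) \<union> cell (False # l)" "cell (True # l) \<inter> cell (False # l) = {}"
  by auto

lemma infsum_cell_split:
  assumes "b summable_on UNIV"
  shows "infsum b (cell l) = infsum b (cell (True # l)) + (infsum b (cell (False # l)) :: real)"
  unfolding cell_split(1)[of l]
  by (rule infsum_Un_disjoint) (use cell_split(2)[of l] summable_on_UNIV_subset[OF assms] in auto)

context
  fixes a :: "'k \<Rightarrow> real"
  assumes a: "a summable_on UNIV"
begin

text \<open>This is the invariant of the construction: the weight of a cell is at most the sum of
  the positive masses of its halves, so the quotient of the two is at most 1 and no half gets more
  than its own positive mass.\<close>

lemma cell_weight_le: "cell_weight a l \<le> cell_pos a l"
proof (induction l)
  case Nil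
  then show ?case by (simp add: cell_pos_def)
next
  case (Cons d l)
  let ?D = "cell_pos a (True # l) + cell_pos a (False # l)"
  have "cell_weight a l \<le> ?D"
    using Cons infsum_cell_split[OF a, of l] unfolding cell_pos_def by linarith
  moreover have "0 \<le> ?D" by (simp del: cell.simps)
  ultimately have "cell_weight a l / ?D \<le> ?D / ?D" by (rule divide_right_mono)
  also have "\<dots> \<le> 1" by simp
  finally have "cell_weight a l / ?D \<le> 1" .
  then have "cell_weight a l / ?D * cell_pos a (d # l) \<le> 1 * cell_pos a (d # l)"
    by (rule mult_right_mono) simp
  then show ?case by simp
qed

lemma cell_weight_split: "cell_weight a l = cell_weight a (True # l) + cell_weight a (False # l)"
proof -
  let ?D = "cell_pos a (True # l) + cell_pos a (False # l)"
  have "cell_weight a (True # l) + cell_weight a (False # l) = cell_weight a l * ?D / ?D"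
    by (simp add: add_divide_distrib distrib_left)
  \<comment> \<open>If neither half has positive mass, division by zero gives both the weight 0;
    nothing is lost, since the cell then has weight 0 itself.\<close>
  moreover have "cell_weight a l = 0" if "?D = 0"
    using that cell_weight_le[of l] infsum_cell_split[OF a, of l] cell_weight_nonneg[of a l]
    unfolding cell_pos_def by linarith
  ultimately show ?thesis by (cases "?D = 0") auto
qed

lemma cell_weight_Cons_le: "cell_weight a (d # l) \<le> cell_weight a l"
  using cell_weight_split[of l] cell_weight_nonneg[of a "True # l"] cell_weight_nonneg[of a "False # l"]
  by (cases d) (simp_all only: le_add_same_cancel1 le_add_same_cancel2)

lemma cell_weight_branch_convergent: "(\<lambda>n. cell_weight a (branch x n)) \<longlonglongrightarrow> lim (\<lambda>n. cell_weight a (branch x n))"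
proof -
  have "decseq (\<lambda>n. cell_weight a (branch x n))"
    unfolding branch.simps by (intro decseq_SucI) (simp only: branch.simps cell_weight_Cons_le)
  then have "convergent (\<lambda>n. cell_weight a (branch x n))"
    by (intro Bseq_monoseq_convergent decseq_imp_monoseq decseq_bounded[of _ 0]) auto
  then show ?thesis by (simp add: convergent_LIMSEQ_iff)
qed

lemma tree_comp_nonneg: "0 \<le> tree_comp a x"
  unfolding tree_comp_def using LIMSEQ_le_const[OF cell_weight_branch_convergent, of 0 x] by auto

text \<open>Dominated convergence: every other point of the support of \<open>b\<close> eventually
  leaves the cells around \<open>x\<close>. Points where \<open>b\<close> vanishes may stay.\<close>

lemma infsum_branch_tendsto:
  assumes b: "b summable_on UNIV" and sep: "\<And>y. b y \<noteq> 0 \<Longrightarrow> y \<noteq> x \<Longrightarrow> \<exists>n. (x \<in> E n) \<noteq> (y \<in> E n)"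
  shows "(\<lambda>n. infsum b (cell (branch x n))) \<longlonglongrightarrow> (b x :: real)"
proof -
  have "(\<lambda>n. infsum (\<lambda>y. b y * indicator (cell (branch x n)) y) UNIV) \<longlonglongrightarrow> infsum (\<lambda>y. b y * indicator {x} y) UNIV"
  proof (rule infsum_dominated_convergence)
    show "(\<lambda>y. \<bar>b y\<bar>) summable_on UNIV" using b by (simp add: summable_on_abs_iff)
    show "\<bar>b y * indicator (cell (branch x n)) y\<bar> \<le> \<bar>b y\<bar>" for n y
      by (auto simp: indicator_def)
    show "(\<lambda>n. b y * indicator (cell (branch x n)) y) \<longlonglongrightarrow> b y * indicator {x} y" for y
    proof (cases "y = x \<or> b y = 0")
      case True
      then have "b y * indicator (cell (branch x n)) y = b y * indicator {x} y" for n
        by (auto simp: mem_cell_iff)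
      then show ?thesis by (simp only: tendsto_const)
    next
      case False
      then obtain m where m: "(x \<in> E m) \<noteq> (y \<in> E m)" using sep by blast
      have "branch x n \<noteq> branch y n" if "m < n" for n
        using that
      proof (induction n)
        case (Suc n)
        then show ?case using m by (cases "m = n") auto
      qed simp
      then have "b y * indicator (cell (branch x n)) y = 0" if "m < n" for n
        using that by (simp add: mem_cell_iff)
      then have "\<forall>\<^sub>F n in sequentially. b y * indicator (cell (branch x n)) y = b y * indicator {x} y"
        using False by (intro eventually_sequentiallyI[of "Suc m"]) auto
      then show ?thesis by (rule tendsto_eventually)
    qed
  qed
  then show ?thesis by (simp add: infsum_indicator)
qed

context
  assumes sep: "\<And>x y. a x \<noteq> 0 \<Longrightarrow> a y \<noteq> 0 \<Longrightarrow> x \<noteq> y \<Longrightarrow> \<exists>n. (x \<in> E n) \<noteq> (y \<in> E n)"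
begin

lemma tree_comp_le: "tree_comp a x \<le> max 0 (a x)"
proof (cases "a x = 0")
  case True
  then show ?thesis by (simp add: tree_comp_def)
next
  case False
  have "(\<lambda>n. cell_pos a (branch x n)) \<longlonglongrightarrow> max 0 (a x)"
    unfolding cell_pos_def by (intro tendsto_intros infsum_branch_tendsto a) (use sep False in blast)
  then have "lim (\<lambda>n. cell_weight a (branch x n)) \<le> max 0 (a x)"
    by (rule LIMSEQ_le[OF cell_weight_branch_convergent]) (use cell_weight_le in blast)
  then show ?thesis using False by (simp add: tree_comp_def)
qed

lemma tree_comp_summable: "tree_comp a summable_on S"
  by (rule summable_on_dominated[OF summable_on_pos_part[OF summable_on_UNIV_subset[OF a]]])
    (simp add: tree_comp_nonneg tree_comp_le)

text \<open>
  Spreading the weight of each cell of level \<open>n\<close> over the cell in proportion to the positive part of \<open>a\<close>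
  gives the right masses down to level \<open>n\<close>; these distributions converge to \<open>tree_comp a\<close>.
\<close>

lemma infsum_tree_comp_cell: "infsum (tree_comp a) (cell l) = cell_weight a l"
proof -
  define P where "P l = infsum (\<lambda>x. max 0 (a x)) (cell l)" for l
  define \<nu> where "\<nu> n x = cell_weight a (branch x n) / P (branch x n) * max 0 (a x)" for n x
  have pos: "(\<lambda>x. max 0 (a x)) summable_on S" for S
    by (rule summable_on_pos_part[OF summable_on_UNIV_subset[OF a]])
  have P_nonneg: "0 \<le> P l" for l unfolding P_def by (rule infsum_nonneg) simp
  have "infsum a (cell l) \<le> P l" for l
    unfolding P_def by (rule infsum_le_pos_part[OF summable_on_UNIV_subset[OF a]])
  then have weight_P: "cell_weight a l \<le> P l" for l
    using cell_weight_le[of l] P_nonneg[of l] unfolding cell_pos_def by (auto intro: order_trans)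
  have ratio: "0 \<le> cell_weight a l / P l \<and> cell_weight a l / P l \<le> 1" for l
    using weight_P[of l] P_nonneg[of l] by (simp add: divide_le_eq)
  have bound: "\<bar>\<nu> n x\<bar> \<le> max 0 (a x)" for n x
  proof -
    have "0 \<le> \<nu> n x" unfolding \<nu>_def using ratio by (intro mult_nonneg_nonneg) auto
    moreover have "\<nu> n x \<le> 1 * max 0 (a x)" unfolding \<nu>_def using ratio by (intro mult_right_mono) auto
    ultimately show ?thesis by simp
  qed
  \<comment> \<open>For \<open>k = 0\<close> the density relative to the positive part is constant
    on the cell; a larger \<open>k\<close> reduces to the two halves, whose weights add up.\<close>
  have level: "infsum (\<nu> (length l + k)) (cell l) = cell_weight a l" for k l
  proof (induction k arbitrary: l)
    case 0
    have "infsum (\<nu> (length l + 0)) (cell l) = infsum (\<lambda>x. cell_weight a l / P l * max 0 (a x)) (cell l)"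
      by (intro infsum_cong) (simp add: \<nu>_def mem_cell_iff)
    also have "\<dots> = cell_weight a l / P l * P l"
      unfolding P_def by (rule infsum_cmult_right) (rule pos)
    also have "\<dots> = cell_weight a l"
      using weight_P[of l] cell_weight_nonneg[of a l] by (cases "P l = 0") auto
    finally show ?case .
  next
    case (Suc k)
    have "\<nu> n summable_on UNIV" for n by (rule summable_on_dominated[OF pos bound])
    then have "infsum (\<nu> (length l + Suc k)) (cell l)
        = infsum (\<nu> (length l + Suc k)) (cell (True # l)) + infsum (\<nu> (length l + Suc k)) (cell (False # l))"
      by (rule infsum_cell_split)
    also have "\<dots> = cell_weight a (True # l) + cell_weight a (False # l)"
      using Suc[of "True # l"] Suc[of "False # l"] by (simp only: list.size add_Suc add_Suc_right add_0_right)
    also have "\<dots> = cell_weight a l" by (rule cell_weight_split[symmetric])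
    finally show ?case .
  qed
  have lim: "(\<lambda>n. \<nu> n x) \<longlonglongrightarrow> tree_comp a x" for x
  proof (cases "a x > 0")
    case True
    have "(\<lambda>n. P (branch x n)) \<longlonglongrightarrow> max 0 (a x)"
      unfolding P_def using sep[of x] True
      by (intro infsum_branch_tendsto[of "\<lambda>x. max 0 (a x)"] pos) (auto simp: max_def split: if_splits)
    then have "(\<lambda>n. cell_weight a (branch x n) / P (branch x n) * max 0 (a x))
        \<longlonglongrightarrow> lim (\<lambda>n. cell_weight a (branch x n)) / max 0 (a x) * max 0 (a x)"
      using True by (intro tendsto_intros cell_weight_branch_convergent) auto
    then show ?thesis using True by (simp add: \<nu>_def[abs_def] tree_comp_def)
  next
    case False
    then have "\<nu> n x = 0" for n by (simp add: \<nu>_def)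
    moreover have "tree_comp a x = 0" using False tree_comp_le[of x] tree_comp_nonneg[of x] by simp
    ultimately show ?thesis by simp
  qed
  have "(\<lambda>n. infsum (\<nu> n) (cell l)) \<longlonglongrightarrow> infsum (tree_comp a) (cell l)"
    by (rule infsum_dominated_convergence[OF pos bound lim])
  then have "(\<lambda>k. infsum (\<nu> (length l + k)) (cell l)) \<longlonglongrightarrow> infsum (tree_comp a) (cell l)"
    by (subst add.commute) (rule LIMSEQ_ignore_initial_segment)
  then show ?thesis by (simp add: level LIMSEQ_const_iff)
qed

lemma infsum_tree_comp_UNIV: "infsum (tree_comp a) UNIV = max 0 (infsum a UNIV)"
  using infsum_tree_comp_cell[of "[]"] by simp

text \<open>\<open>E n\<close> is the disjoint union of the finitely many cells that choose it, so
  its mass is a finite sum of weights.\<close>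

lemma infsum_tree_comp_level: "infsum (tree_comp a) (E n) = (\<Sum>l\<in>{l. length l = n}. cell_weight a (True # l))"
proof -
  have "E n = (\<Union>l\<in>{l. length l = n}. cell (True # l))"
    by (auto simp: mem_cell_iff)
  then have "infsum (tree_comp a) (E n) = infsum (tree_comp a) (\<Union>l\<in>{l. length l = n}. cell (True # l))"
    by (rule arg_cong)
  also have "\<dots> = (\<Sum>l\<in>{l. length l = n}. infsum (tree_comp a) (cell (True # l)))"
  proof (rule sum_infsum[symmetric])
    show "finite {l :: bool list. length l = n}"
      using finite_lists_length_eq[of "UNIV :: bool set" n] by simp
    show "cell (True # l) \<inter> cell (True # l') = {}"
      if "l \<in> {l. length l = n}" "l' \<in> {l. length l = n}" "l \<noteq> l'" for l l'
      using that by (auto simp: mem_cell_iff)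
  qed (rule tree_comp_summable)
  also have "\<dots> = (\<Sum>l\<in>{l. length l = n}. cell_weight a (True # l))"
    by (simp only: infsum_tree_comp_cell)
  finally show ?thesis .
qed

end

end

lemma cell_weight_tendsto:
  assumes sum: "\<And>t. a t summable_on UNIV"
    and lim: "\<And>l. ((\<lambda>t. infsum (a t) (cell l)) \<longlongrightarrow> infsum (a t0) (cell l)) F"
  shows "((\<lambda>t. cell_weight (a t) l) \<longlongrightarrow> cell_weight (a t0) l) F"
proof (induction l)
  case Nil
  then show ?case using lim[of "[]"] by (auto intro!: tendsto_intros)
next
  case (Cons d l)
  have pos: "((\<lambda>t. cell_pos (a t) l) \<longlongrightarrow> cell_pos (a t0) l) F" for l
    unfolding cell_pos_def by (intro tendsto_intros lim)
  have le: "cell_weight (a t0) l \<le> cell_pos (a t0) (True # l) + cell_pos (a t0) (False # l)"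
    using cell_weight_le[OF sum, of t0 l] infsum_cell_split[OF sum, of t0 l] unfolding cell_pos_def by linarith
  show ?case
  proof (cases d)
    case True
    then show ?thesis
      using proportional_tendsto[OF pos[of "True # l"] pos[of "False # l"] Cons] le by simp
  next
    case False
    then show ?thesis
      using proportional_tendsto[OF pos[of "False # l"] pos[of "True # l"] Cons] le by (simp add: add.commute)
  qed
qed

end

section \<open>Countable ordinals and continuity\<close>

text \<open>Otherwise \<open>{..<Omega1}\<close> would be a countable union of countable sets. All
  later thresholds rest on this.\<close>

lemma countable_bounded_below_Omega1:
  assumes A: "countable A" "\<And>x. x \<in> A \<Longrightarrow> x < Omega1"
  shows "\<exists>b<Omega1. \<forall>x\<in>A. x \<le> b"
proof (rule ccontr)
  assume no: "\<not> ?thesis"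
  have "{..<Omega1} \<subseteq> (\<Union>x\<in>A. {..<x})"
    using no by (auto simp: not_le)
  moreover have "countable (\<Union>x\<in>A. {..<x})"
    using A countable_below_Omega1 by (intro countable_UN) auto
  ultimately show False
    using uncountable_below_Omega1 countable_subset by blast
qed

lemma below_Omega1: "\<exists>b. b < Omega1"
  using countable_bounded_below_Omega1[of "{}"] by auto

lemma countable_atMost:
  assumes "b < Omega1"
  shows "countable {..b}"
proof -
  have "{..b} = insert b {..<b}" by auto
  then show ?thesis using countable_below_Omega1[OF assms] by simp
qed

lemma successor_below_Omega1:
  assumes "b < Omega1"
  shows "\<exists>c<Omega1. b < c"
proof (rule ccontr)
  assume "\<not> ?thesis"
  then have "x \<le> b" if "x < Omega1" for x using that not_le by blast
  then have "{..<Omega1} \<subseteq> {..b}" by blast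
  then show False
    using countable_subset countable_atMost[OF assms] uncountable_below_Omega1 by blast
qed

lemma less_Omega1_iff: "x < Omega1 \<longleftrightarrow> x \<noteq> Omega1"
  using le_Omega1[of x] by (auto simp: less_le)

text \<open>For each \<open>n\<close> the values stay within \<open>1 / (n + 1)\<close> of
  \<open>f Omega1\<close> beyond some countable ordinal; beyond a common bound of these ordinals no
  difference is left.\<close>

lemma eventually_constant:
  fixes f :: "omega1_interval \<Rightarrow> real"
  assumes f: "continuous_on UNIV f"
  shows "\<exists>b<Omega1. \<forall>t>b. f t = f Omega1"
proof -
  have "\<exists>b<Omega1. \<forall>t>b. \<bar>f t - f Omega1\<bar> < inverse (real (Suc n))" for n
  proof -
    let ?U = "f -` {f Omega1 - inverse (real (Suc n))<..<f Omega1 + inverse (real (Suc n))}"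
    have "open ?U" using f by (intro open_vimage) auto
    moreover have "Omega1 \<in> ?U" by simp
    moreover obtain c where "c < Omega1" using below_Omega1 by blast
    ultimately obtain b where b: "b < Omega1" "{b<..Omega1} \<subseteq> ?U" using open_left by blast
    have "\<bar>f t - f Omega1\<bar> < inverse (real (Suc n))" if "b < t" for t
    proof -
      have "t \<in> {b<..Omega1}" using that le_Omega1[of t] by simp
      then have "t \<in> ?U" using b(2) by blast
      then show ?thesis by (auto simp: abs_less_iff)
    qed
    then show ?thesis using b(1) by blast
  qed
  then obtain b where b: "\<And>n. b n < Omega1" "\<And>n t. t > b n \<Longrightarrow> \<bar>f t - f Omega1\<bar> < inverse (real (Suc n))"
    by metis
  obtain c where c: "c < Omega1" "\<And>n. b n \<le> c"
    using countable_bounded_below_Omega1[of "range b"] b(1) by auto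
  have "f t = f Omega1" if t: "t > c" for t
  proof (rule ccontr)
    assume "f t \<noteq> f Omega1"
    then have "0 < \<bar>f t - f Omega1\<bar>" by simp
    then obtain n where "inverse (real (Suc n)) < \<bar>f t - f Omega1\<bar>" using reals_Archimedean by blast
    then show False using b(2)[OF le_less_trans[OF c(2)[of n] t]] by simp
  qed
  then show ?thesis using c(1) by blast
qed

lemma support_bounded_below_Omega1:
  fixes a :: "omega1_interval \<Rightarrow> real"
  assumes "a summable_on UNIV"
  shows "\<exists>b<Omega1. \<forall>x>b. x < Omega1 \<longrightarrow> a x = 0"
proof -
  have "countable {x \<in> UNIV. a x \<noteq> 0}" by (rule summable_countable_real[OF assms])
  then have "countable ({x. a x \<noteq> 0} \<inter> {..<Omega1})" by simp
  then obtain b where b: "b < Omega1" "\<And>x. x \<in> {x. a x \<noteq> 0} \<inter> {..<Omega1} \<Longrightarrow> x \<le> b"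
    using countable_bounded_below_Omega1[of "{x. a x \<noteq> 0} \<inter> {..<Omega1}"] by auto
  have "a x = 0" if "b < x" "x < Omega1" for x
    using b(2)[of x] that leD[of x b] by auto
  then show ?thesis using b(1) by blast
qed

lemma infsum_beyond:
  fixes c :: "omega1_interval \<Rightarrow> real"
  assumes "\<And>x. b < x \<Longrightarrow> x < Omega1 \<Longrightarrow> c x = 0" "b < Omega1"
  shows "infsum c (- {..b}) = c Omega1"
proof -
  have "infsum c (- {..b}) = infsum c {Omega1}"
  proof (rule infsum_cong_neutral)
    show "c x = 0" if "x \<in> - {..b} - {Omega1}" for x
      using that assms(1)[of x] less_Omega1_iff[of x] by auto
    show "c x = 0" if "x \<in> {Omega1} - - {..b}" for x
      using that assms(2) by auto
  qed simp
  then show ?thesis by simp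
qed

lemma initial_sums_determine:
  fixes a a' :: "'k::wellorder \<Rightarrow> real"
  assumes a: "a summable_on UNIV" and a': "a' summable_on UNIV"
    and eq: "\<And>y. y \<le> b \<Longrightarrow> infsum a {..y} = infsum a' {..y}"
  shows "x \<le> b \<Longrightarrow> a x = a' x"
proof (induction x rule: less_induct)
  case (less x)
  have *: "infsum c {..x} = infsum c {..<x} + c x" if "c summable_on UNIV" for c :: "'k \<Rightarrow> real"
  proof -
    have "infsum c ({..<x} \<union> {x}) = infsum c {..<x} + infsum c {x}"
      by (intro infsum_Un_disjoint summable_on_UNIV_subset[OF that]) auto
    moreover have "{..<x} \<union> {x} = {..x}" by auto
    ultimately show ?thesis by simp
  qed
  have "infsum a {..<x} = infsum a' {..<x}"
    using less by (intro infsum_cong) auto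
  then show ?case using *[OF a] *[OF a'] eq[OF less.prems] by linarith
qed

lemma continuous_on_UNIV_iff_nhds:
  "continuous_on UNIV f \<longleftrightarrow> (\<forall>t. (f \<longlongrightarrow> f t) (nhds t))"
  by (simp add: continuous_on_def tendsto_at_iff_tendsto_nhds)

text \<open>\<open>{c<..t}\<close> is a neighbourhood of \<open>t\<close>, so continuity at
  \<open>t\<close> concerns only arguments up to \<open>t\<close>. This is why the intervals below
  are closed on the right.\<close>

lemma eventually_nhds_left:
  fixes t :: "'k::{wellorder, linorder_topology}"
  assumes "c < t"
  shows "\<forall>\<^sub>F s in nhds t. c < s \<and> s \<le> t"
proof -
  have "open ({c<..} \<inter> {..t})" using clopen_atMost by (intro open_Int) auto
  then have "\<forall>\<^sub>F s in nhds t. s \<in> {c<..} \<inter> {..t}" using assms by (intro eventually_nhds_in_open) auto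
  then show ?thesis by simp
qed

text \<open>What holds eventually at \<open>nhds t\<close> holds at \<open>t\<close> itself, so the
  limit values agree too.\<close>

lemma tendsto_nhds_cong:
  assumes "\<forall>\<^sub>F s in nhds t. f s = g s" "(g \<longlongrightarrow> g t) (nhds t)"
  shows "(f \<longlongrightarrow> f t) (nhds t)"
  using assms eventually_nhds_x_imp_x[OF assms(1)] tendsto_cong[OF assms(1)] by simp

section \<open>Initial segments as a tree\<close>

text \<open>
  The cells generated by \<open>segments k\<close> separate the points of \<open>{..k} \<union> {Omega1}\<close>. Starting
  with \<open>{..k}\<close> itself makes the share of \<open>Omega1\<close> independent of \<open>k\<close>.
\<close>

definition segments :: "omega1_interval \<Rightarrow> nat \<Rightarrow> omega1_interval set" where
  "segments k n = (case n of 0 \<Rightarrow> {..k} | Suc i \<Rightarrow> {..from_nat_into {..k} i})"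

text \<open>\<open>Omega1\<close> is exempt; with this exemption every summable function has such a
  \<open>k\<close> below \<open>Omega1\<close>.\<close>

definition supported :: "omega1_interval \<Rightarrow> (omega1_interval \<Rightarrow> real) \<Rightarrow> bool" where
  "supported k a \<longleftrightarrow> (\<forall>x>k. x < Omega1 \<longrightarrow> a x = 0)"

definition seg_comp :: "omega1_interval \<Rightarrow> (omega1_interval \<Rightarrow> real) \<Rightarrow> omega1_interval \<Rightarrow> real" where
  "seg_comp k = tree_comp (segments k)"

lemma segments_surj:
  assumes "k < Omega1" "b \<le> k"
  shows "\<exists>n. segments k n = {..b}"
proof -
  obtain i where "from_nat_into {..k} i = b"
    using from_nat_into_surj[OF countable_atMost[OF assms(1)], of b] assms(2) by auto
  then show ?thesis by (intro exI[of _ "Suc i"]) (simp add: segments_def)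
qed

lemma clopen_cell_segments: "clopen (cell (segments k) l)"
proof (induction l)
  case (Cons d l)
  have "clopen (segments k (length l))"
    using clopen_atMost by (cases "length l") (simp_all add: segments_def)
  then show ?case using Cons by (auto intro: open_Diff closed_Diff)
qed simp

context
  fixes k and a :: "omega1_interval \<Rightarrow> real"
  assumes k: "k < Omega1" and a: "a summable_on UNIV" and supp: "supported k a"
begin

lemma segments_separate:
  assumes "a x \<noteq> 0" "a y \<noteq> 0" "x \<noteq> y"
  shows "\<exists>n. (x \<in> segments k n) \<noteq> (y \<in> segments k n)"
proof -
  have "\<exists>n. x \<in> segments k n \<and> y \<notin> segments k n" if "x < y" "a x \<noteq> 0" for x y
  proof -
    have "x < Omega1" using that(1) le_Omega1 by (rule less_le_trans)
    then have "x \<le> k" using supp that(2) by (force simp: supported_def)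
    then obtain n where "segments k n = {..x}" using segments_surj[OF k] by blast
    then show ?thesis using that(1) by (intro exI[of _ n]) auto
  qed
  then show ?thesis using assms by (cases x y rule: linorder_cases) blast+
qed

lemma seg_comp_nonneg: "0 \<le> seg_comp k a x"
  unfolding seg_comp_def by (rule tree_comp_nonneg[OF a])

lemma seg_comp_le: "seg_comp k a x \<le> max 0 (a x)"
  unfolding seg_comp_def by (rule tree_comp_le[OF a segments_separate])

lemma seg_comp_zero: "a x = 0 \<Longrightarrow> seg_comp k a x = 0"
  using seg_comp_le[of x] seg_comp_nonneg[of x] by simp

lemma seg_comp_summable: "seg_comp k a summable_on S"
  unfolding seg_comp_def by (rule tree_comp_summable[OF a segments_separate])

lemma infsum_seg_comp_UNIV: "infsum (seg_comp k a) UNIV = max 0 (infsum a UNIV)"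
  unfolding seg_comp_def by (rule infsum_tree_comp_UNIV[OF a segments_separate])

lemma infsum_seg_comp_beyond:
  assumes "k \<le> b" "b < Omega1"
  shows "infsum (seg_comp k a) {..b} = infsum (seg_comp k a) {..k}"
  using assms supp by (intro infsum_cong_neutral seg_comp_zero) (auto simp: supported_def)

lemma infsum_supported: "infsum a UNIV = infsum a {..k} + a Omega1"
  using infsum_split[OF a, of "{..k}"] infsum_beyond[of k a] supp k
  by (simp add: supported_def Compl_eq_Diff_UNIV)

text \<open>The complement of \<open>{..k}\<close> is a cell of level 1 in which only
  \<open>Omega1\<close> is charged, so the share of \<open>Omega1\<close> is settled by the first
  split.\<close>

lemma seg_comp_Omega1:
  "seg_comp k a Omega1 = max 0 (infsum a UNIV) * max 0 (a Omega1) /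
    (max 0 (infsum a UNIV - a Omega1) + max 0 (a Omega1))"
proof -
  have cells: "cell (segments k) [False] = - {..k}" "cell (segments k) [True] = {..k}"
    by (auto simp: segments_def)
  have a: "infsum a (- {..k}) = a Omega1"
    using infsum_beyond[of k a] supp k by (simp add: supported_def)
  have "infsum (seg_comp k a) (- {..k}) = seg_comp k a Omega1"
    using supp by (intro infsum_beyond k seg_comp_zero) (simp add: supported_def)
  moreover have "infsum (seg_comp k a) (- {..k}) = cell_weight (segments k) a [False]"
    unfolding seg_comp_def cells(1)[symmetric] by (rule infsum_tree_comp_cell[OF \<open>a summable_on UNIV\<close> segments_separate])
  ultimately show ?thesis
    using infsum_supported cells a by (simp add: cell_pos_def del: cell.simps)
qed

text \<open>Nothing is charged between \<open>b\<close> and \<open>Omega1\<close>, so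
  \<open>{..b}\<close> receives what \<open>Omega1\<close> leaves over, an amount independent of
  \<open>k\<close>.\<close>

lemma infsum_seg_comp_before:
  assumes "\<And>x. b < x \<Longrightarrow> x < Omega1 \<Longrightarrow> a x = 0" "b < Omega1"
  shows "infsum (seg_comp k a) {..b} = max 0 (infsum a UNIV) - seg_comp k a Omega1"
  using infsum_split[OF seg_comp_summable, of UNIV "{..b}"] infsum_seg_comp_UNIV
    infsum_beyond[OF seg_comp_zero[OF assms(1)] assms(2)]
  by (simp add: Compl_eq_Diff_UNIV)

end

text \<open>Segments up to \<open>k\<close> occur in the tree and have masses that are finite sums
  of continuous weights. Beyond \<open>k\<close> only \<open>Omega1\<close> adds mass, and the total
  is prescribed.\<close>

lemma seg_comp_tendsto:
  assumes k: "k < Omega1" and sum: "\<And>t. a t summable_on UNIV"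
    and supp: "\<forall>\<^sub>F t in nhds t0. supported k (a t)"
    and lim: "\<And>S. clopen S \<Longrightarrow> ((\<lambda>t. infsum (a t) S) \<longlongrightarrow> infsum (a t0) S) (nhds t0)"
  shows "((\<lambda>t. infsum (seg_comp k (a t)) {..b}) \<longlongrightarrow> infsum (seg_comp k (a t0)) {..b}) (nhds t0)"
proof -
  have initial: "((\<lambda>t. infsum (seg_comp k (a t)) {..c}) \<longlongrightarrow> infsum (seg_comp k (a t0)) {..c}) (nhds t0)"
    if c: "c \<le> k" for c
  proof -
    obtain n where n: "segments k n = {..c}" using segments_surj[OF k c] by blast
    let ?g = "\<lambda>t. \<Sum>l\<in>{l. length l = n}. cell_weight (segments k) (a t) (True # l)"
    have "\<forall>\<^sub>F t in nhds t0. infsum (seg_comp k (a t)) {..c} = ?g t"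
      using supp
    proof (rule eventually_mono)
      fix t assume "supported k (a t)"
      then show "infsum (seg_comp k (a t)) {..c} = ?g t"
        unfolding n[symmetric] seg_comp_def
        by (intro infsum_tree_comp_level sum segments_separate[OF k sum]) auto
    qed
    moreover have "(?g \<longlongrightarrow> ?g t0) (nhds t0)"
      by (intro tendsto_sum cell_weight_tendsto sum lim clopen_cell_segments)
    ultimately show ?thesis by (rule tendsto_nhds_cong)
  qed
  consider "b \<le> k" | "k < b" "b < Omega1" | "b = Omega1" using less_Omega1_iff by fastforce
  then show ?thesis
  proof cases
    case 1
    then show ?thesis by (rule initial)
  next
    case 2
    have "\<forall>\<^sub>F t in nhds t0. infsum (seg_comp k (a t)) {..b} = infsum (seg_comp k (a t)) {..k}"
      using supp 2 by (auto elim!: eventually_mono intro: infsum_seg_comp_beyond[OF k sum])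
    then show ?thesis using initial[of k] by (rule tendsto_nhds_cong) simp
  next
    case 3
    then have b: "{..b} = UNIV" using le_Omega1 by auto
    have "\<forall>\<^sub>F t in nhds t0. infsum (seg_comp k (a t)) {..b} = max 0 (infsum (a t) UNIV)"
      unfolding b using supp by (rule eventually_mono) (rule infsum_seg_comp_UNIV[OF k sum])
    moreover have "((\<lambda>t. max 0 (infsum (a t) UNIV)) \<longlongrightarrow> max 0 (infsum (a t0) UNIV)) (nhds t0)"
      by (intro tendsto_intros lim) simp
    ultimately show ?thesis by (rule tendsto_nhds_cong)
  qed
qed

section \<open>Local compensation on \<open>[0, \<omega>\<^sub>1]\<close>\<close>

locale omega1_family =
  fixes a :: "omega1_interval \<Rightarrow> omega1_interval \<Rightarrow> real"
  assumes a: "atomic_family a"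
begin

lemma summable_a: "a t summable_on S"
  using a by (auto simp: atomic_family_def intro: summable_on_UNIV_subset)

text \<open>There are only countably many \<open>x\<close> and \<open>t\<close> up to
  \<open>b\<close>. Each \<open>x\<close> has a time after which the mass of \<open>{..x}\<close> is
  constant, each \<open>t\<close> a bound for the support of \<open>a t\<close>, and these ordinals
  have a common countable bound.\<close>

lemma threshold:
  assumes b: "b < Omega1"
  shows "\<exists>c. b < c \<and> c < Omega1 \<and> (\<forall>t>c. \<forall>x\<le>b. a t x = a Omega1 x) \<and> (\<forall>t\<le>b. supported c (a t))"
proof -
  have "\<exists>c<Omega1. \<forall>t>c. infsum (a t) {..x} = infsum (a Omega1) {..x}" for x
    using a by (intro eventually_constant) (simp add: atomic_family_def)
  then obtain u where u: "\<And>x. u x < Omega1"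
    "\<And>x t. t > u x \<Longrightarrow> infsum (a t) {..x} = infsum (a Omega1) {..x}" by metis
  have "\<exists>c<Omega1. \<forall>x>c. x < Omega1 \<longrightarrow> a t x = 0" for t
    using summable_a by (rule support_bounded_below_Omega1)
  then obtain v where v: "\<And>t. v t < Omega1" "\<And>t x. v t < x \<Longrightarrow> x < Omega1 \<Longrightarrow> a t x = 0" by metis
  have "countable (insert b (u ` {..b} \<union> v ` {..b}))" using countable_atMost[OF b] by simp
  moreover have "x < Omega1" if "x \<in> insert b (u ` {..b} \<union> v ` {..b})" for x
    using that u(1) v(1) b by blast
  ultimately obtain c where c: "c < Omega1" "\<And>x. x \<in> insert b (u ` {..b} \<union> v ` {..b}) \<Longrightarrow> x \<le> c"
    using countable_bounded_below_Omega1 by metis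
  \<comment> \<open>One step further guarantees \<open>b < d\<close>, so that \<open>settled\<close>
    is strictly increasing under iteration.\<close>
  obtain d where d: "c < d" "d < Omega1" using successor_below_Omega1[OF c(1)] by blast
  have "b < d" using c(2)[of b] d(1) by simp
  moreover have "a t x = a Omega1 x" if "t > d" "x \<le> b" for t x
  proof (rule initial_sums_determine[OF summable_a summable_a _ that(2)])
    fix y assume "y \<le> b"
    then have "u y \<le> c" using c(2) by simp
    then have "u y < t" using d(1) that(1) by simp
    then show "infsum (a t) {..y} = infsum (a Omega1) {..y}" by (rule u(2))
  qed
  moreover have "supported d (a t)" if "t \<le> b" for t
  proof -
    have "v t \<le> c" using c(2) that by simp
    then have "v t < x" if "d < x" for x using d(1) that by simp
    then show ?thesis using v(2)[of t] by (auto simp: supported_def)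
  qed
  ultimately show ?thesis using d(2) by blast
qed

definition settled :: "omega1_interval \<Rightarrow> omega1_interval" where
  "settled b = (SOME c. b < c \<and> c < Omega1 \<and> (\<forall>t>c. \<forall>x\<le>b. a t x = a Omega1 x) \<and> (\<forall>t\<le>b. supported c (a t)))"

lemma settled:
  assumes "b < Omega1"
  shows "b < settled b" "settled b < Omega1" "\<And>t x. t > settled b \<Longrightarrow> x \<le> b \<Longrightarrow> a t x = a Omega1 x"
    "\<And>t. t \<le> b \<Longrightarrow> supported (settled b) (a t)"
  using someI_ex[OF threshold[OF assms], folded settled_def] by blast+

lemma split_point:
  "\<exists>b c. b < c \<and> c < Omega1 \<and> supported b (a Omega1) \<and> (\<forall>t>c. \<forall>x\<le>b. a t x = a Omega1 x)
    \<and> (\<forall>t>c. infsum (a t) UNIV = infsum (a Omega1) UNIV)"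
proof -
  obtain b where b: "b < Omega1" "supported b (a Omega1)"
    using support_bounded_below_Omega1[OF summable_a] unfolding supported_def by blast
  have top: "{..Omega1} = UNIV" using le_Omega1 by auto
  have "continuous_on UNIV (\<lambda>t. infsum (a t) UNIV)"
    using a unfolding atomic_family_def top[symmetric] by blast
  then obtain c where c: "c < Omega1" "\<And>t. t > c \<Longrightarrow> infsum (a t) UNIV = infsum (a Omega1) UNIV"
    using eventually_constant by blast
  have "b < max (settled b) c" "max (settled b) c < Omega1" using settled(1,2)[OF b(1)] c(1) by (auto simp: less_max_iff_disj)
  moreover have "\<forall>t>max (settled b) c. \<forall>x\<le>b. a t x = a Omega1 x"
    using settled(3)[OF b(1)] by (auto simp only: max_less_iff_conj)
  moreover have "\<forall>t>max (settled b) c. infsum (a t) UNIV = infsum (a Omega1) UNIV"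
    using c(2) by (auto simp only: max_less_iff_conj)
  ultimately show ?thesis using b(2) by blast
qed

definition fixed_end :: omega1_interval where
  "fixed_end = (SOME b. \<exists>c. b < c \<and> c < Omega1 \<and> supported b (a Omega1) \<and> (\<forall>t>c. \<forall>x\<le>b. a t x = a Omega1 x)
    \<and> (\<forall>t>c. infsum (a t) UNIV = infsum (a Omega1) UNIV))"

definition fixed_time :: omega1_interval where
  "fixed_time = (SOME c. fixed_end < c \<and> c < Omega1 \<and> supported fixed_end (a Omega1) \<and> (\<forall>t>c. \<forall>x\<le>fixed_end. a t x = a Omega1 x)
    \<and> (\<forall>t>c. infsum (a t) UNIV = infsum (a Omega1) UNIV))"

lemma fixed_facts:
  shows "fixed_end < fixed_time" "fixed_time < Omega1" "supported fixed_end (a Omega1)"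
    "\<And>t x. t > fixed_time \<Longrightarrow> x \<le> fixed_end \<Longrightarrow> a t x = a Omega1 x"
    "\<And>t. t > fixed_time \<Longrightarrow> infsum (a t) UNIV = infsum (a Omega1) UNIV"
  using someI_ex[OF someI_ex[OF split_point, folded fixed_end_def], folded fixed_time_def] by blast+

text \<open>
  For \<open>t > fixed_time\<close> the measure \<open>a t\<close> is a fixed measure on \<open>{..fixed_end}\<close> plus a moving part
  \<open>moving t\<close> of fixed total mass \<open>mass\<close>.
\<close>

definition moving :: "omega1_interval \<Rightarrow> omega1_interval \<Rightarrow> real" where
  "moving t x = (if x \<le> fixed_end then 0 else a t x)"

lemma infsum_moving: "infsum (moving t) S = infsum (a t) (S \<inter> - {..fixed_end})"
  by (rule infsum_cong_neutral) (auto simp: moving_def)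

lemma summable_moving: "moving t summable_on S"
  by (rule summable_on_dominated[of "\<lambda>x. \<bar>a t x\<bar>"]) (auto simp: moving_def summable_on_abs_iff summable_a)

lemma moving_clopen_tendsto:
  assumes "clopen S"
  shows "((\<lambda>t. infsum (moving t) S) \<longlongrightarrow> infsum (moving t0) S) (nhds t0)"
proof -
  have "clopen (S - {..fixed_end})" using assms clopen_atMost[of fixed_end] by (intro conjI open_Diff closed_Diff) auto
  from atomic_family_clopen[OF a this] show ?thesis
    unfolding infsum_moving continuous_on_UNIV_iff_nhds Diff_eq by blast
qed

text \<open>Since \<open>a Omega1\<close> charges nothing between \<open>fixed_end\<close> and
  \<open>Omega1\<close>, this is its atom at \<open>Omega1\<close>.\<close>

definition mass :: real where "mass = infsum (moving Omega1) UNIV"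

lemma infsum_moving_UNIV:
  assumes "t > fixed_time"
  shows "infsum (moving t) UNIV = mass"
proof -
  have "infsum (a t) {..fixed_end} = infsum (a Omega1) {..fixed_end}"
    using fixed_facts(4)[OF assms] by (intro infsum_cong) auto
  then show ?thesis
    using fixed_facts(5)[OF assms] infsum_split[OF summable_a, of t UNIV "{..fixed_end}"] infsum_split[OF summable_a, of Omega1 UNIV "{..fixed_end}"]
    by (simp add: mass_def infsum_moving Compl_eq_Diff_UNIV)
qed

lemma moving_Omega1:
  assumes "x < Omega1"
  shows "moving Omega1 x = 0"
  using fixed_facts(3) assms by (auto simp: moving_def supported_def not_le)

lemma supported_moving: "supported k (a t) \<Longrightarrow> supported k (moving t)"
  by (simp add: supported_def moving_def)

section \<open>Cuts and the trees between them\<close>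

definition cuts :: "omega1_interval set" where
  "cuts = {c. fixed_time < c \<and> c < Omega1 \<and> (\<forall>t\<ge>c. \<forall>x<c. moving t x = 0) \<and>
    (\<forall>t<c. \<forall>x\<ge>c. x < Omega1 \<longrightarrow> moving t x = 0)}"

text \<open>\<open>settled\<close> is iterated, and \<open>c\<close> is the least strict upper bound
  of the iterates. A time or position below \<open>c\<close> is at most some
  \<open>\<gamma> n\<close>, and its threshold \<open>\<gamma> (Suc n)\<close> is still below
  \<open>c\<close>.\<close>

lemma cuts_unbounded:
  assumes b: "b < Omega1"
  shows "\<exists>c\<in>cuts. b < c"
proof -
  define \<gamma> where "\<gamma> n = (settled ^^ n) (max b fixed_time)" for n
  have \<gamma>: "\<gamma> n < Omega1" for n
    by (induction n) (use b fixed_facts(2) settled(2) in \<open>auto simp: \<gamma>_def\<close>)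
  have Suc: "\<gamma> (Suc n) = settled (\<gamma> n)" for n by (simp add: \<gamma>_def)
  have "\<exists>d. \<forall>n. \<gamma> n < d"
    using \<gamma> by blast
  define c where "c = (LEAST d. \<forall>n. \<gamma> n < d)"
  have c: "\<gamma> n < c" for n
    using LeastI_ex[OF \<open>\<exists>d. \<forall>n. \<gamma> n < d\<close>] unfolding c_def by blast
  have below: "\<exists>n. x \<le> \<gamma> n" if "x < c" for x
    using not_less_Least[OF that[unfolded c_def]] by (auto simp: not_less)
  obtain d where d: "d < Omega1" "\<And>n. \<gamma> n \<le> d"
    using countable_bounded_below_Omega1[of "range \<gamma>"] \<gamma> by auto
  obtain e where "d < e" "e < Omega1" using successor_below_Omega1[OF d(1)] by blast
  then have "c \<le> e" unfolding c_def using d(2) by (intro Least_le) (auto intro: le_less_trans)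
  then have "c < Omega1" using \<open>e < Omega1\<close> by simp
  moreover have "b < c" "fixed_time < c" using c[of 0] by (auto simp: \<gamma>_def)
  moreover have "moving t x = 0" if tx: "c \<le> t" "x < c" for t x
  proof -
    obtain n where n: "x \<le> \<gamma> n" using below[OF tx(2)] by blast
    have "settled (\<gamma> n) < t" using c[of "Suc n"] tx(1) by (simp add: Suc)
    then have "a t x = a Omega1 x" using settled(3)[OF \<gamma>] n by blast
    moreover have "moving Omega1 x = 0" using tx(2) \<open>c < Omega1\<close> by (intro moving_Omega1) simp
    ultimately show ?thesis by (simp add: moving_def split: if_splits)
  qed
  moreover have "moving t x = 0" if tx: "t < c" "c \<le> x" "x < Omega1" for t x
  proof -
    obtain n where n: "t \<le> \<gamma> n" using below[OF tx(1)] by blast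
    have "settled (\<gamma> n) < x" using c[of "Suc n"] tx(2) by (simp add: Suc)
    then show ?thesis
      using supported_moving[OF settled(4)[OF \<gamma> n]] tx(3) by (simp add: supported_def)
  qed
  ultimately show ?thesis by (intro bexI[of _ c]) (auto simp: cuts_def)
qed

text \<open>It is constant on \<open>{c<..c'}\<close> for consecutive cuts \<open>c\<close> and
  \<open>c'\<close>; these intervals are clopen.\<close>

definition next_cut :: "omega1_interval \<Rightarrow> omega1_interval" where
  "next_cut t = (LEAST c. c \<in> cuts \<and> t \<le> c)"

lemma next_cut:
  assumes "t < Omega1"
  shows "next_cut t \<in> cuts" "t \<le> next_cut t"
proof -
  have "\<exists>c. c \<in> cuts \<and> t \<le> c" using cuts_unbounded[OF assms] by (auto intro: less_imp_le)
  from LeastI_ex[OF this] show "next_cut t \<in> cuts" "t \<le> next_cut t"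
    unfolding next_cut_def by auto
qed

text \<open>For \<open>t < Omega1\<close> this supports \<open>moving s\<close> for all
  \<open>s \<le> next_cut t\<close>, so one tree serves a whole interval between cuts.
  \<open>moving Omega1\<close> charges only \<open>Omega1\<close>, and any countable bound would
  do.\<close>

definition tree_bound :: "omega1_interval \<Rightarrow> omega1_interval" where
  "tree_bound t = (if t = Omega1 then settled fixed_end else settled (next_cut t))"

lemma tree_bound_less: "tree_bound t < Omega1"
  using fixed_facts(1,2) next_cut(1)[of t] by (auto simp: tree_bound_def cuts_def less_Omega1_iff[of t] intro!: settled(2))

lemma supported_settled_next_cut:
  assumes "s \<le> next_cut t" "t < Omega1"
  shows "supported (settled (next_cut t)) (moving s)"
  using next_cut(1)[OF assms(2)] assms(1) by (intro supported_moving settled(4)) (auto simp: cuts_def)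

lemma supported_tree_bound: "supported (tree_bound t) (moving t)"
proof (cases "t = Omega1")
  case True
  then show ?thesis by (simp add: supported_def moving_Omega1)
next
  case False
  then have "t < Omega1" by (simp add: less_Omega1_iff)
  then show ?thesis using supported_settled_next_cut[OF next_cut(2)] False by (simp add: tree_bound_def)
qed

lemmas tree_bound_facts = tree_bound_less summable_moving supported_tree_bound

section \<open>Compensating the moving part\<close>

definition moving_comp :: "omega1_interval \<Rightarrow> omega1_interval \<Rightarrow> real" where
  "moving_comp t = seg_comp (tree_bound t) (moving t)"

lemma moving_comp_Omega1:
  assumes "t > fixed_time"
  shows "moving_comp t Omega1 = max 0 mass * max 0 (moving t Omega1) / (max 0 (mass - moving t Omega1) + max 0 (moving t Omega1))"
  unfolding moving_comp_def seg_comp_Omega1[OF tree_bound_facts] by (simp add: infsum_moving_UNIV[OF assms])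

text \<open>
  If cuts accumulate at \<open>t0\<close> from the left, the moving part close to \<open>t0\<close> is concentrated
  near \<open>t0\<close> and at \<open>Omega1\<close>, whatever trees are used.
\<close>

lemma moving_comp_tendsto_limit_of_cuts:
  assumes t0: "fixed_time < t0" "t0 < Omega1" and limit: "\<And>d. d < t0 \<Longrightarrow> \<exists>c\<in>cuts. d < c \<and> c < t0"
  shows "((\<lambda>t. infsum (moving_comp t) {..b}) \<longlongrightarrow> infsum (moving_comp t0) {..b}) (nhds t0)"
proof -
  define k where "k = settled (next_cut t0)"
  have k: "k < Omega1" "t0 \<le> k"
    using next_cut[OF t0(2)] settled(1,2)[of "next_cut t0"] by (auto simp: k_def cuts_def)
  have supp: "supported k (moving t)" if "t \<le> t0" for t
    unfolding k_def using that next_cut(2)[OF t0(2)] by (intro supported_settled_next_cut t0(2)) simp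
  have left: "\<forall>\<^sub>F t in nhds t0. fixed_time < t \<and> t \<le> t0" by (rule eventually_nhds_left[OF t0(1)])
  \<comment> \<open>For \<open>t \<le> t0\<close> nothing is charged between \<open>k\<close> and
    \<open>Omega1\<close>, so the atom at \<open>Omega1\<close> is \<open>mass\<close> less the mass
    of a clopen set.\<close>
  have top: "((\<lambda>t. moving t Omega1) \<longlongrightarrow> moving t0 Omega1) (nhds t0)"
  proof (rule tendsto_nhds_cong)
    show "\<forall>\<^sub>F t in nhds t0. moving t Omega1 = mass - infsum (moving t) {..k}"
      using left
    proof (rule eventually_mono)
      fix t assume t: "fixed_time < t \<and> t \<le> t0"
      then show "moving t Omega1 = mass - infsum (moving t) {..k}"
        using infsum_supported[OF k(1) summable_moving supp, of t] infsum_moving_UNIV[of t] by simp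
    qed
    show "((\<lambda>t. mass - infsum (moving t) {..k}) \<longlongrightarrow> mass - infsum (moving t0) {..k}) (nhds t0)"
      by (intro tendsto_intros moving_clopen_tendsto clopen_atMost)
  qed
  have zero: "moving t x = 0" if tx: "t < t0" "t0 \<le> x" "x < Omega1" for t x
  proof -
    obtain c where c: "c \<in> cuts" "t < c" "c < t0" using limit[OF tx(1)] by blast
    then have "c \<le> x" using tx(2) by simp
    then show ?thesis using c tx by (simp add: cuts_def)
  qed
  \<comment> \<open>At times \<open>t < t0\<close> the cuts show that only \<open>Omega1\<close> is
    charged beyond \<open>b\<close>, so the equation holds arbitrarily close to \<open>t0\<close>;
    continuity carries it to \<open>t0\<close>.\<close>
  have initial: "infsum (moving t0) {..b} = mass - moving t0 Omega1" if b: "t0 \<le> b" "b < Omega1" for b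
  proof (rule ccontr)
    let ?f = "\<lambda>t. infsum (moving t) {..b} + moving t Omega1"
    assume "infsum (moving t0) {..b} \<noteq> mass - moving t0 Omega1"
    then have "?f t0 \<noteq> mass" by linarith
    moreover have "(?f \<longlongrightarrow> ?f t0) (nhds t0)"
      by (intro tendsto_intros moving_clopen_tendsto clopen_atMost top)
    ultimately have "\<forall>\<^sub>F t in nhds t0. ?f t \<noteq> mass"
      by (rule tendsto_imp_eventually_ne[rotated])
    then obtain U where U: "open U" "t0 \<in> U" "\<And>t. t \<in> U \<Longrightarrow> ?f t \<noteq> mass"
      unfolding eventually_nhds by blast
    obtain y where y: "y < t0" "{y<..t0} \<subseteq> U" using open_left[OF U(1,2) t0(1)] by blast
    obtain t where t: "max y fixed_time < t" "t < t0" using limit[of "max y fixed_time"] y(1) t0(1) by auto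
    have "infsum (moving t) (- {..b}) = moving t Omega1"
      using t(2) b by (intro infsum_beyond zero) auto
    then have "?f t = mass"
      using infsum_split[OF summable_moving, of t UNIV "{..b}"] infsum_moving_UNIV[of t] t(1) by (simp add: Compl_eq_Diff_UNIV)
    moreover have "t \<in> U" using y(2) t by auto
    ultimately show False using U(3) by blast
  qed
  \<comment> \<open>By \<open>initial\<close> the mass of \<open>{..x}\<close> is the same for all
    countable \<open>x \<ge> t0\<close>, which leaves no room for atoms.\<close>
  have zero0: "moving t0 x = 0" if "t0 < x" "x < Omega1" for x
    using that
  proof (induction x rule: less_induct)
    case (less x)
    have "{..x} = {..t0} \<union> {t0<..x}" using less.prems(1) by auto
    moreover have "infsum (moving t0) ({..t0} \<union> {t0<..x}) = infsum (moving t0) {..t0} + infsum (moving t0) {t0<..x}"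
      by (intro infsum_Un_disjoint summable_moving) auto
    ultimately have "infsum (moving t0) {..x} = infsum (moving t0) {..t0} + infsum (moving t0) {t0<..x}"
      by (simp only:)
    moreover have "infsum (moving t0) {t0<..x} = infsum (moving t0) {x}"
      using less by (intro infsum_cong_neutral) auto
    ultimately show ?case
      using initial[of x] initial[of t0] less.prems t0(2) by simp
  qed
  consider "b < t0" | "t0 \<le> b" "b < Omega1" | "b = Omega1" using less_Omega1_iff[of b] by fastforce
  then show ?thesis
  proof cases
    case 1
    obtain c where c: "c \<in> cuts" "b < c" "c < t0" using limit[OF 1] by blast
    have "\<forall>\<^sub>F t in nhds t0. infsum (moving_comp t) {..b} = 0"
      using eventually_nhds_left[OF c(3)]
    proof (rule eventually_mono)
      fix t assume t: "c < t \<and> t \<le> t0"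
      have "moving_comp t x = 0" if "x \<le> b" for x
        unfolding moving_comp_def
        using t c(1,2) that by (intro seg_comp_zero[OF tree_bound_facts]) (auto simp: cuts_def)
      then show "infsum (moving_comp t) {..b} = 0" by (intro infsum_0) auto
    qed
    then show ?thesis by (rule tendsto_nhds_cong) simp
  next
    \<comment> \<open>The tree drops out here: \<open>{..b}\<close> receives the total less the
      share of \<open>Omega1\<close>, and that share is a continuous expression in the atom at
      \<open>Omega1\<close>. For positive \<open>mass\<close> its denominator is at least
      \<open>mass\<close>.\<close>
    case 2
    have "\<forall>\<^sub>F t in nhds t0. infsum (moving_comp t) {..b} = max 0 mass - max 0 mass * max 0 (moving t Omega1) /
        (max 0 (mass - moving t Omega1) + max 0 (moving t Omega1))"
      using left
    proof (rule eventually_mono)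
      fix t assume t: "fixed_time < t \<and> t \<le> t0"
      have "moving t x = 0" if "b < x" "x < Omega1" for x
        using zero[of t x] zero0[of x] t 2 that by (cases "t = t0") auto
      then have "infsum (moving_comp t) {..b} = max 0 mass - moving_comp t Omega1"
        unfolding moving_comp_def using infsum_seg_comp_before[OF tree_bound_facts, of b t] infsum_moving_UNIV[of t] 2(2) t by simp
      then show "infsum (moving_comp t) {..b} = max 0 mass - max 0 mass * max 0 (moving t Omega1) /
          (max 0 (mass - moving t Omega1) + max 0 (moving t Omega1))"
        using moving_comp_Omega1 t by simp
    qed
    moreover have "((\<lambda>t. max 0 mass - max 0 mass * max 0 (moving t Omega1) /
          (max 0 (mass - moving t Omega1) + max 0 (moving t Omega1))) \<longlongrightarrow> max 0 mass - max 0 mass * max 0 (moving t0 Omega1) /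
          (max 0 (mass - moving t0 Omega1) + max 0 (moving t0 Omega1))) (nhds t0)"
    proof (cases "mass > 0")
      case True
      then have "max 0 (mass - moving t0 Omega1) + max 0 (moving t0 Omega1) \<noteq> 0" by linarith
      then show ?thesis by (intro tendsto_intros top)
    next
      case False
      then have "max 0 mass = 0" by simp
      then show ?thesis by simp
    qed
    ultimately show ?thesis by (rule tendsto_nhds_cong)
  next
    case 3
    then have top: "{..b} = UNIV" using le_Omega1 by auto
    have "\<forall>\<^sub>F t in nhds t0. infsum (moving_comp t) {..b} = max 0 mass"
      using left by (rule eventually_mono) (simp add: top moving_comp_def infsum_seg_comp_UNIV[OF tree_bound_facts] infsum_moving_UNIV)
    then show ?thesis by (rule tendsto_nhds_cong) simp
  qed
qed

text \<open>No cut lies strictly between \<open>d\<close> and \<open>t0\<close>, so a single tree is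
  used on the neighbourhood \<open>{d<..t0}\<close>.\<close>

lemma moving_comp_tendsto_between_cuts:
  assumes t0: "fixed_time < t0" "t0 < Omega1" and d: "d < t0" "\<And>c. c \<in> cuts \<Longrightarrow> d < c \<Longrightarrow> t0 \<le> c"
  shows "((\<lambda>t. infsum (moving_comp t) {..b}) \<longlongrightarrow> infsum (moving_comp t0) {..b}) (nhds t0)"
proof (rule tendsto_nhds_cong)
  have left: "\<forall>\<^sub>F t in nhds t0. d < t \<and> t \<le> t0" by (rule eventually_nhds_left[OF d(1)])
  have tree_bound_eq: "tree_bound t = tree_bound t0" if "d < t" "t \<le> t0" for t
  proof -
    have "c \<in> cuts \<and> t \<le> c \<longleftrightarrow> c \<in> cuts \<and> t0 \<le> c" for c
      using d(2)[of c] that by (auto intro: order_trans less_le_trans)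
    moreover have "t \<noteq> Omega1" "t0 \<noteq> Omega1" using that t0(2) less_Omega1_iff le_less_trans by blast+
    ultimately show ?thesis by (simp add: tree_bound_def next_cut_def)
  qed
  show "\<forall>\<^sub>F t in nhds t0. infsum (moving_comp t) {..b} = infsum (seg_comp (tree_bound t0) (moving t)) {..b}"
    using left by (rule eventually_mono) (metis moving_comp_def tree_bound_eq)
  have "supported (tree_bound t0) (moving t)" if "t \<le> t0" for t
    using supported_settled_next_cut[OF order_trans[OF that next_cut(2)[OF t0(2)]] t0(2)] t0(2)[unfolded less_Omega1_iff]
    by (simp add: tree_bound_def)
  then have "\<forall>\<^sub>F t in nhds t0. supported (tree_bound t0) (moving t)"
    using left by (auto elim: eventually_mono)
  then show "((\<lambda>t. infsum (seg_comp (tree_bound t0) (moving t)) {..b}) \<longlongrightarrow> infsum (seg_comp (tree_bound t0) (moving t0)) {..b}) (nhds t0)"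
    by (rule seg_comp_tendsto[OF tree_bound_less summable_moving]) (rule moving_clopen_tendsto)
qed

lemma moving_comp_tendsto_Omega1:
  "((\<lambda>t. infsum (moving_comp t) {..b}) \<longlongrightarrow> infsum (moving_comp Omega1) {..b}) (nhds Omega1)"
proof (cases "b = Omega1")
  case True
  then have top: "{..b} = UNIV" using le_Omega1 by auto
  have "\<forall>\<^sub>F t in nhds Omega1. infsum (moving_comp t) {..b} = max 0 mass"
    using eventually_nhds_left[OF fixed_facts(2)]
    by (rule eventually_mono) (simp add: top moving_comp_def infsum_seg_comp_UNIV[OF tree_bound_facts] infsum_moving_UNIV)
  then show ?thesis by (rule tendsto_nhds_cong) simp
next
  case False
  then obtain c where c: "c \<in> cuts" "b < c" using cuts_unbounded[of b] by (auto simp: less_Omega1_iff)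
  then have "c < Omega1" by (simp add: cuts_def)
  from eventually_nhds_left[OF this] have "\<forall>\<^sub>F t in nhds Omega1. infsum (moving_comp t) {..b} = 0"
  proof (rule eventually_mono)
    fix t assume t: "c < t \<and> t \<le> Omega1"
    have "moving_comp t x = 0" if "x \<le> b" for x
      unfolding moving_comp_def
      using t c(1,2) that by (intro seg_comp_zero[OF tree_bound_facts]) (auto simp: cuts_def)
    then show "infsum (moving_comp t) {..b} = 0" by (intro infsum_0) auto
  qed
  then show ?thesis by (rule tendsto_nhds_cong) simp
qed

lemma moving_comp_tendsto:
  assumes t0: "fixed_time < t0"
  shows "((\<lambda>t. infsum (moving_comp t) {..b}) \<longlongrightarrow> infsum (moving_comp t0) {..b}) (nhds t0)"
proof (cases "t0 = Omega1")
  case True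
  then show ?thesis using moving_comp_tendsto_Omega1 by simp
next
  case False
  then have "t0 < Omega1" by (simp add: less_Omega1_iff)
  then show ?thesis
    using moving_comp_tendsto_limit_of_cuts[OF t0] moving_comp_tendsto_between_cuts[OF t0] by (metis not_le)
qed

section \<open>Joining the fixed and the moving part\<close>

definition fixed_pos :: "omega1_interval \<Rightarrow> real" where
  "fixed_pos x = (if x \<le> fixed_end then max 0 (a Omega1 x) else 0)"

text \<open>The fixed part does not depend on \<open>t\<close>, so its positive part can be taken
  whole. Together with the moving compensation this may exceed the prescribed total; the factor
  reduces it, and being constant in \<open>t\<close> it preserves continuity.\<close>

definition \<theta> :: real where
  "\<theta> = max 0 (infsum (a Omega1) UNIV) / (infsum fixed_pos UNIV + max 0 mass)"

text \<open>Up to \<open>fixed_time\<close> one tree suffices, as \<open>settled fixed_time\<close>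
  supports all these measures. \<open>{..fixed_time}\<close> is clopen, so the two formulas need not
  match at its end.\<close>

definition family_comp :: "omega1_interval \<Rightarrow> omega1_interval \<Rightarrow> real" where
  "family_comp t x = (if t \<le> fixed_time then seg_comp (settled fixed_time) (a t) x else \<theta> * (fixed_pos x + moving_comp t x))"

lemma fixed_pos_summable: "fixed_pos summable_on S"
  by (rule summable_on_dominated[of "\<lambda>x. \<bar>a Omega1 x\<bar>"]) (auto simp: fixed_pos_def summable_on_abs_iff summable_a)

lemma moving_comp_bounds: "0 \<le> moving_comp t x" "moving_comp t x \<le> max 0 (moving t x)" "moving_comp t summable_on S"
  unfolding moving_comp_def using seg_comp_nonneg[OF tree_bound_facts] seg_comp_le[OF tree_bound_facts] seg_comp_summable[OF tree_bound_facts] by auto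

lemma \<theta>_bounds:
  "0 \<le> \<theta>" "\<theta> \<le> 1"
  "\<theta> * (infsum fixed_pos UNIV + max 0 mass) = max 0 (infsum (a Omega1) UNIV)"
proof -
  let ?D = "infsum fixed_pos UNIV + max 0 mass"
  have "infsum (a Omega1) {..fixed_end} \<le> infsum fixed_pos UNIV"
    by (rule infsum_mono_neutral) (auto simp: fixed_pos_def summable_a fixed_pos_summable)
  moreover have "infsum (a Omega1) UNIV = infsum (a Omega1) {..fixed_end} + mass"
    using infsum_split[OF summable_a, of Omega1 UNIV "{..fixed_end}"] by (simp add: mass_def infsum_moving Compl_eq_Diff_UNIV)
  moreover have p: "0 \<le> infsum fixed_pos UNIV" by (rule infsum_nonneg) (simp add: fixed_pos_def)
  ultimately have le: "max 0 (infsum (a Omega1) UNIV) \<le> ?D" by linarith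
  have D: "0 \<le> ?D" using p by simp
  show "0 \<le> \<theta>" unfolding \<theta>_def using D by (intro divide_nonneg_nonneg) auto
  show "\<theta> \<le> 1" using divide_right_mono[OF le D] unfolding \<theta>_def by (cases "?D = 0") auto
  show "\<theta> * ?D = max 0 (infsum (a Omega1) UNIV)"
    unfolding \<theta>_def using le by (cases "?D = 0") auto
qed

lemma supported_initial: "t \<le> fixed_time \<Longrightarrow> supported (settled fixed_time) (a t)"
  using settled(4)[OF fixed_facts(2)] .

lemma family_comp_nonneg: "0 \<le> family_comp t x"
proof (cases "t \<le> fixed_time")
  case True
  then show ?thesis using seg_comp_nonneg[OF settled(2)[OF fixed_facts(2)] summable_a supported_initial[OF True]] by (simp add: family_comp_def)
next
  case False
  then show ?thesis using moving_comp_bounds(1) \<theta>_bounds(1) by (simp add: family_comp_def fixed_pos_def)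
qed

lemma family_comp_le: "family_comp t x \<le> max 0 (a t x)"
proof (cases "t \<le> fixed_time")
  case True
  then show ?thesis using seg_comp_le[OF settled(2)[OF fixed_facts(2)] summable_a supported_initial[OF True]] by (simp add: family_comp_def)
next
  case False
  have "fixed_pos x + moving_comp t x \<le> max 0 (a t x)"
    using moving_comp_bounds(1,2)[of t x] fixed_facts(4)[of t x] False by (auto simp: fixed_pos_def moving_def)
  moreover have "0 \<le> fixed_pos x + moving_comp t x" using moving_comp_bounds(1) by (simp add: fixed_pos_def)
  ultimately have "\<theta> * (fixed_pos x + moving_comp t x) \<le> 1 * max 0 (a t x)"
    using \<theta>_bounds(1,2) by (intro mult_mono) auto
  then show ?thesis using False by (simp add: family_comp_def)
qed

lemma infsum_family_comp_beyond:
  assumes "t > fixed_time"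
  shows "infsum (family_comp t) S = \<theta> * (infsum fixed_pos S + infsum (moving_comp t) S)"
proof -
  have "infsum (family_comp t) S = infsum (\<lambda>x. \<theta> * (fixed_pos x + moving_comp t x)) S"
    unfolding family_comp_def using assms by (simp only: not_le[symmetric] if_False)
  also have "\<dots> = \<theta> * infsum (\<lambda>x. fixed_pos x + moving_comp t x) S" by (rule infsum_cmult_right')
  finally show ?thesis by (simp add: infsum_add fixed_pos_summable moving_comp_bounds(3))
qed

lemma infsum_family_comp: "infsum (family_comp t) UNIV = max 0 (infsum (a t) UNIV)"
proof (cases "t \<le> fixed_time")
  case True
  then have "family_comp t = seg_comp (settled fixed_time) (a t)" by (auto simp: family_comp_def)
  then show ?thesis using infsum_seg_comp_UNIV[OF settled(2)[OF fixed_facts(2)] summable_a supported_initial[OF True]] by simp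
next
  case False
  then show ?thesis
    using fixed_facts(5)[of t] \<theta>_bounds(3) infsum_moving_UNIV[of t]
    by (simp add: infsum_family_comp_beyond moving_comp_def infsum_seg_comp_UNIV[OF tree_bound_facts])
qed

lemma family_comp_tendsto: "((\<lambda>t. infsum (family_comp t) {..b}) \<longlongrightarrow> infsum (family_comp t0) {..b}) (nhds t0)"
proof (cases "t0 \<le> fixed_time")
  case True
  have near: "\<forall>\<^sub>F t in nhds t0. t \<in> {..fixed_time}"
    using clopen_atMost[of fixed_time] True by (intro eventually_nhds_in_open) auto
  have "family_comp t = seg_comp (settled fixed_time) (a t)" if "t \<le> fixed_time" for t using that by (auto simp: family_comp_def)
  then have "\<forall>\<^sub>F t in nhds t0. infsum (family_comp t) {..b} = infsum (seg_comp (settled fixed_time) (a t)) {..b}"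
    using near by (auto elim: eventually_mono)
  moreover have "\<forall>\<^sub>F t in nhds t0. supported (settled fixed_time) (a t)"
    using near supported_initial by (auto elim: eventually_mono)
  then have "((\<lambda>t. infsum (seg_comp (settled fixed_time) (a t)) {..b}) \<longlongrightarrow> infsum (seg_comp (settled fixed_time) (a t0)) {..b}) (nhds t0)"
    using atomic_family_clopen[OF a] unfolding continuous_on_UNIV_iff_nhds
    by (intro seg_comp_tendsto settled(2)[OF fixed_facts(2)] summable_a) auto
  ultimately show ?thesis by (rule tendsto_nhds_cong)
next
  case False
  then have t0: "fixed_time < t0" by simp
  have "\<forall>\<^sub>F t in nhds t0. infsum (family_comp t) {..b} = \<theta> * (infsum fixed_pos {..b} + infsum (moving_comp t) {..b})"
    using eventually_nhds_left[OF t0] by (rule eventually_mono) (simp add: infsum_family_comp_beyond)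
  moreover have "((\<lambda>t. \<theta> * (infsum fixed_pos {..b} + infsum (moving_comp t) {..b}))
      \<longlongrightarrow> \<theta> * (infsum fixed_pos {..b} + infsum (moving_comp t0) {..b})) (nhds t0)"
    by (intro tendsto_intros moving_comp_tendsto t0)
  ultimately show ?thesis by (rule tendsto_nhds_cong)
qed

lemma family_comp_summable: "family_comp t summable_on S"
  by (rule summable_on_dominated[OF summable_on_pos_part[OF summable_a[of t]]]) (simp add: family_comp_nonneg family_comp_le)

lemma family_comp_atomic_family: "atomic_family family_comp"
proof -
  have "infsum (\<lambda>x. \<bar>family_comp t x\<bar>) UNIV \<le> 1" for t
  proof -
    have "infsum (\<lambda>x. \<bar>family_comp t x\<bar>) UNIV = max 0 (infsum (a t) UNIV)" by (simp add: family_comp_nonneg infsum_family_comp)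
    also have "\<dots> \<le> infsum (\<lambda>x. \<bar>a t x\<bar>) UNIV"
      using infsum_abs_bound[OF summable_a, of t UNIV] infsum_nonneg[of UNIV "\<lambda>x. \<bar>a t x\<bar>"] by simp
    also have "\<dots> \<le> 1" using a by (simp add: atomic_family_def)
    finally show ?thesis .
  qed
  then show ?thesis
    using family_comp_summable family_comp_tendsto by (auto simp: atomic_family_def continuous_on_UNIV_iff_nhds)
qed

end

lemma atomic_family_compensation:
  fixes a :: "omega1_interval \<Rightarrow> omega1_interval \<Rightarrow> real"
  assumes "atomic_family a"
  obtains g where "atomic_family g" "\<And>t x. 0 \<le> g t x" "\<And>t x. g t x \<le> max 0 (a t x)"
    "\<And>t. infsum (g t) UNIV = max 0 (infsum (a t) UNIV)"
proof -
  interpret omega1_family a by (rule omega1_family.intro) fact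
  show ?thesis
    by (rule that[OF family_comp_atomic_family family_comp_nonneg family_comp_le infsum_family_comp])
qed

theorem omega1_interval_local_compensation: "admits_local_compensation TYPE(omega1_interval)"
proof -
  have "\<exists>G\<in>W. compensation F G" if F: "F \<in> W" for F :: "omega1_interval \<Rightarrow> omega1_interval set \<Rightarrow> real"
  proof -
    obtain a where a: "atomic_family a" and F: "F = (\<lambda>t. atomic_measure (a t))"
      using F W_iff_atomic_family by blast
    obtain g where g: "atomic_family g" "\<And>t x. 0 \<le> g t x" "\<And>t x. g t x \<le> max 0 (a t x)"
      "\<And>t. infsum (g t) UNIV = max 0 (infsum (a t) UNIV)"
      using atomic_family_compensation[OF a] by metis
    have sum: "a t summable_on S" and gsum: "g t summable_on S" for t S
      using a g(1) by (auto simp: atomic_family_def intro: summable_on_UNIV_subset)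
    have "compensation_measure (atomic_measure (a t)) (atomic_measure (g t))" for t
    proof (cases "infsum (a t) UNIV > 0")
      case True
      have "0 \<le> infsum (g t) A" "infsum (g t) A \<le> infsum (\<lambda>x. max 0 (a t x)) A" for A
        using g(2,3) by (auto intro!: infsum_nonneg infsum_mono gsum summable_on_pos_part sum)
      then show ?thesis
        using True g(4)[of t] atomic_measure_regular[OF gsum]
        by (simp add: compensation_measure_def atomic_measure_def[of _ UNIV])
          (simp add: pos_part_atomic_measure[OF sum] atomic_measure_def)
    next
      case False
      have "g t x = 0" for x
        using nonneg_infsum_le_0D[of "g t" UNIV x] g(2,4) gsum False by simp
      then have "g t = (\<lambda>x. 0)" by blast
      then have "atomic_measure (g t) = (\<lambda>A. 0)" by (auto simp: atomic_measure_def)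
      then show ?thesis
        using False atomic_measure_regular[OF gsum, of t]
        by (simp add: compensation_measure_def atomic_measure_def[of "a t"])
    qed
    then have "compensation F (\<lambda>t. atomic_measure (g t))" by (simp add: compensation_def F)
    then show ?thesis using g(1) W_iff_atomic_family by blast
  qed
  then show ?thesis by (simp add: admits_local_compensation_def)
qed

section \<open>Numerical radius of operators on \<open>C([0, \<omega>\<^sub>1])\<close>\<close>

type_synonym C_omega1 = "omega1_interval \<Rightarrow>\<^sub>C real"

lemma apply_Bcontfun:
  fixes f :: "omega1_interval \<Rightarrow> real"
  assumes "continuous_on UNIV f"
  shows "apply_bcontfun (Bcontfun f) = f"
  using continuous_bounded(1)[OF assms] by (rule Bcontfun_inverse)

lemma Bcontfun_add:
  fixes f g :: "omega1_interval \<Rightarrow> real"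
  assumes "continuous_on UNIV f" "continuous_on UNIV g"
  shows "Bcontfun (\<lambda>x. f x + g x) = Bcontfun f + Bcontfun g"
  using assms by (intro bcontfun_eqI) (simp add: plus_bcontfun.rep_eq apply_Bcontfun continuous_intros)

lemma Bcontfun_scale:
  fixes f :: "omega1_interval \<Rightarrow> real"
  assumes "continuous_on UNIV f"
  shows "Bcontfun (\<lambda>x. c * f x) = c *\<^sub>R Bcontfun f"
  using assms by (intro bcontfun_eqI) (simp add: scaleR_bcontfun.rep_eq apply_Bcontfun continuous_intros)

lemma weights_functional:
  fixes b :: "omega1_interval \<Rightarrow> real"
  assumes b: "b summable_on UNIV"
  obtains x' :: "C_omega1 \<Rightarrow>\<^sub>L real"
  where "\<And>f. blinfun_apply x' f = infsum (\<lambda>y. b y * apply_bcontfun f y) UNIV"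
proof -
  let ?L = "\<lambda>f :: C_omega1. infsum (\<lambda>y. b y * apply_bcontfun f y) UNIV"
  have bound: "\<bar>apply_bcontfun f y\<bar> \<le> norm f" for f :: "C_omega1" and y
    using norm_bounded[of f y] by simp
  have sum: "(\<lambda>y. b y * apply_bcontfun f y) summable_on UNIV" for f :: "C_omega1"
    by (rule summable_on_mult_bounded[OF b bound])
  have "bounded_linear ?L"
  proof (rule bounded_linear_intro)
    show "?L (f + g) = ?L f + ?L g" for f g
      by (simp add: distrib_left infsum_add sum)
    show "?L (r *\<^sub>R f) = r *\<^sub>R ?L f" for r f
      by (subst infsum_cmult_right'[symmetric, of r, folded real_scaleR_def]) (simp add: mult_ac)
    show "norm (?L f) \<le> norm f * infsum (\<lambda>y. \<bar>b y\<bar>) UNIV" for f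
      using pairing_bound[OF b bound, of f] by (simp add: mult.commute)
  qed
  then show ?thesis using that[of "Blinfun ?L"] by (simp add: bounded_linear_Blinfun_apply)
qed

lemma weights_operator:
  fixes c :: "omega1_interval \<Rightarrow> omega1_interval \<Rightarrow> real"
  assumes c: "\<And>t. c t summable_on UNIV" "\<And>t. infsum (\<lambda>y. \<bar>c t y\<bar>) UNIV \<le> 1"
    and cont: "\<And>f. continuous_on UNIV f \<Longrightarrow> continuous_on UNIV (\<lambda>t. infsum (\<lambda>y. c t y * f y) UNIV)"
  shows "\<exists>T :: C_omega1 \<Rightarrow>\<^sub>L C_omega1.
    \<forall>f t. apply_bcontfun (blinfun_apply T f) t = infsum (\<lambda>y. c t y * apply_bcontfun f y) UNIV"
proof -
  let ?T = "\<lambda>f :: C_omega1. Bcontfun (\<lambda>t. infsum (\<lambda>y. c t y * apply_bcontfun f y) UNIV)"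
  have app: "apply_bcontfun (?T f) t = infsum (\<lambda>y. c t y * apply_bcontfun f y) UNIV" for f t
    by (simp add: apply_Bcontfun cont)
  have bound: "\<bar>apply_bcontfun f y\<bar> \<le> norm f" for f :: "C_omega1" and y
    using norm_bounded[of f y] by simp
  have sum: "(\<lambda>y. c t y * apply_bcontfun f y) summable_on UNIV" for f :: "C_omega1" and t
    by (rule summable_on_mult_bounded[OF c(1) bound])
  have "bounded_linear ?T"
  proof (rule bounded_linear_intro)
    show "?T (f + g) = ?T f + ?T g" for f g
    proof (rule bcontfun_eqI)
      fix t
      have "infsum (\<lambda>y. c t y * apply_bcontfun (f + g) y) UNIV
          = infsum (\<lambda>y. c t y * apply_bcontfun f y) UNIV + infsum (\<lambda>y. c t y * apply_bcontfun g y) UNIV"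
        by (simp only: plus_bcontfun.rep_eq distrib_left infsum_add sum)
      then show "apply_bcontfun (?T (f + g)) t = apply_bcontfun (?T f + ?T g) t"
        by (simp only: app plus_bcontfun.rep_eq[of "?T f"])
    qed
    show "?T (r *\<^sub>R f) = r *\<^sub>R ?T f" for r f
    proof (rule bcontfun_eqI)
      fix t
      have "infsum (\<lambda>y. c t y * apply_bcontfun (r *\<^sub>R f) y) UNIV = r * infsum (\<lambda>y. c t y * apply_bcontfun f y) UNIV"
        by (simp only: scaleR_bcontfun.rep_eq real_scaleR_def mult.left_commute[of _ r] infsum_cmult_right')
      then show "apply_bcontfun (?T (r *\<^sub>R f)) t = apply_bcontfun (r *\<^sub>R ?T f) t"
        by (simp only: app scaleR_bcontfun.rep_eq[of r "?T f"] real_scaleR_def)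
    qed
    show "norm (?T f) \<le> norm f * 1" for f
    proof (rule norm_bound)
      fix t
      have "\<bar>infsum (\<lambda>y. c t y * apply_bcontfun f y) UNIV\<bar> \<le> infsum (\<lambda>y. \<bar>c t y\<bar>) UNIV * norm f"
        by (rule pairing_bound[OF c(1) bound])
      also have "\<dots> \<le> 1 * norm f" by (rule mult_right_mono[OF c(2)]) simp
      finally show "norm (apply_bcontfun (?T f) t) \<le> norm f * 1" unfolding app by simp
    qed
  qed
  then show ?thesis by (intro exI[of _ "Blinfun ?T"]) (simp add: bounded_linear_Blinfun_apply app)
qed

lemma evaluation_functional:
  obtains \<delta> :: "C_omega1 \<Rightarrow>\<^sub>L real"
  where "\<And>f. blinfun_apply \<delta> f = apply_bcontfun f t" "norm \<delta> = 1"
proof -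
  have "(indicator {t} :: omega1_interval \<Rightarrow> real) summable_on UNIV"
    by (rule finite_nonzero_values_imp_summable_on) (simp add: indicator_def)
  then obtain \<delta> :: "C_omega1 \<Rightarrow>\<^sub>L real"
    where \<delta>: "\<And>f. blinfun_apply \<delta> f = infsum (\<lambda>y. indicator {t} y * apply_bcontfun f y) UNIV"
    using weights_functional by metis
  have ap: "blinfun_apply \<delta> f = apply_bcontfun f t" for f
  proof -
    have "infsum (\<lambda>y. indicator {t} y * apply_bcontfun f y) UNIV = infsum (apply_bcontfun f) {t}"
      by (rule infsum_cong_neutral) auto
    then show ?thesis by (simp add: \<delta>)
  qed
  have "norm \<delta> \<le> 1"
  proof (rule norm_blinfun_bound)
    show "norm (blinfun_apply \<delta> f) \<le> 1 * norm f" for f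
      using norm_bounded[of f t] by (simp only: ap mult_1)
  qed simp
  moreover have "1 \<le> norm \<delta>"
  proof -
    have "norm (const_bcontfun 1 :: C_omega1) \<le> 1"
      by (rule norm_bound) (simp add: const_bcontfun.rep_eq)
    then have "norm \<delta> * norm (const_bcontfun 1 :: C_omega1) \<le> norm \<delta> * 1"
      by (intro mult_left_mono) auto
    moreover have "norm (blinfun_apply \<delta> (const_bcontfun 1)) = 1"
      by (simp add: ap const_bcontfun.rep_eq)
    ultimately show ?thesis using norm_blinfun[of \<delta> "const_bcontfun 1"] by linarith
  qed
  ultimately show ?thesis using that ap by force
qed

section \<open>The numerical radius as the operator norm\<close>

lemma numerical_radius_upper:
  fixes T :: "'x::real_normed_vector \<Rightarrow>\<^sub>L 'x"
  assumes "(x, x') \<in> states"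
  shows "\<bar>blinfun_apply x' (blinfun_apply T x)\<bar> \<le> numerical_radius T"
proof -
  have "bdd_above ((\<lambda>(x, x'). \<bar>blinfun_apply x' (blinfun_apply T x)\<bar>) ` states)"
  proof (rule bdd_aboveI)
    fix r assume "r \<in> (\<lambda>(x, x'). \<bar>blinfun_apply x' (blinfun_apply T x)\<bar>) ` states"
    then obtain x x' where s: "norm x = 1" "norm x' = 1" and r: "r = \<bar>blinfun_apply x' (blinfun_apply T x)\<bar>"
      by (auto simp: states_def)
    have "r \<le> norm x' * norm (blinfun_apply T x)" using norm_blinfun[of x' "blinfun_apply T x"] r by simp
    also have "\<dots> \<le> norm T" using norm_blinfun[of T x] s by simp
    finally show "r \<le> norm T" .
  qed
  from cSUP_upper[OF assms this] show ?thesis by (simp add: numerical_radius_def)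
qed

lemma numerical_radius_le:
  fixes T :: "C_omega1 \<Rightarrow>\<^sub>L C_omega1"
  assumes "\<And>f t. norm f \<le> 1 \<Longrightarrow> \<bar>apply_bcontfun (blinfun_apply T f) t\<bar> \<le> K"
  shows "numerical_radius T \<le> K"
  unfolding numerical_radius_def
proof (rule cSUP_least)
  \<comment> \<open>A supremum can be bounded by its members only over a nonempty set; the constant
    function 1 and an evaluation form a state.\<close>
  obtain \<delta> :: "C_omega1 \<Rightarrow>\<^sub>L real"
    where \<delta>: "\<And>f. blinfun_apply \<delta> f = apply_bcontfun f Omega1" "norm \<delta> = 1"
    using evaluation_functional[where t = Omega1] by metis
  have "norm (const_bcontfun 1 :: C_omega1) = 1"
  proof (rule antisym)
    show "norm (const_bcontfun 1 :: C_omega1) \<le> 1"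
      by (rule norm_bound) (simp add: const_bcontfun.rep_eq)
    show "1 \<le> norm (const_bcontfun 1 :: C_omega1)"
      using norm_bounded[of "const_bcontfun 1 :: C_omega1" Omega1] by (simp add: const_bcontfun.rep_eq)
  qed
  then have "(const_bcontfun 1, \<delta>) \<in> states"
    using \<delta> by (simp add: states_def const_bcontfun.rep_eq)
  then show "(states :: (C_omega1 \<times> _) set) \<noteq> {}" by blast
next
  fix p :: "C_omega1 \<times> (C_omega1 \<Rightarrow>\<^sub>L real)"
  assume "p \<in> states"
  then obtain x x' where p: "p = (x, x')" "norm x = 1" "norm x' = 1" by (auto simp: states_def)
  have "norm (blinfun_apply T x) \<le> K"
    by (rule norm_bound) (use assms p(2) in auto)
  then show "(case p of (x, x') \<Rightarrow> \<bar>blinfun_apply x' (blinfun_apply T x)\<bar>) \<le> K"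
    using norm_blinfun[of x' "blinfun_apply T x"] p by simp
qed

text \<open>
  At an isolated point, a function of norm at most 1 is a convex combination of two functions taking
  the values 1 and -1 there; both form a state with the (signed) evaluation.
\<close>

lemma numerical_radius_isolated:
  fixes T :: "C_omega1 \<Rightarrow>\<^sub>L C_omega1"
  assumes f: "norm f \<le> 1" and t: "open {t}"
  shows "\<bar>apply_bcontfun (blinfun_apply T f) t\<bar> \<le> numerical_radius T"
proof -
  obtain \<delta> :: "C_omega1 \<Rightarrow>\<^sub>L real"
    where \<delta>: "\<And>f. blinfun_apply \<delta> f = apply_bcontfun f t" "norm \<delta> = 1"
    using evaluation_functional[where t = t] by metis
  define g where "g s = Bcontfun (\<lambda>y. if y \<in> {t} then s else apply_bcontfun f y)" for s :: real
  have g: "apply_bcontfun (g s) y = (if y = t then s else apply_bcontfun f y)" for s y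
  proof -
    have "apply_bcontfun (g s) = (\<lambda>y. if y \<in> {t} then s else apply_bcontfun f y)"
      unfolding g_def using t by (intro apply_Bcontfun continuous_on_if_clopen) auto
    then show ?thesis by simp
  qed
  have "\<bar>apply_bcontfun f y\<bar> \<le> 1" for y using norm_bounded[of f y] f by simp
  then have "norm (g s) = 1" if "\<bar>s\<bar> = 1" for s
    using norm_bounded[of "g s" t] that by (intro antisym norm_bound) (auto simp: g)
  then have "(g s, s *\<^sub>R \<delta>) \<in> states" if "\<bar>s\<bar> = 1" for s
    using that \<delta> by (auto simp: states_def g scaleR_blinfun.rep_eq abs_mult_self_eq abs_if split: if_splits)
  from numerical_radius_upper[OF this, of _ T]
  have le: "\<bar>apply_bcontfun (blinfun_apply T (g s)) t\<bar> \<le> numerical_radius T" if "\<bar>s\<bar> = 1" for s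
    using that by (simp add: scaleR_blinfun.rep_eq \<delta> abs_mult)
  \<comment> \<open>The weight that represents the value of \<open>f\<close> at \<open>t\<close> as
    \<open>l * 1 + (1 - l) * (-1)\<close>.\<close>
  define l where "l = (1 + apply_bcontfun f t) / 2"
  have l: "0 \<le> l" "0 \<le> 1 - l" using \<open>\<bar>apply_bcontfun f t\<bar> \<le> 1\<close> by (auto simp: l_def abs_le_iff field_simps)
  have "f = l *\<^sub>R g 1 + (1 - l) *\<^sub>R g (-1)"
    by (rule bcontfun_eqI) (simp add: plus_bcontfun.rep_eq scaleR_bcontfun.rep_eq g l_def field_simps)
  then have "blinfun_apply T f = l *\<^sub>R blinfun_apply T (g 1) + (1 - l) *\<^sub>R blinfun_apply T (g (-1))"
    by (metis blinfun.add_right blinfun.scaleR_right)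
  then have "apply_bcontfun (blinfun_apply T f) t
      = l * apply_bcontfun (blinfun_apply T (g 1)) t + (1 - l) * apply_bcontfun (blinfun_apply T (g (-1))) t"
    by (simp add: plus_bcontfun.rep_eq scaleR_bcontfun.rep_eq)
  also have "\<bar>\<dots>\<bar> \<le> l * numerical_radius T + (1 - l) * numerical_radius T"
    using mult_left_mono[OF le[of 1] l(1)] mult_left_mono[OF le[of "-1"] l(2)] l
    by (intro order_trans[OF abs_triangle_ineq] add_mono) (auto simp: abs_mult)
  finally show ?thesis by (simp add: algebra_simps)
qed

text \<open>A neighbourhood \<open>{c<..t}\<close> contains the successor of \<open>c\<close>, which
  is isolated.\<close>

lemma isolated_dense:
  fixes t :: "'k::{wellorder, linorder_topology}"
  assumes "open U" "t \<in> U"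
  shows "\<exists>s\<in>U. open {s}"
proof (cases "\<exists>y. y < t")
  case True
  then obtain c where c: "c < t" "{c<..t} \<subseteq> U" using open_left[OF assms] by blast
  define s where "s = (LEAST s. c < s)"
  have s: "c < s" unfolding s_def using c(1) by (rule LeastI)
  have le: "s \<le> y" if "c < y" for y unfolding s_def using that by (rule Least_le)
  have "{c<..} \<inter> {..s} = {s}" using s le by (auto intro: antisym)
  moreover have "open ({c<..} \<inter> {..s})" using clopen_atMost by (intro open_Int) auto
  ultimately show ?thesis using c(2) s le[OF c(1)] by (intro bexI[of _ s]) auto
next
  case False
  then have "{..t} = {t}" by (auto simp: order_le_less)
  then show ?thesis using clopen_atMost[of t] assms(2) by auto
qed

text \<open>By continuity, a value above the radius would also occur at an isolated point.\<close>

lemma numerical_radius_bound: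
  fixes T :: "C_omega1 \<Rightarrow>\<^sub>L C_omega1"
  assumes f: "norm f \<le> 1"
  shows "\<bar>apply_bcontfun (blinfun_apply T f) t\<bar> \<le> numerical_radius T"
proof (rule ccontr)
  let ?U = "(\<lambda>t. \<bar>apply_bcontfun (blinfun_apply T f) t\<bar>) -` {numerical_radius T<..}"
  assume "\<not> ?thesis"
  then have "t \<in> ?U" by simp
  moreover have "open ?U" by (intro open_vimage continuous_intros) auto
  ultimately obtain s where "s \<in> ?U" "open {s}" using isolated_dense by blast
  then show False using numerical_radius_isolated[OF f, of s T] by simp
qed

text \<open>Radius 1 bounds \<open>T f\<close> pointwise by 1 on the unit ball, so evaluating
  \<open>T f\<close> at \<open>t\<close> is a functional of norm at most 1. Images of indicators of
  initial segments are continuous functions, which makes the representing weights an atomic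
  family.\<close>

lemma operator_weights:
  fixes T :: "C_omega1 \<Rightarrow>\<^sub>L C_omega1"
  assumes T: "numerical_radius T = 1"
  obtains a where "atomic_family a"
    "\<And>f t. apply_bcontfun (blinfun_apply T f) t = infsum (\<lambda>y. a t y * apply_bcontfun f y) UNIV"
proof -
  have "\<exists>a. a summable_on UNIV \<and> infsum (\<lambda>y. \<bar>a y\<bar>) UNIV \<le> 1 \<and>
      (\<forall>f. continuous_on UNIV f \<longrightarrow>
        apply_bcontfun (blinfun_apply T (Bcontfun f)) t = infsum (\<lambda>y. a y * f y) UNIV)" for t
  proof -
    let ?L = "\<lambda>f. apply_bcontfun (blinfun_apply T (Bcontfun f)) t"
    have add: "?L (\<lambda>x. f x + g x) = ?L f + ?L g" if "continuous_on UNIV f" "continuous_on UNIV g" for f g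
      using that by (simp add: Bcontfun_add blinfun.add_right plus_bcontfun.rep_eq)
    have scale: "?L (\<lambda>x. c * f x) = c * ?L f" if "continuous_on UNIV f" for c f
      using that by (simp add: Bcontfun_scale blinfun.scaleR_right scaleR_bcontfun.rep_eq)
    have bound: "\<bar>?L f\<bar> \<le> 1 * B" if f: "continuous_on UNIV f" "\<And>x. \<bar>f x\<bar> \<le> B" for f B
    proof (cases "B = 0")
      case True
      then have "f = (\<lambda>x. 0 * f x)" using f(2) by auto
      then have "?L f = 0" using scale[OF f(1), of 0] by simp
      then show ?thesis using True by simp
    next
      case False
      then have B: "B > 0" using f(2)[of Omega1] by linarith
      have g: "continuous_on UNIV (\<lambda>x. inverse B * f x)" using f(1) by (intro continuous_intros)
      have "norm (Bcontfun (\<lambda>x. inverse B * f x)) \<le> 1"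
      proof (rule norm_bound)
        show "norm (apply_bcontfun (Bcontfun (\<lambda>x. inverse B * f x)) x) \<le> 1" for x
          unfolding apply_Bcontfun[OF g] using f(2)[of x] B by (simp add: abs_mult field_simps)
      qed
      from numerical_radius_bound[OF this, of T t] have "\<bar>inverse B * ?L f\<bar> \<le> 1"
        by (simp only: scale[OF f(1)] T)
      then show ?thesis using B by (simp add: abs_mult field_simps)
    qed
    from functional_representation[of ?L, OF add scale bound] show ?thesis by metis
  qed
  then obtain a where a: "\<And>t. a t summable_on UNIV" "\<And>t. infsum (\<lambda>y. \<bar>a t y\<bar>) UNIV \<le> 1"
    "\<And>t f. continuous_on UNIV f \<Longrightarrow>
      apply_bcontfun (blinfun_apply T (Bcontfun f)) t = infsum (\<lambda>y. a t y * f y) UNIV"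
    by metis
  have "continuous_on UNIV (\<lambda>t. infsum (a t) {..b})" for b
  proof -
    have "infsum (a t) {..b} = apply_bcontfun (blinfun_apply T (Bcontfun (indicator {..b}))) t" for t
      using a(3)[OF continuous_on_indicator_clopen[OF clopen_atMost[of b]]] by (simp add: infsum_indicator)
    then show ?thesis by simp
  qed
  then have "atomic_family a" using a by (simp add: atomic_family_def)
  moreover have "apply_bcontfun (blinfun_apply T f) t = infsum (\<lambda>y. a t y * apply_bcontfun f y) UNIV" for f t
    using a(3)[of "apply_bcontfun f" t] by (simp add: apply_bcontfun_inverse)
  ultimately show ?thesis by (rule that)
qed

lemma functional_weights:
  fixes x' :: "C_omega1 \<Rightarrow>\<^sub>L real"
  obtains b where "b summable_on UNIV" "infsum (\<lambda>y. \<bar>b y\<bar>) UNIV \<le> norm x'"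
    "\<And>f. blinfun_apply x' f = infsum (\<lambda>y. b y * apply_bcontfun f y) UNIV"
proof -
  let ?L = "\<lambda>f. blinfun_apply x' (Bcontfun f)"
  have add: "?L (\<lambda>x. f x + g x) = ?L f + ?L g" if "continuous_on UNIV f" "continuous_on UNIV g" for f g
    using that by (simp add: Bcontfun_add blinfun.add_right)
  have scale: "?L (\<lambda>x. c * f x) = c * ?L f" if "continuous_on UNIV f" for c f
    using that by (simp add: Bcontfun_scale blinfun.scaleR_right)
  have bound: "\<bar>?L f\<bar> \<le> norm x' * B" if "continuous_on UNIV f" "\<And>x. \<bar>f x\<bar> \<le> B" for f B
  proof -
    have "norm (Bcontfun f) \<le> B" using that by (intro norm_bound) (simp add: apply_Bcontfun)
    then have "norm x' * norm (Bcontfun f) \<le> norm x' * B" by (rule mult_left_mono) simp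
    then show ?thesis using norm_blinfun[of x' "Bcontfun f"] by simp
  qed
  show ?thesis
  proof (rule functional_representation[of ?L "norm x'"])
    fix b
    assume b: "b summable_on UNIV" "infsum (\<lambda>y. \<bar>b y\<bar>) UNIV \<le> norm x'"
      "\<And>f. continuous_on UNIV f \<Longrightarrow> ?L f = infsum (\<lambda>y. b y * f y) UNIV"
    have "blinfun_apply x' f = infsum (\<lambda>y. b y * apply_bcontfun f y) UNIV" for f
      using b(3)[of "apply_bcontfun f"] by (simp add: apply_bcontfun_inverse)
    with b(1,2) show ?thesis by (rule that)
  qed (fact add scale bound)+
qed

section \<open>Perturbing an almost norm-attaining operator\<close>

text \<open>
  For a measure \<open>a\<close> almost attaining its norm at \<open>x\<close>, little mass is lost by restricting to
  the set where \<open>x\<close> is close to \<open>q\<close> in \<open>{-1, 1}\<close>, compensating and normalizing.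
\<close>

lemma compensation_close:
  fixes a x q g :: "'k \<Rightarrow> real"
  assumes \<epsilon>: "0 < \<epsilon>" "\<epsilon> < 1" and a: "a summable_on UNIV" "infsum (\<lambda>y. \<bar>a y\<bar>) UNIV \<le> 1"
    and x: "\<And>y. \<bar>x y\<bar> \<le> 1"
    and q: "\<And>y. q y = 1 \<and> x y > 0 \<or> q y = -1 \<and> x y < 0 \<or> q y = 0 \<and> \<bar>x y\<bar> \<le> 1 - \<epsilon> / 2"
    and attain: "infsum (\<lambda>y. a y * x y) UNIV \<ge> 1 - \<epsilon>\<^sup>2 / 18"
    and g: "\<And>y. 0 \<le> g y" "\<And>y. g y \<le> max 0 (q y * a y)"
      "infsum g UNIV = max 0 (infsum (\<lambda>y. q y * a y) UNIV)"
  shows "1 / 2 \<le> infsum g UNIV" "infsum g UNIV \<le> 1"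
    "infsum (\<lambda>y. \<bar>a y - q y * g y / infsum g UNIV\<bar>) UNIV \<le> \<epsilon>"
proof -
  define M where "M = infsum (\<lambda>y. \<bar>a y\<bar>) UNIV"
  define V where "V = infsum (\<lambda>y. a y * x y) UNIV"
  define C where "C = infsum (\<lambda>y. q y * a y) UNIV"
  define \<tau> where "\<tau> = infsum g UNIV"
  \<comment> \<open>The loss is nonnegative with total at most
    \<open>\<epsilon>\<^sup>2 / 18\<close>, and every error is estimated by it. Mass where
    \<open>q\<close> vanishes is at most \<open>2 / \<epsilon>\<close> times the loss; mass of the
    wrong sign is at most the loss and enters twice. \<open>K\<close> collects both factors.\<close>
  define loss where "loss y = \<bar>a y\<bar> - a y * x y" for y
  define K where "K = 2 / \<epsilon> + 2"
  have qabs: "\<bar>q y\<bar> \<le> 1" for y using q[of y] by auto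
  have sum_qa: "(\<lambda>y. q y * a y) summable_on UNIV"
    using summable_on_mult_bounded[OF a(1) qabs] by (simp add: mult.commute)
  have hM: "((\<lambda>y. \<bar>a y\<bar>) has_sum M) UNIV"
    unfolding M_def using a(1) by (intro has_sum_infsum) (simp add: summable_on_abs_iff)
  have hV: "((\<lambda>y. a y * x y) has_sum V) UNIV"
    unfolding V_def by (intro has_sum_infsum summable_on_mult_bounded[OF a(1) x])
  have hC: "((\<lambda>y. q y * a y) has_sum C) UNIV"
    unfolding C_def by (intro has_sum_infsum sum_qa)
  have hg: "(g has_sum \<tau>) UNIV"
    unfolding \<tau>_def
    by (intro has_sum_infsum summable_on_dominated[OF summable_on_pos_part[OF sum_qa]]) (use g in auto)
  have "((\<lambda>y. \<bar>a y\<bar> + - (a y * x y)) has_sum (M + - V)) UNIV"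
    by (intro has_sum_add hM has_sum_uminusI hV)
  then have hloss: "((\<lambda>y. K * loss y) has_sum (K * (M - V))) UNIV"
    unfolding loss_def by (intro has_sum_cmult_right) simp
  have K: "K * (\<epsilon>\<^sup>2 / 18) \<le> 2 * \<epsilon> / 9" "K \<ge> 2"
    using \<epsilon> by (auto simp: K_def field_simps power2_eq_square)
  have ax: "a y * x y \<le> \<bar>a y\<bar>" for y
    using x[of y] by (metis abs_ge_self abs_ge_zero abs_mult mult_left_le order_trans)
  then have loss: "0 \<le> loss y" for y by (simp add: loss_def)
  have VM: "V \<le> M" using hV hM ax by (rule has_sum_mono)
  have "M - V \<le> \<epsilon>\<^sup>2 / 18" using attain a(2) by (simp add: V_def M_def)
  then have "K * (M - V) \<le> K * (\<epsilon>\<^sup>2 / 18)" using K(2) by (intro mult_left_mono) auto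
  then have KMV: "K * (M - V) \<le> 2 * \<epsilon> / 9" using K(1) by linarith
  have "\<epsilon>\<^sup>2 \<le> \<epsilon>" using \<epsilon> by (simp add: power2_eq_square mult_left_le)
  then have M: "M \<ge> 1 - \<epsilon> / 18" using attain VM by (simp add: V_def)
  have wrong: "max 0 (- (q y * a y)) \<le> loss y" for y
  proof -
    consider "q y = 1" "x y > 0" | "q y = -1" "x y < 0" | "q y = 0" using q by blast
    then show ?thesis
    proof cases
      case 1
      then have "a y \<le> 0 \<Longrightarrow> a y * x y \<le> 0" by (simp add: mult_le_0_iff)
      then show ?thesis using 1 loss[of y] by (auto simp: loss_def max_def)
    next
      case 2
      then have "a y \<ge> 0 \<Longrightarrow> a y * x y \<le> 0" by (simp add: mult_le_0_iff)
      then show ?thesis using 2 loss[of y] by (auto simp: loss_def max_def)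
    qed (use loss in auto)
  qed
  have outside: "\<bar>a y\<bar> \<le> 2 / \<epsilon> * loss y" if "q y = 0" for y
  proof -
    have "\<bar>x y\<bar> \<le> 1 - \<epsilon> / 2" using q[of y] that by auto
    then have "\<bar>a y\<bar> * \<bar>x y\<bar> \<le> \<bar>a y\<bar> * (1 - \<epsilon> / 2)" by (rule mult_left_mono) simp
    then have "\<bar>a y\<bar> * (\<epsilon> / 2) \<le> loss y"
      unfolding loss_def using abs_ge_self[of "a y * x y"] by (simp add: abs_mult algebra_simps)
    then show ?thesis using \<epsilon> by (simp add: field_simps)
  qed
  have split_K: "K * loss y = 2 / \<epsilon> * loss y + 2 * loss y" for y by (simp add: K_def distrib_right)
  have nonneg: "0 \<le> 2 / \<epsilon> * loss y" for y using \<epsilon>(1) loss[of y] by simp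
  have low: "\<bar>a y\<bar> \<le> q y * a y + K * loss y" for y
  proof (cases "q y = 0")
    case True
    then show ?thesis using outside[of y] split_K[of y] loss[of y] by simp
  next
    case False
    then have "\<bar>a y\<bar> = \<bar>q y * a y\<bar>" using q[of y] by (auto simp: abs_mult)
    then show ?thesis using wrong[of y] split_K[of y] nonneg[of y] by linarith
  qed
  have "M \<le> C + K * (M - V)"
    by (rule has_sum_mono[OF hM has_sum_add[OF hC hloss]]) (rule low)
  \<comment> \<open>The deficit is at most \<open>5 * \<epsilon> / 18 < 1 / 2\<close>; so
    \<open>C\<close> is positive and the compensation has exactly this total.\<close>
  then have C: "C \<ge> 1 - \<epsilon> / 18 - 2 * \<epsilon> / 9" using M KMV by linarith
  then have \<tau>C: "\<tau> = C" using g(3) \<epsilon> unfolding \<tau>_def C_def[symmetric] by simp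
  show half: "1 / 2 \<le> infsum g UNIV" using C \<tau>C \<epsilon> unfolding \<tau>_def[symmetric] by simp
  have "q y * a y \<le> \<bar>a y\<bar>" for y
    using q[of y] by auto
  then have "C \<le> M" by (intro has_sum_mono[OF hC hM])
  then show le1: "infsum g UNIV \<le> 1" using \<tau>C a(2) unfolding \<tau>_def[symmetric] M_def by simp
  define r where "r = inverse \<tau>"
  have r: "r \<ge> 1" "\<tau> * r = 1"
    using half le1 unfolding \<tau>_def[symmetric] r_def by (auto simp: one_le_inverse)
  \<comment> \<open>The middle term is kept without absolute value because its sum is
    \<open>C - \<tau> = 0\<close>; the wrong signs are paid for by the loss.\<close>
  have close: "\<bar>a y - q y * g y / \<tau>\<bar> \<le> K * loss y + (q y * a y + - g y) + (r - 1) * g y" for y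
  proof (cases "q y = 0")
    case True
    then have "g y = 0" using g(1,2)[of y] by simp
    then show ?thesis using True outside[of y] split_K[of y] loss[of y] by simp
  next
    case False
    then have qq: "q y * q y = 1" "\<bar>q y\<bar> = 1" using q[of y] by auto
    have "a y - q y * g y / \<tau> = q y * (q y * a y - r * g y)"
      using qq(1) by (simp add: r_def field_simps)
    then have "\<bar>a y - q y * g y / \<tau>\<bar> = \<bar>q y * a y - r * g y\<bar>" using qq(2) by (simp add: abs_mult)
    also have "\<dots> \<le> \<bar>q y * a y - g y\<bar> + (r - 1) * g y"
    proof -
      have "q y * a y - r * g y = (q y * a y - g y) - (r - 1) * g y" by (simp add: algebra_simps)
      moreover have "0 \<le> (r - 1) * g y" using r(1) g(1)[of y] by simp
      ultimately show ?thesis by linarith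
    qed
    also have "\<bar>q y * a y - g y\<bar> \<le> 2 * loss y + (q y * a y - g y)"
      using wrong[of y] g(1)[of y] g(2)[of y] by linarith
    finally show ?thesis using split_K[of y] nonneg[of y] by linarith
  qed
  have total: "((\<lambda>y. K * loss y + (q y * a y + - g y) + (r - 1) * g y)
      has_sum (K * (M - V) + (C + - \<tau>) + (r - 1) * \<tau>)) UNIV"
    by (intro has_sum_add hloss hC has_sum_uminusI hg has_sum_cmult_right)
  have "infsum (\<lambda>y. \<bar>a y - q y * g y / \<tau>\<bar>) UNIV \<le> K * (M - V) + (C + - \<tau>) + (r - 1) * \<tau>"
  proof (rule has_sum_mono[OF has_sum_infsum total close])
    show "(\<lambda>y. \<bar>a y - q y * g y / \<tau>\<bar>) summable_on UNIV"
      by (rule summable_on_comparison_test[OF has_sum_imp_summable[OF total] close]) simp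
  qed
  also have "\<dots> = K * (M - V) + 1 - \<tau>" using \<tau>C r(2) by (simp add: algebra_simps)
  \<comment> \<open>The first term is at most \<open>2 * \<epsilon> / 9\<close> and
    \<open>1 - \<tau>\<close> at most \<open>5 * \<epsilon> / 18\<close>, together
    \<open>\<epsilon> / 2\<close>.\<close>
  also have "\<dots> \<le> \<epsilon>" using KMV C \<tau>C \<epsilon> by linarith
  finally show "infsum (\<lambda>y. \<bar>a y - q y * g y / infsum g UNIV\<bar>) UNIV \<le> \<epsilon>"
    by (simp only: \<tau>_def)
qed

text \<open>The signs \<open>q\<close> of \<open>x\<close> and \<open>\<sigma>\<close> of
  \<open>T x\<close> are continuous because they come from clopen sets, so multiplying by them
  yields an atomic family again. It is compensated, normalized and given its signs back; outside
  \<open>Up\<close> and \<open>Dn\<close> the operator stays unchanged.\<close>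

lemma operator_perturbation:
  fixes T :: "C_omega1 \<Rightarrow>\<^sub>L C_omega1"
    and x :: "C_omega1"
  assumes \<epsilon>: "0 < \<epsilon>" "\<epsilon> < 1" and T: "numerical_radius T = 1" and x: "norm x \<le> 1"
    and P: "clopen P" "{y. apply_bcontfun x y \<ge> 1 - \<epsilon> / 2} \<subseteq> P" "P \<subseteq> {y. apply_bcontfun x y > 0}"
    and N: "clopen N" "{y. - apply_bcontfun x y \<ge> 1 - \<epsilon> / 2} \<subseteq> N" "N \<subseteq> {y. - apply_bcontfun x y > 0}"
    and Up: "clopen Up" "Up \<subseteq> {t. apply_bcontfun (blinfun_apply T x) t > 1 - \<epsilon>\<^sup>2 / 18}"
    and Dn: "clopen Dn" "Dn \<subseteq> {t. - apply_bcontfun (blinfun_apply T x) t > 1 - \<epsilon>\<^sup>2 / 18}"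
    and x0: "\<And>y. y \<in> P \<Longrightarrow> apply_bcontfun x0 y = 1" "\<And>y. y \<in> N \<Longrightarrow> apply_bcontfun x0 y = -1"
  obtains T0 :: "C_omega1 \<Rightarrow>\<^sub>L C_omega1"
  where "numerical_radius T0 \<le> 1" "numerical_radius (T - T0) \<le> \<epsilon>"
    "\<And>t. t \<in> Up \<Longrightarrow> apply_bcontfun (blinfun_apply T0 x0) t = 1"
    "\<And>t. t \<in> Dn \<Longrightarrow> apply_bcontfun (blinfun_apply T0 x0) t = -1"
proof -
  let ?X = "apply_bcontfun x"
  obtain a where a: "atomic_family a"
    and Ta: "\<And>f t. apply_bcontfun (blinfun_apply T f) t = infsum (\<lambda>y. a t y * apply_bcontfun f y) UNIV"
    using operator_weights[OF T] by metis
  have sum_a: "a t summable_on UNIV" and norm_a: "infsum (\<lambda>y. \<bar>a t y\<bar>) UNIV \<le> 1" for t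
    using a by (auto simp: atomic_family_def)
  have X: "\<bar>?X y\<bar> \<le> 1" for y using norm_bounded[of x y] x by simp
  define q :: "omega1_interval \<Rightarrow> real" where "q y = indicator P y - indicator N y" for y
  define \<sigma> :: "omega1_interval \<Rightarrow> real" where "\<sigma> t = indicator Up t - indicator Dn t" for t
  define U where "U = Up \<union> Dn"
  have disj: "P \<inter> N = {}" using P(3) N(3) by fastforce
  have small: "\<epsilon>\<^sup>2 < 1" using \<epsilon> by (simp add: power_less_one_iff)
  have disjU: "Up \<inter> Dn = {}" using Up(2) Dn(2) small by fastforce
  have q: "q y = 1 \<and> ?X y > 0 \<or> q y = -1 \<and> ?X y < 0 \<or> q y = 0 \<and> \<bar>?X y\<bar> \<le> 1 - \<epsilon> / 2" for y
  proof -
    consider "y \<in> P" "y \<notin> N" | "y \<notin> P" "y \<in> N" | "y \<notin> P" "y \<notin> N" using disj by blast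
    then show ?thesis
    proof cases
      case 1
      then show ?thesis using P(3) by (auto simp: q_def)
    next
      case 2
      then show ?thesis using N(3) by (auto simp: q_def)
    next
      case 3
      then have "\<not> ?X y \<ge> 1 - \<epsilon> / 2" "\<not> - ?X y \<ge> 1 - \<epsilon> / 2" using P(2) N(2) by blast+
      then have "\<bar>?X y\<bar> \<le> 1 - \<epsilon> / 2" by linarith
      then show ?thesis using 3 by (simp add: q_def)
    qed
  qed
  have \<sigma>Up: "\<sigma> t = 1" if "t \<in> Up" for t
  proof -
    have "t \<notin> Dn" using that disjU by blast
    then show ?thesis using that by (simp add: \<sigma>_def)
  qed
  have \<sigma>Dn: "\<sigma> t = -1" if "t \<in> Dn" for t
  proof -
    have "t \<notin> Up" using that disjU by blast
    then show ?thesis using that by (simp add: \<sigma>_def)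
  qed
  have \<sigma>: "\<sigma> t = 1 \<or> \<sigma> t = -1" if "t \<in> U" for t
    using that \<sigma>Up \<sigma>Dn unfolding U_def by blast
  have \<sigma>_le: "\<bar>\<sigma> t\<bar> \<le> 1" for t by (auto simp: \<sigma>_def indicator_def)
  have q_le: "\<bar>q y\<bar> \<le> 1" for y by (auto simp: q_def indicator_def)
  have q_cont: "continuous_on UNIV q" and \<sigma>_cont: "continuous_on UNIV \<sigma>"
    unfolding q_def[abs_def] \<sigma>_def[abs_def]
    using P(1) N(1) Up(1) Dn(1) by (auto intro!: continuous_intros continuous_on_indicator_clopen)
  define c where "c t y = q y * (\<sigma> t * a t y)" for t y
  have c_le: "\<bar>c t y\<bar> \<le> \<bar>a t y\<bar>" for t y
    unfolding c_def abs_mult mult.assoc[symmetric]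
    using mult_mono[OF q_le[of y] \<sigma>_le[of t]] by (intro mult_left_le_one_le) (auto simp: mult_le_one)
  have abs_a: "(\<lambda>y. \<bar>a t y\<bar>) summable_on UNIV" for t using sum_a by (simp add: summable_on_abs_iff)
  have sum_c: "c t summable_on UNIV" for t by (rule summable_on_dominated[OF abs_a c_le])
  have "infsum (\<lambda>y. \<bar>c t y\<bar>) UNIV \<le> 1" for t
  proof -
    have "infsum (\<lambda>y. \<bar>c t y\<bar>) UNIV \<le> infsum (\<lambda>y. \<bar>a t y\<bar>) UNIV"
      using sum_c abs_a c_le by (intro infsum_mono) (simp_all add: summable_on_abs_iff)
    then show ?thesis using norm_a[of t] by linarith
  qed
  moreover have "continuous_on UNIV (\<lambda>t. infsum (c t) {..d})" for d
  proof -
    have "infsum (c t) {..d} = \<sigma> t * infsum (\<lambda>y. a t y * (q y * indicator {..d} y)) UNIV" for t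
    proof -
      have "infsum (c t) {..d} = infsum (\<lambda>y. \<sigma> t * (a t y * (q y * indicator {..d} y))) UNIV"
        by (rule infsum_cong_neutral) (auto simp: c_def)
      then show ?thesis by (simp only: infsum_cmult_right')
    qed
    moreover have "continuous_on UNIV (\<lambda>y. q y * indicator {..d} y)"
      by (intro continuous_intros q_cont continuous_on_indicator_clopen clopen_atMost)
    ultimately show ?thesis
      using \<sigma>_cont atomic_family_pairing[OF a] by (simp add: continuous_intros)
  qed
  ultimately have "atomic_family c" using sum_c by (simp add: atomic_family_def)
  then obtain g where g: "atomic_family g" "\<And>t y. 0 \<le> g t y" "\<And>t y. g t y \<le> max 0 (c t y)"
    "\<And>t. infsum (g t) UNIV = max 0 (infsum (c t) UNIV)"
    by (rule atomic_family_compensation) metis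
  define \<tau> where "\<tau> t = infsum (g t) UNIV" for t
  have sum_g: "g t summable_on UNIV" for t using g(1) by (simp add: atomic_family_def)
  have U: "1 / 2 \<le> \<tau> t" "\<tau> t \<le> 1" "infsum (\<lambda>y. \<bar>\<sigma> t * a t y - q y * g t y / \<tau> t\<bar>) UNIV \<le> \<epsilon>"
    if t: "t \<in> U" for t
  proof -
    have \<sigma>a: "(\<lambda>y. \<sigma> t * a t y) summable_on UNIV" using sum_a by (rule summable_on_cmult_right)
    have "infsum (\<lambda>y. \<bar>\<sigma> t * a t y\<bar>) UNIV \<le> 1"
      using \<sigma>[OF t] norm_a[of t] by (auto simp: abs_mult)
    moreover have "infsum (\<lambda>y. \<sigma> t * a t y * ?X y) UNIV = \<sigma> t * apply_bcontfun (blinfun_apply T x) t"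
      by (simp only: mult.assoc infsum_cmult_right' Ta)
    then have "infsum (\<lambda>y. \<sigma> t * a t y * ?X y) UNIV \<ge> 1 - \<epsilon>\<^sup>2 / 18"
      using t Up(2) Dn(2) \<sigma>Up[of t] \<sigma>Dn[of t] unfolding U_def by fastforce
    moreover have "infsum (g t) UNIV = max 0 (infsum (\<lambda>y. q y * (\<sigma> t * a t y)) UNIV)"
      unfolding g(4) by (simp only: c_def[abs_def])
    ultimately show "1 / 2 \<le> \<tau> t" "\<tau> t \<le> 1"
      "infsum (\<lambda>y. \<bar>\<sigma> t * a t y - q y * g t y / \<tau> t\<bar>) UNIV \<le> \<epsilon>"
      unfolding \<tau>_def using compensation_close[OF \<epsilon> \<sigma>a _ X q _ g(2) g(3)[of t, unfolded c_def]] by blast+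
  qed
  have clopenU: "clopen U" using Up(1) Dn(1) by (auto simp: U_def)
  \<comment> \<open>\<open>\<tau>\<close> may vanish off \<open>U\<close>. The lower bound
    \<open>1 / 2\<close>, which holds on \<open>U\<close> anyway, keeps the quotient continuous
    everywhere.\<close>
  define F where "F t y = (if t \<in> U then \<sigma> t / max (1 / 2) (\<tau> t) * (g t y * q y) else a t y)" for t y
  have FU: "F t y = \<sigma> t * (q y * g t y / \<tau> t)" if "t \<in> U" for t y
    using U(1)[OF that] that by (simp add: F_def max_def)
  have sum_F: "F t summable_on UNIV" for t
  proof (cases "t \<in> U")
    case True
    have "(\<lambda>y. \<sigma> t / max (1 / 2) (\<tau> t) * (g t y * q y)) summable_on UNIV"
      by (intro summable_on_cmult_right summable_on_mult_bounded[OF sum_g q_le])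
    then show ?thesis using True by (simp add: F_def[abs_def])
  next
    case False
    then show ?thesis using sum_a by (simp add: F_def[abs_def])
  qed
  have norm_F: "infsum (\<lambda>y. \<bar>F t y\<bar>) UNIV \<le> 1" for t
  proof (cases "t \<in> U")
    case True
    have "\<bar>F t y\<bar> \<le> inverse (\<tau> t) * g t y" for y
    proof -
      have nonneg: "0 \<le> inverse (\<tau> t) * g t y" using U(1)[OF True] g(2) by (intro mult_nonneg_nonneg) auto
      have "\<bar>\<sigma> t\<bar> = 1" using \<sigma>[OF True] by fastforce
      moreover have "F t y = \<sigma> t * (q y * (inverse (\<tau> t) * g t y))"
        unfolding FU[OF True] by (simp add: divide_inverse mult_ac)
      ultimately have "\<bar>F t y\<bar> = \<bar>q y\<bar> * (inverse (\<tau> t) * g t y)"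
        by (simp only: abs_mult[of "\<sigma> t"] abs_mult[of "q y"] abs_of_nonneg[OF nonneg] mult_1)
      also have "\<dots> \<le> 1 * (inverse (\<tau> t) * g t y)" using q_le nonneg by (rule mult_right_mono)
      finally show ?thesis by simp
    qed
    then have "infsum (\<lambda>y. \<bar>F t y\<bar>) UNIV \<le> infsum (\<lambda>y. inverse (\<tau> t) * g t y) UNIV"
      using sum_F sum_g by (intro infsum_mono) (auto simp: summable_on_abs_iff summable_on_cmult_right)
    also have "\<dots> = inverse (\<tau> t) * \<tau> t" unfolding \<tau>_def by (rule infsum_cmult_right')
    finally show ?thesis using U(1)[OF True] by simp
  next
    case False
    then show ?thesis using norm_a by (simp add: F_def)
  qed
  have cont_F: "continuous_on UNIV (\<lambda>t. infsum (\<lambda>y. F t y * f y) UNIV)" if f: "continuous_on UNIV f" for f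
  proof -
    have "infsum (\<lambda>y. F t y * f y) UNIV = (if t \<in> U
        then \<sigma> t / max (1 / 2) (\<tau> t) * infsum (\<lambda>y. g t y * (q y * f y)) UNIV
        else infsum (\<lambda>y. a t y * f y) UNIV)" for t
      by (simp add: F_def infsum_cmult_right'[symmetric] mult.assoc del: infsum_cmult_right')
    moreover have "continuous_on UNIV \<tau>"
      unfolding \<tau>_def[abs_def] using atomic_family_clopen[OF g(1), of UNIV] by simp
    moreover have "continuous_on UNIV (\<lambda>t. infsum (\<lambda>y. g t y * (q y * f y)) UNIV)"
      by (intro atomic_family_pairing g(1) continuous_intros q_cont f)
    ultimately show ?thesis
      using clopenU atomic_family_pairing[OF a f] \<sigma>_cont
      by (auto intro!: continuous_on_if_clopen continuous_intros)
  qed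
  from weights_operator[of F, OF sum_F norm_F cont_F]
  obtain T0 :: "C_omega1 \<Rightarrow>\<^sub>L C_omega1"
    where T0: "\<And>f t. apply_bcontfun (blinfun_apply T0 f) t = infsum (\<lambda>y. F t y * apply_bcontfun f y) UNIV"
    by blast
  have f_le: "\<bar>apply_bcontfun f y\<bar> \<le> 1" if "norm f \<le> 1" for f :: "C_omega1" and y
    using norm_bounded[of f y] that by simp
  have "numerical_radius T0 \<le> 1"
  proof (rule numerical_radius_le)
    fix f :: "C_omega1" and t
    assume f: "norm f \<le> 1"
    have "\<bar>infsum (\<lambda>y. F t y * apply_bcontfun f y) UNIV\<bar> \<le> infsum (\<lambda>y. \<bar>F t y\<bar>) UNIV * 1"
      by (rule pairing_bound[OF sum_F f_le[OF f]])
    then show "\<bar>apply_bcontfun (blinfun_apply T0 f) t\<bar> \<le> 1"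
      using norm_F[of t] by (simp add: T0)
  qed
  moreover have "numerical_radius (T - T0) \<le> \<epsilon>"
  proof (rule numerical_radius_le)
    fix f :: "C_omega1" and t
    assume f: "norm f \<le> 1"
    have "apply_bcontfun (blinfun_apply (T - T0) f) t
        = infsum (\<lambda>y. a t y * apply_bcontfun f y) UNIV - infsum (\<lambda>y. F t y * apply_bcontfun f y) UNIV"
      by (simp add: blinfun.diff_left minus_bcontfun.rep_eq Ta T0)
    also have "\<dots> = infsum (\<lambda>y. a t y * apply_bcontfun f y + - (F t y * apply_bcontfun f y)) UNIV"
      by (subst infsum_add)
        (auto simp: infsum_uminus summable_on_uminus intro!: summable_on_mult_bounded[OF sum_a f_le[OF f]]
          summable_on_mult_bounded[OF sum_F f_le[OF f]])
    also have "\<dots> = infsum (\<lambda>y. (a t y - F t y) * apply_bcontfun f y) UNIV"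
      by (simp add: left_diff_distrib)
    finally have eq: "apply_bcontfun (blinfun_apply (T - T0) f) t
        = infsum (\<lambda>y. (a t y - F t y) * apply_bcontfun f y) UNIV" .
    have "(\<lambda>y. a t y + - F t y) summable_on UNIV"
      by (intro summable_on_add sum_a) (simp add: summable_on_uminus sum_F)
    then have "\<bar>apply_bcontfun (blinfun_apply (T - T0) f) t\<bar> \<le> infsum (\<lambda>y. \<bar>a t y - F t y\<bar>) UNIV * 1"
      unfolding eq using f_le[OF f] by (intro pairing_bound) simp_all
    also have "\<dots> \<le> \<epsilon>"
    proof (cases "t \<in> U")
      case True
      have "\<bar>a t y - F t y\<bar> = \<bar>\<sigma> t * a t y - q y * g t y / \<tau> t\<bar>" for y
        using \<sigma>[OF True] by (auto simp: FU[OF True])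
      then show ?thesis using U(3)[OF True] by simp
    next
      case False
      then show ?thesis using \<epsilon> by (simp add: F_def)
    qed
    finally show "\<bar>apply_bcontfun (blinfun_apply (T - T0) f) t\<bar> \<le> \<epsilon>" .
  qed
  moreover have x0T: "apply_bcontfun (blinfun_apply T0 x0) t = \<sigma> t" if t: "t \<in> U" for t
  proof -
    \<comment> \<open>Where \<open>g t y\<close> is not 0, the sign \<open>q y\<close> is nonzero
      and equals the value of \<open>x0\<close>, so their product is 1.\<close>
    have "F t y * apply_bcontfun x0 y = \<sigma> t / \<tau> t * g t y" for y
    proof -
      consider "y \<in> P" "y \<notin> N" | "y \<notin> P" "y \<in> N" | "q y = 0"
        using disj by (cases "y \<in> P"; cases "y \<in> N") (auto simp: q_def)
      then have "q y * g t y * apply_bcontfun x0 y = g t y"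
      proof cases
        case 3
        then have "g t y = 0" using g(2)[of t y] g(3)[of t y] by (simp add: c_def)
        then show ?thesis by simp
      qed (use x0 in \<open>auto simp: q_def\<close>)
      then show ?thesis unfolding FU[OF t] by (simp add: divide_inverse mult_ac)
    qed
    then have "apply_bcontfun (blinfun_apply T0 x0) t = infsum (\<lambda>y. \<sigma> t / \<tau> t * g t y) UNIV" by (simp add: T0)
    also have "\<dots> = \<sigma> t / \<tau> t * \<tau> t" unfolding \<tau>_def by (rule infsum_cmult_right')
    finally show ?thesis using U(1)[OF t] by simp
  qed
  moreover have "apply_bcontfun (blinfun_apply T0 x0) t = 1" if "t \<in> Up" for t
    using x0T[of t] that \<sigma>Up by (simp add: U_def)
  moreover have "apply_bcontfun (blinfun_apply T0 x0) t = -1" if "t \<in> Dn" for t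
    using x0T[of t] that \<sigma>Dn by (simp add: U_def)
  ultimately show ?thesis using that by blast
qed

text \<open>
  The functional of a state almost attaining the numerical radius is concentrated on the points where
  \<open>T x\<close> is close to the sign of its weight; it is restricted to them and normalized.
\<close>

lemma state_perturbation:
  fixes x :: "C_omega1" and x' :: "C_omega1 \<Rightarrow>\<^sub>L real"
  assumes \<kappa>: "0 < \<kappa>" "\<kappa> < 1" and x: "(x, x') \<in> states" and Y: "norm Y \<le> 1"
    and attain: "blinfun_apply x' Y \<ge> 1 - \<kappa>\<^sup>2"
    and Up: "{t. apply_bcontfun Y t \<ge> 1 - \<kappa>} \<subseteq> Up" and Dn: "{t. - apply_bcontfun Y t \<ge> 1 - \<kappa>} \<subseteq> Dn"
  obtains z' :: "C_omega1 \<Rightarrow>\<^sub>L real"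
  where "norm z' \<le> 1" "norm (x' - z') \<le> 2 * \<kappa>"
    "\<And>f. (\<And>t. t \<in> Up \<Longrightarrow> apply_bcontfun x t = 1 \<Longrightarrow> apply_bcontfun f t = 1) \<Longrightarrow>
      (\<And>t. t \<in> Dn \<Longrightarrow> apply_bcontfun x t = -1 \<Longrightarrow> apply_bcontfun f t = -1) \<Longrightarrow> blinfun_apply z' f = 1"
proof -
  let ?X = "apply_bcontfun x" and ?Y = "apply_bcontfun Y"
  have nx: "norm x = 1" "norm x' = 1" "blinfun_apply x' x = 1" using x by (auto simp: states_def)
  obtain b where b: "b summable_on UNIV" "infsum (\<lambda>y. \<bar>b y\<bar>) UNIV \<le> norm x'"
    and x'b: "\<And>f. blinfun_apply x' f = infsum (\<lambda>y. b y * apply_bcontfun f y) UNIV"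
    using functional_weights[of x'] by metis
  have X: "\<bar>?X y\<bar> \<le> 1" and Y': "\<bar>?Y y\<bar> \<le> 1" for y
    using norm_bounded[of x y] norm_bounded[of Y y] nx(1) Y by auto
  have abs_b: "(\<lambda>y. \<bar>b y\<bar>) summable_on S" for S
    using summable_on_UNIV_subset[OF b(1)] by (simp add: summable_on_abs_iff)
  have le: "b y * v \<le> \<bar>b y\<bar>" if "\<bar>v\<bar> \<le> 1" for y v
    using mult_left_mono[OF that abs_ge_zero[of "b y"]] abs_ge_self[of "b y * v"] by (simp add: abs_mult)
  have defect: "((\<lambda>y. \<bar>b y\<bar> + - (b y * f y)) has_sum
      (infsum (\<lambda>y. \<bar>b y\<bar>) UNIV + - infsum (\<lambda>y. b y * f y) UNIV)) UNIV" if "\<And>y. \<bar>f y\<bar> \<le> 1" for f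
    by (intro has_sum_add has_sum_uminusI has_sum_infsum abs_b summable_on_mult_bounded[OF b(1) that])
  \<comment> \<open>\<open>x'\<close> attains its norm at \<open>x\<close>: the nonnegative defects
    \<open>\<bar>b y\<bar> - b y * ?X y\<close> have sum at most 0, so each of them
    vanishes.\<close>
  have bX: "b y * ?X y = \<bar>b y\<bar>" for y
  proof -
    have "infsum (\<lambda>y. \<bar>b y\<bar>) UNIV + - infsum (\<lambda>y. b y * ?X y) UNIV \<le> 0"
      using b(2) nx x'b[of x] by simp
    then have "\<bar>b y\<bar> + - (b y * ?X y) = 0"
      using nonneg_has_sum_le_0D[OF defect[of ?X, OF X], of y] le[OF X] by simp
    then show ?thesis by simp
  qed
  have norm_b: "infsum (\<lambda>y. \<bar>b y\<bar>) UNIV = 1"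
    using nx(3) unfolding x'b bX .
  have bpos: "?X y = 1" if "b y > 0" for y using bX[of y] that by simp
  have bneg: "?X y = -1" if "b y < 0" for y
  proof -
    have "b y * ?X y = b y * (-1)" using bX[of y] that by simp
    then show ?thesis using that by (subst (asm) mult_cancel_left) simp
  qed
  define S where "S = {y. b y > 0 \<and> y \<in> Up \<or> b y < 0 \<and> y \<in> Dn}"
  define \<beta> where "\<beta> = infsum (\<lambda>y. \<bar>b y\<bar>) S"
  have split: "infsum (\<lambda>y. \<bar>b y\<bar>) (- S) = 1 - \<beta>"
    using infsum_split[OF abs_b, of UNIV S] norm_b by (simp add: \<beta>_def Compl_eq_Diff_UNIV)
  \<comment> \<open>Chebyshev's argument: off \<open>S\<close> each defect with respect to
    \<open>Y\<close> is at least \<open>\<kappa> * \<bar>b y\<bar>\<close>, and all defects together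
    are at most \<open>\<kappa>\<^sup>2\<close>.\<close>
  have "\<kappa> * infsum (\<lambda>y. \<bar>b y\<bar>) (- S) \<le> \<kappa>\<^sup>2"
  proof -
    have "\<kappa> * \<bar>b y\<bar> \<le> \<bar>b y\<bar> + - (b y * ?Y y)" if "y \<in> - S" for y
    proof -
      have "\<not> ?Y y \<ge> 1 - \<kappa>" if "b y > 0"
        using that \<open>y \<in> - S\<close> Up unfolding S_def by blast
      moreover have "\<not> - ?Y y \<ge> 1 - \<kappa>" if "b y < 0"
        using that \<open>y \<in> - S\<close> Dn unfolding S_def by blast
      ultimately consider "b y > 0" "?Y y < 1 - \<kappa>" | "b y < 0" "- ?Y y < 1 - \<kappa>" | "b y = 0"
        by (meson linorder_neqE_linordered_idom not_le)
      then show ?thesis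
      proof cases
        case 1
        then have "b y * ?Y y \<le> b y * (1 - \<kappa>)" by (intro mult_left_mono) auto
        then show ?thesis using 1 by (simp add: algebra_simps)
      next
        case 2
        then have "(- b y) * (- ?Y y) \<le> (- b y) * (1 - \<kappa>)" by (intro mult_left_mono) auto
        then show ?thesis using 2 by (simp add: algebra_simps)
      qed simp
    qed
    then have "infsum (\<lambda>y. \<kappa> * \<bar>b y\<bar>) (- S) \<le> infsum (\<lambda>y. \<bar>b y\<bar> + - (b y * ?Y y)) UNIV"
      using le[OF Y'] by (intro infsum_mono_neutral summable_on_cmult_right abs_b has_sum_imp_summable[OF defect[of ?Y, OF Y']]) auto
    also have "\<dots> = 1 + - blinfun_apply x' Y"
      unfolding x'b infsumI[OF defect[of ?Y, OF Y']] norm_b ..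
    also have "\<dots> \<le> \<kappa>\<^sup>2" using attain by simp
    finally show ?thesis by (simp only: infsum_cmult_right')
  qed
  then have "infsum (\<lambda>y. \<bar>b y\<bar>) (- S) \<le> \<kappa>" using \<kappa>(1) by (simp add: power2_eq_square)
  then have \<beta>: "\<beta> \<ge> 1 - \<kappa>" using split by simp
  then have \<beta>0: "\<beta> > 0" using \<kappa>(2) by simp
  have "0 \<le> infsum (\<lambda>y. \<bar>b y\<bar>) (- S)" by (rule infsum_nonneg) simp
  then have \<beta>1: "\<beta> \<le> 1" using split by simp
  define d where "d y = (if y \<in> S then inverse \<beta> * b y else 0)" for y
  have d_eq: "infsum (\<lambda>y. \<bar>d y\<bar>) UNIV = 1"
  proof -
    have "infsum (\<lambda>y. \<bar>d y\<bar>) UNIV = infsum (\<lambda>y. inverse \<beta> * \<bar>b y\<bar>) S"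
      using \<beta>0 by (intro infsum_cong_neutral) (auto simp: d_def abs_mult)
    also have "\<dots> = inverse \<beta> * \<beta>" unfolding \<beta>_def by (rule infsum_cmult_right')
    finally show ?thesis using \<beta>0 by simp
  qed
  have sum_d: "d summable_on UNIV"
    by (rule summable_on_dominated[of "\<lambda>y. inverse \<beta> * \<bar>b y\<bar>"])
      (use \<beta>0 in \<open>auto simp: d_def abs_mult intro: summable_on_cmult_right abs_b\<close>)
  obtain z' :: "C_omega1 \<Rightarrow>\<^sub>L real"
    where z': "\<And>f. blinfun_apply z' f = infsum (\<lambda>y. d y * apply_bcontfun f y) UNIV"
    using weights_functional[OF sum_d] by metis
  have f_le: "\<bar>apply_bcontfun f y\<bar> \<le> norm f" for f :: "C_omega1" and y
    using norm_bounded[of f y] by simp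
  have "norm z' \<le> 1"
  proof (rule norm_blinfun_bound)
    fix f
    have "\<bar>infsum (\<lambda>y. d y * apply_bcontfun f y) UNIV\<bar> \<le> infsum (\<lambda>y. \<bar>d y\<bar>) UNIV * norm f"
      by (rule pairing_bound[OF sum_d f_le])
    then show "norm (blinfun_apply z' f) \<le> 1 * norm f"
      unfolding z' d_eq by simp
  qed simp
  \<comment> \<open>Dropping the weights off \<open>S\<close> costs \<open>1 - \<beta>\<close>,
    normalizing the others costs \<open>1 - \<beta>\<close> again.\<close>
  moreover have "norm (x' - z') \<le> 2 * \<kappa>"
  proof (rule norm_blinfun_bound)
    fix f
    have sum_diff: "(\<lambda>y. b y + - d y) summable_on UNIV"
      by (intro summable_on_add b(1)) (simp add: summable_on_uminus sum_d)
    have "infsum (\<lambda>y. \<bar>b y + - d y\<bar>) UNIV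
        = infsum (\<lambda>y. \<bar>b y + - d y\<bar>) S + infsum (\<lambda>y. \<bar>b y + - d y\<bar>) (- S)"
      using infsum_split[of "\<lambda>y. \<bar>b y + - d y\<bar>" UNIV S] sum_diff
      by (simp add: summable_on_abs_iff Compl_eq_Diff_UNIV)
    also have "infsum (\<lambda>y. \<bar>b y + - d y\<bar>) S = infsum (\<lambda>y. (inverse \<beta> - 1) * \<bar>b y\<bar>) S"
    proof (rule infsum_cong)
      fix y assume "y \<in> S"
      then have "b y + - d y = - ((inverse \<beta> - 1) * b y)" by (simp add: d_def algebra_simps)
      moreover have "0 \<le> inverse \<beta> - 1" using \<beta>0 \<beta>1 by (simp add: one_le_inverse)
      ultimately show "\<bar>b y + - d y\<bar> = (inverse \<beta> - 1) * \<bar>b y\<bar>" by (simp add: abs_mult)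
    qed
    also have "\<dots> = (inverse \<beta> - 1) * \<beta>" unfolding \<beta>_def by (rule infsum_cmult_right')
    also have "\<dots> = 1 - \<beta>" using \<beta>0 by (simp add: left_diff_distrib)
    also have "infsum (\<lambda>y. \<bar>b y + - d y\<bar>) (- S) = infsum (\<lambda>y. \<bar>b y\<bar>) (- S)"
      by (rule infsum_cong) (simp add: d_def)
    finally have total: "infsum (\<lambda>y. \<bar>b y + - d y\<bar>) UNIV \<le> 2 * \<kappa>" using split \<beta> by simp
    have "blinfun_apply (x' - z') f = infsum (\<lambda>y. b y * apply_bcontfun f y + - (d y * apply_bcontfun f y)) UNIV"
      by (subst infsum_add) (auto simp: infsum_uminus summable_on_uminus blinfun.diff_left x'b z'
          intro!: summable_on_mult_bounded[OF b(1) f_le[of f]] summable_on_mult_bounded[OF sum_d f_le[of f]])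
    also have "\<dots> = infsum (\<lambda>y. (b y + - d y) * apply_bcontfun f y) UNIV"
      by (simp add: distrib_right left_diff_distrib)
    also have "\<bar>\<dots>\<bar> \<le> infsum (\<lambda>y. \<bar>b y + - d y\<bar>) UNIV * norm f"
      by (rule pairing_bound[OF sum_diff f_le])
    also have "\<dots> \<le> 2 * \<kappa> * norm f" using total by (rule mult_right_mono) simp
    finally show "norm (blinfun_apply (x' - z') f) \<le> 2 * \<kappa> * norm f" by simp
  qed (use \<kappa> in simp)
  moreover have "blinfun_apply z' f = 1"
    if f: "\<And>t. t \<in> Up \<Longrightarrow> ?X t = 1 \<Longrightarrow> apply_bcontfun f t = 1"
      "\<And>t. t \<in> Dn \<Longrightarrow> ?X t = -1 \<Longrightarrow> apply_bcontfun f t = -1" for f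
  proof -
    have "d y * apply_bcontfun f y = \<bar>d y\<bar>" for y
    proof (cases "y \<in> S")
      case True
      then consider "b y > 0" "y \<in> Up" | "b y < 0" "y \<in> Dn" by (auto simp: S_def)
      then show ?thesis
      proof cases
        case 1
        then show ?thesis using f(1) bpos True \<beta>0 by (simp add: d_def)
      next
        case 2
        then show ?thesis using f(2) bneg True \<beta>0 by (simp add: d_def abs_mult)
      qed
    qed (simp add: d_def)
    then show ?thesis using d_eq by (simp add: z')
  qed
  ultimately show ?thesis by (rule that)
qed

text \<open>\<open>Up\<close> and \<open>Dn\<close> serve operator and functional alike.
  \<open>T0 x0\<close> is 1 on \<open>Up\<close> and -1 on \<open>Dn\<close>, and \<open>x0\<close>
  agrees with \<open>x\<close> wherever \<open>x\<close> is 1 or -1, so \<open>z'\<close> takes the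
  value 1 at both \<open>T0 x0\<close> and \<open>x0\<close>.\<close>

lemma state_operator_perturbation:
  fixes T :: "C_omega1 \<Rightarrow>\<^sub>L C_omega1"
  assumes \<epsilon>: "0 < \<epsilon>" "\<epsilon> < 1" and T: "numerical_radius T = 1" and x: "(x, x') \<in> states"
    and attain: "blinfun_apply x' (blinfun_apply T x) \<ge> 1 - (\<epsilon>\<^sup>2 / 36)\<^sup>2"
  shows "\<exists>T0 x0 x0'. numerical_radius T0 = 1 \<and> (x0, x0') \<in> states \<and>
    blinfun_apply x0' (blinfun_apply T0 x0) = 1 \<and>
    numerical_radius (T - T0) \<le> \<epsilon> \<and> norm (x - x0) \<le> \<epsilon> \<and> norm (x' - x0') \<le> \<epsilon>"
proof -
  let ?X = "apply_bcontfun x" and ?Y = "apply_bcontfun (blinfun_apply T x)"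
  \<comment> \<open>Twice this is the tolerance \<open>\<epsilon>\<^sup>2 / 18\<close> for
    perturbing the operator, its square the one for perturbing the state; \<open>Up\<close> and
    \<open>Dn\<close> fit between the levels \<open>1 - \<kappa>\<close> and
    \<open>1 - 2 * \<kappa>\<close>.\<close>
  define \<kappa> where "\<kappa> = \<epsilon>\<^sup>2 / 36"
  have nx: "norm x = 1" using x by (simp add: states_def)
  have "\<epsilon>\<^sup>2 \<le> \<epsilon>" using \<epsilon> by (simp add: power2_eq_square mult_left_le)
  then have \<kappa>: "0 < \<kappa>" "\<kappa> < 1" "2 * \<kappa> \<le> \<epsilon>" "\<epsilon>\<^sup>2 / 18 = 2 * \<kappa>" using \<epsilon> by (auto simp: \<kappa>_def)
  have X: "\<bar>?X y\<bar> \<le> 1" for y using norm_bounded[of x y] nx by simp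
  have Y: "norm (blinfun_apply T x) \<le> 1"
    using numerical_radius_bound[of x T] nx T by (intro norm_bound) simp
  have cX: "continuous_on UNIV ?X" "continuous_on UNIV (\<lambda>y. - ?X y)"
    and cY: "continuous_on UNIV ?Y" "continuous_on UNIV (\<lambda>y. - ?Y y)"
    by (auto intro: continuous_on_minus)
  have lt: "1 - \<epsilon> < 1 - \<epsilon> / 2" "1 - \<epsilon>\<^sup>2 / 18 < 1 - \<kappa>" using \<epsilon> \<kappa> by auto
  obtain P where P: "clopen P" "{y. ?X y \<ge> 1 - \<epsilon> / 2} \<subseteq> P" "P \<subseteq> {y. ?X y > 1 - \<epsilon>}"
    by (rule continuous_clopen_separation[OF cX(1) lt(1)])
  obtain N where N: "clopen N" "{y. - ?X y \<ge> 1 - \<epsilon> / 2} \<subseteq> N" "N \<subseteq> {y. - ?X y > 1 - \<epsilon>}"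
    by (rule continuous_clopen_separation[OF cX(2) lt(1)])
  obtain Up where Up: "clopen Up" "{t. ?Y t \<ge> 1 - \<kappa>} \<subseteq> Up" "Up \<subseteq> {t. ?Y t > 1 - \<epsilon>\<^sup>2 / 18}"
    by (rule continuous_clopen_separation[OF cY(1) lt(2)])
  obtain Dn where Dn: "clopen Dn" "{t. - ?Y t \<ge> 1 - \<kappa>} \<subseteq> Dn" "Dn \<subseteq> {t. - ?Y t > 1 - \<epsilon>\<^sup>2 / 18}"
    by (rule continuous_clopen_separation[OF cY(2) lt(2)])
  have P0: "P \<subseteq> {y. ?X y > 0}" and N0: "N \<subseteq> {y. - ?X y > 0}" using P(3) N(3) \<epsilon>(2) by fastforce+
  then have disj: "y \<notin> P" if "y \<in> N" for y using that by fastforce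
  define x0 where "x0 = Bcontfun (\<lambda>y. if y \<in> P then 1 else if y \<in> N then -1 else ?X y)"
  have x0: "apply_bcontfun x0 = (\<lambda>y. if y \<in> P then 1 else if y \<in> N then -1 else ?X y)"
    unfolding x0_def using P(1) N(1) cX(1) by (intro apply_Bcontfun continuous_on_if_clopen) auto
  have x0PN: "\<And>y. y \<in> P \<Longrightarrow> apply_bcontfun x0 y = 1" "\<And>y. y \<in> N \<Longrightarrow> apply_bcontfun x0 y = -1"
    using disj by (auto simp: x0)
  obtain T0 :: "C_omega1 \<Rightarrow>\<^sub>L C_omega1"
    where T0: "numerical_radius T0 \<le> 1" "numerical_radius (T - T0) \<le> \<epsilon>"
      "\<And>t. t \<in> Up \<Longrightarrow> apply_bcontfun (blinfun_apply T0 x0) t = 1"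
      "\<And>t. t \<in> Dn \<Longrightarrow> apply_bcontfun (blinfun_apply T0 x0) t = -1"
    using operator_perturbation[OF \<epsilon> T eq_refl[OF nx] P(1,2) P0 N(1,2) N0 Up(1,3) Dn(1,3) x0PN] by metis
  obtain z' :: "C_omega1 \<Rightarrow>\<^sub>L real"
    where z': "norm z' \<le> 1" "norm (x' - z') \<le> 2 * \<kappa>"
      "\<And>f. (\<And>t. t \<in> Up \<Longrightarrow> ?X t = 1 \<Longrightarrow> apply_bcontfun f t = 1) \<Longrightarrow>
        (\<And>t. t \<in> Dn \<Longrightarrow> ?X t = -1 \<Longrightarrow> apply_bcontfun f t = -1) \<Longrightarrow> blinfun_apply z' f = 1"
    using state_perturbation[OF \<kappa>(1,2) x Y attain[folded \<kappa>_def] Up(2) Dn(2)] by metis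
  have z'T0: "blinfun_apply z' (blinfun_apply T0 x0) = 1" using T0(3,4) by (intro z'(3)) auto
  have z'x0: "blinfun_apply z' x0 = 1"
  proof (rule z'(3))
    show "apply_bcontfun x0 t = 1" if "?X t = 1" for t
      using P(2) that \<epsilon>(1) by (intro x0PN(1)) auto
    show "apply_bcontfun x0 t = -1" if "?X t = -1" for t
      using N(2) that \<epsilon>(1) by (intro x0PN(2)) auto
  qed
  have x0_le: "norm x0 \<le> 1" by (rule norm_bound) (use X in \<open>auto simp: x0\<close>)
  \<comment> \<open>Both norms are at most 1, so the value 1 of \<open>z'\<close> at
    \<open>x0\<close> forces both to equal 1.\<close>
  have "1 \<le> norm z' * norm x0" using norm_blinfun[of z' x0] z'x0 by simp
  moreover have "norm z' * norm x0 \<le> norm z'" "norm z' * norm x0 \<le> norm x0"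
    using x0_le z'(1) by (auto intro: mult_left_le mult_left_le_one_le)
  ultimately have states: "(x0, z') \<in> states" using x0_le z'(1) z'x0 by (simp add: states_def)
  have "numerical_radius T0 = 1"
    using numerical_radius_upper[OF states, of T0] T0(1) z'T0 by simp
  moreover have "norm (x - x0) \<le> \<epsilon>"
  proof (rule norm_bound)
    fix y
    have "\<bar>?X y - apply_bcontfun x0 y\<bar> \<le> \<epsilon>"
    proof -
      consider "y \<in> P" | "y \<notin> P" "y \<in> N" | "y \<notin> P" "y \<notin> N" by blast
      then show ?thesis
      proof cases
        case 1
        then have "?X y > 1 - \<epsilon>" using P(3) by blast
        then show ?thesis using 1 X[of y] by (simp add: x0)
      next
        case 2
        then have "- ?X y > 1 - \<epsilon>" using N(3) by blast
        then show ?thesis using 2 X[of y] by (simp add: x0)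
      qed (use \<epsilon> in \<open>simp add: x0\<close>)
    qed
    then show "norm (apply_bcontfun (x - x0) y) \<le> \<epsilon>" by (simp add: minus_bcontfun.rep_eq)
  qed
  moreover have "norm (x' - z') \<le> \<epsilon>" using z'(2) \<kappa>(3) by simp
  ultimately show ?thesis using states z'T0 T0(2) by blast
qed

theorem theorem4p11:
  shows "admits_local_compensation TYPE(omega1_interval) \<and>
    BPB_numerical_radius TYPE(omega1_interval \<Rightarrow>\<^sub>C real)"
proof
  show "admits_local_compensation TYPE(omega1_interval)"
    by (rule omega1_interval_local_compensation)
  have "(\<epsilon>\<^sup>2 / 36)\<^sup>2 \<in> {0<..<1}" if "\<epsilon> \<in> {0<..<1}" for \<epsilon> :: real
  proof -
    have "0 < \<epsilon>\<^sup>2 / 36" "\<epsilon>\<^sup>2 / 36 < 1" using that power_less_one_iff[of \<epsilon> 2] by auto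
    then show ?thesis by (simp only: greaterThanLessThan_iff zero_less_power power_less_one_iff) simp
  qed
  then show "BPB_numerical_radius TYPE(omega1_interval \<Rightarrow>\<^sub>C real)"
    unfolding BPB_numerical_radius_def
    by (intro exI[of _ "\<lambda>\<epsilon>. (\<epsilon>\<^sup>2 / 36)\<^sup>2"] conjI ballI allI impI state_operator_perturbation) auto
qed

end
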